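(* Suppose $|y|\le M$ almost surely and $f^*=L^r u^*$ for some $\frac12\le r\le2$ and $u^*\in L^2_{\rho_{\mathcal X}}$. Then there exists a constant $\bar C$, independent of $m$, of $|D_1|,\dots,|D_m|$ and of $\lambda$, such that for every $0<\lambda\le1$, $$\mathbf E\left[\|\overline f_{D,\lambda}^\sharp-f^*\|_{L^2_{\rho_{\mathcal X}}}^2\right]\le\bar C\sum_{j=1}^m\frac{|D_j|}{|D|}\left(\frac{\mathcal B_{|D_j|,\lambda}}{\sqrt\lambda}+1\right)^6\left(\frac{|D_j|}{|D|}\mathcal B^2_{|D_j|,\lambda}+\frac{\lambda^2\mathcal N(\lambda)}{|D_j|}+\lambda^{2r}\right).$$
   Context: Setting. $\mathcal X$ is a compact metric space, $\rho$ is a Borel probability measure on $\mathcal X\times\mathbb R$ with marginal $\rho_{\mathcal X}$ on $\mathcal X$, and $f^*(x)=\mathbf E[y\mid x]$ (i.e. $y=f^*(x)+\epsilon$ with zero-mean noise). $K:\mathcal X\times\mathcal X\to\mathbb R$ is a Mercer kernel (continuous, symmetric, positive semidefinite), $\mathcal H_K$ its reproducing kernel Hilbert space with norm $\|\cdot\|_K$, $K_x=K(x,\cdot)$, and $\kappa=\max\{1,\sup_{x}\sqrt{K(x,x)}\}$. The integral operator $Lf(x)=\int_{\mathcal X}K(x,t)f(t)\,d\rho_{\mathcal X}(t)$ is compact, self-adjoint and positive on $L^2_{\rho_{\mathcal X}}$; $L_K$ denotes its restriction to $\mathcal H_K$. Powers of operators are defined by spectral calculus. For $r\ge\frac12$,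 $f^*=L^ru^*$ lies in $\mathcal H_K$ and is identified with its representative there. Estimator on one data set. For a sample $D=\{(x_i,y_i)\}_{i=1}^{|D|}$ with $\mathbf y_D=(y_1,\dots,y_{|D|})^\top$, let $S_D:\mathcal H_K\to\mathbb R^{|D|}$, $S_Df=(f(x_1),\dots,f(x_{|D|}))^\top$, $S_D^*\mathbf c=\sum_i c_iK_{x_i}$, $L_{K,D}=\frac1{|D|}S_D^*S_D$, $f_{D,\lambda}=(\lambda I+L_{K,D})^{-1}\frac1{|D|}S_D^*\mathbf y_D$, and $f_{D,\lambda}^\sharp=f_{D,\lambda}+\lambda(\lambda I+L_{K,D})^{-1}f_{D,\lambda}$ (the bias corrected regularization kernel network, BCRKN). Distributed estimator. The sample $D$, drawn i.i.d. from $\rho$, is split into $m$ disjoint nonempty blocks $D_1,\dots,D_m$ (with sizes not depending on the data, not necessarily equal), and $\overline f_{D,\lambda}^\sharp=\sum_{j=1}^m\frac{|D_j|}{|D|}f_{D_j,\lambda}^\sharp$. Complexity. $\mathcal N(\lambda)=\mathrm{Tr}((L_K+\lambda I)^{-1}L_K)$ and $\mathcal B_{n,\lambda}=\frac{2\kappa}{\sqrt n}\left\{\frac{\kappa}{\sqrt{n\lambda}}+\sqrt{\mathcal N(\lambda)}\right\}$. *)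

theory Defs
  imports "HOL-Probability.Probability"
begin

section \<open>Compact metric spaces\<close>

class compact_metric_space = metric_space +
  assumes compact_UNIV: "compact (UNIV :: 'a set)"

instance compact_metric_space \<subseteq> polish_space
proof
  show "convergent X" if "Cauchy X" for X :: "nat \<Rightarrow> 'a"
    using compact_imp_complete[OF compact_UNIV] that
    unfolding complete_def convergent_def by auto
next
  have "\<exists>k. finite k \<and> (\<Union>x\<in>k. ball x (1 / real (Suc n))) = (UNIV :: 'a set)" for n
  proof -
    obtain k :: "'a set" where "finite k" "UNIV \<subseteq> (\<Union>x\<in>k. ball x (1 / real (Suc n)))"
      using compact_eq_totally_bounded[of "UNIV :: 'a set"] compact_UNIV
      by (metis of_nat_0_less_iff zero_less_Suc zero_less_divide_1_iff)
    then show ?thesis by auto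
  qed
  then obtain k :: "nat \<Rightarrow> 'a set" where
    k: "\<And>n. finite (k n)" "\<And>n. (\<Union>x\<in>k n. ball x (1 / real (Suc n))) = UNIV"
    by metis
  define B where "B = (\<Union>n. (\<lambda>x. ball x (1 / real (Suc n))) ` k n)"
  have "countable B"
    unfolding B_def using k(1) by (intro countable_UN) (auto intro: countable_finite)
  moreover have "topological_basis B"
  proof (rule topological_basisI)
    show "open b" if "b \<in> B" for b using that unfolding B_def by auto
  next
    fix U :: "'a set" and x assume "open U" "x \<in> U"
    then obtain e where e: "e > 0" "ball x e \<subseteq> U" using open_contains_ball by blast
    obtain n where n: "1 / real (Suc n) < e / 2"
      using e(1) by (metis half_gt_zero inverse_eq_divide reals_Archimedean)
    obtain y where y: "y \<in> k n" "x \<in> ball y (1 / real (Suc n))" using k(2)[of n] by blast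
    have "ball y (1 / real (Suc n)) \<subseteq> ball x e"
    proof
      fix z assume z: "z \<in> ball y (1 / real (Suc n))"
      have "dist x z \<le> dist y x + dist y z" by (metis dist_commute dist_triangle2)
      then show "z \<in> ball x e" using z y(2) n by (simp only: mem_ball)
    qed
    then show "\<exists>b\<in>B. x \<in> b \<and> b \<subseteq> U" using y e(2) unfolding B_def by blast
  qed
  ultimately show "\<exists>B :: 'a set set. countable B \<and> open = generate_topology B"
    using topological_basis_imp_subbasis by blast
qed

section \<open>Mercer kernels and reproducing kernel Hilbert spaces\<close>

definition mercer_kernel :: "('a::topological_space \<Rightarrow> 'a \<Rightarrow> real) \<Rightarrow> bool" where
  "mercer_kernel K \<longleftrightarrow>
     continuous_on UNIV (\<lambda>(x, t). K x t) \<and>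
     (\<forall>x t. K x t = K t x) \<and>
     (\<forall>A c. finite A \<longrightarrow> (\<Sum>x\<in>A. \<Sum>t\<in>A. c x * c t * K x t) \<ge> 0)"

text \<open>
  The set \<open>H\<close> of functions with inner product \<open>ip\<close> is the reproducing kernel Hilbert space of
  \<open>K\<close>. By the Moore-Aronszajn theorem \<open>K\<close> determines \<open>H\<close> and the values of \<open>ip\<close> on \<open>H\<close>;
  nothing is assumed about \<open>ip\<close> outside \<open>H\<close>.
\<close>

locale rkhs =
  fixes K :: "'a \<Rightarrow> 'a \<Rightarrow> real"
    and H :: "('a \<Rightarrow> real) set"
    and ip :: "('a \<Rightarrow> real) \<Rightarrow> ('a \<Rightarrow> real) \<Rightarrow> real"
  assumes zero_mem: "(\<lambda>x. 0) \<in> H"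
    and add_mem: "\<lbrakk>f \<in> H; g \<in> H\<rbrakk> \<Longrightarrow> (\<lambda>x. f x + g x) \<in> H"
    and scale_mem: "f \<in> H \<Longrightarrow> (\<lambda>x. c * f x) \<in> H"
    and ip_commute: "\<lbrakk>f \<in> H; g \<in> H\<rbrakk> \<Longrightarrow> ip f g = ip g f"
    and ip_add: "\<lbrakk>f \<in> H; g \<in> H; h \<in> H\<rbrakk> \<Longrightarrow> ip (\<lambda>x. f x + g x) h = ip f h + ip g h"
    and ip_scale: "\<lbrakk>f \<in> H; h \<in> H\<rbrakk> \<Longrightarrow> ip (\<lambda>x. c * f x) h = c * ip f h"
    and ip_nonneg: "f \<in> H \<Longrightarrow> ip f f \<ge> 0"
    and ip_definite: "\<lbrakk>f \<in> H; ip f f = 0\<rbrakk> \<Longrightarrow> f = (\<lambda>x. 0)"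
    and complete:
      "\<lbrakk>\<And>n :: nat. F n \<in> H;
        \<And>e. e > 0 \<Longrightarrow>
          \<exists>N. \<forall>m\<ge>N. \<forall>n\<ge>N. sqrt (ip (\<lambda>x. F m x - F n x) (\<lambda>x. F m x - F n x)) < e\<rbrakk> \<Longrightarrow>
        \<exists>f\<in>H. (\<lambda>n. sqrt (ip (\<lambda>x. F n x - f x) (\<lambda>x. F n x - f x))) \<longlonglongrightarrow> 0"
    and kernel_mem: "K x \<in> H"
    and reproducing: "f \<in> H \<Longrightarrow> ip f (K x) = f x"

definition kappa :: "('a \<Rightarrow> 'a \<Rightarrow> real) \<Rightarrow> real" where
  "kappa K = max 1 (SUP x. sqrt (K x x))"

definition orthonormal_basis ::
  "('a \<Rightarrow> real) set \<Rightarrow> (('a \<Rightarrow> real) \<Rightarrow> ('a \<Rightarrow> real) \<Rightarrow> real) \<Rightarrow> ('a \<Rightarrow> real) set \<Rightarrow> bool" where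
  "orthonormal_basis H ip B \<longleftrightarrow>
     B \<subseteq> H \<and> (\<forall>e\<in>B. \<forall>e'\<in>B. ip e e' = (if e = e' then 1 else 0)) \<and>
     (\<forall>f\<in>H. (\<forall>e\<in>B. ip f e = 0) \<longrightarrow> f = (\<lambda>x. 0))"

text \<open>For positive trace class operators the sum is the same for every orthonormal basis.\<close>

definition op_trace ::
  "('a \<Rightarrow> real) set \<Rightarrow> (('a \<Rightarrow> real) \<Rightarrow> ('a \<Rightarrow> real) \<Rightarrow> real) \<Rightarrow>
     (('a \<Rightarrow> real) \<Rightarrow> 'a \<Rightarrow> real) \<Rightarrow> real" where
  "op_trace H ip T = (\<Sum>\<^sub>\<infinity>e\<in>(SOME B. orthonormal_basis H ip B). ip (T e) e)"

text \<open>\<open>(\<lambda> I + T)\<^sup>-\<^sup>1\<close> for an operator \<open>T\<close> on \<open>H\<close>.\<close>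

definition resolvent ::
  "('a \<Rightarrow> real) set \<Rightarrow> (('a \<Rightarrow> real) \<Rightarrow> 'a \<Rightarrow> real) \<Rightarrow> real \<Rightarrow> ('a \<Rightarrow> real) \<Rightarrow> 'a \<Rightarrow> real" where
  "resolvent H T l = inv_into H (\<lambda>f x. l * f x + T f x)"

section \<open>The integral operator on the space of square integrable functions\<close>

text \<open>Elements of \<open>L\<^sup>2(\<mu>)\<close> are represented by functions, up to equality almost everywhere.\<close>

definition L2 :: "'a measure \<Rightarrow> ('a \<Rightarrow> real) set" where
  "L2 mu = {f \<in> borel_measurable mu. integrable mu (\<lambda>x. (f x)\<^sup>2)}"

definition L2_inner :: "'a measure \<Rightarrow> ('a \<Rightarrow> real) \<Rightarrow> ('a \<Rightarrow> real) \<Rightarrow> real" where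
  "L2_inner mu f g = (\<integral>x. f x * g x \<partial>mu)"

definition L2_norm :: "'a measure \<Rightarrow> ('a \<Rightarrow> real) \<Rightarrow> real" where
  "L2_norm mu f = sqrt (L2_inner mu f f)"

definition integral_op ::
  "'a measure \<Rightarrow> ('a \<Rightarrow> 'a \<Rightarrow> real) \<Rightarrow> ('a \<Rightarrow> real) \<Rightarrow> 'a \<Rightarrow> real" where
  "integral_op mu K f = (\<lambda>x. \<integral>t. K x t * f t \<partial>mu)"

definition eigenspace ::
  "'a measure \<Rightarrow> (('a \<Rightarrow> real) \<Rightarrow> 'a \<Rightarrow> real) \<Rightarrow> real \<Rightarrow> ('a \<Rightarrow> real) set" where
  "eigenspace mu T s = {g \<in> L2 mu. AE x in mu. T g x = s * g x}"

definition eigenvalues :: "'a measure \<Rightarrow> (('a \<Rightarrow> real) \<Rightarrow> 'a \<Rightarrow> real) \<Rightarrow> real set" where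
  "eigenvalues mu T = {s. \<exists>g\<in>eigenspace mu T s. \<not> (AE x in mu. g x = 0)}"

text \<open>\<open>p\<close> is the orthogonal projection of \<open>u\<close> onto the subspace \<open>E\<close>.\<close>

definition is_projection ::
  "'a measure \<Rightarrow> ('a \<Rightarrow> real) set \<Rightarrow> ('a \<Rightarrow> real) \<Rightarrow> ('a \<Rightarrow> real) \<Rightarrow> bool" where
  "is_projection mu E u p \<longleftrightarrow> p \<in> E \<and> (\<forall>g\<in>E. L2_inner mu (\<lambda>x. u x - p x) g = 0)"

text \<open>
  \<open>v = T\<^sup>r u\<close> in \<open>L\<^sup>2(\<mu>)\<close>, by the spectral calculus of a compact, self-adjoint, positive operator
  \<open>T\<close> and an exponent \<open>r > 0\<close>: the spectral measure of \<open>T\<close> consists of the orthogonal projections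
  \<open>P\<^sub>s\<close> onto the eigenspaces, so \<open>T\<^sup>r u\<close> is the sum of \<open>s\<^sup>r P\<^sub>s u\<close> over the eigenvalues \<open>s\<close>,
  unconditionally convergent in \<open>L\<^sup>2(\<mu>)\<close>. The eigenvalue \<open>0\<close> contributes \<open>0\<close> and is left out.
\<close>

definition is_spectral_power ::
  "'a measure \<Rightarrow> (('a \<Rightarrow> real) \<Rightarrow> 'a \<Rightarrow> real) \<Rightarrow> real \<Rightarrow> ('a \<Rightarrow> real) \<Rightarrow> ('a \<Rightarrow> real) \<Rightarrow> bool" where
  "is_spectral_power mu T r u v \<longleftrightarrow>
     v \<in> L2 mu \<and>
     (\<exists>P. (\<forall>s \<in> eigenvalues mu T \<inter> {0<..}. is_projection mu (eigenspace mu T s) u (P s)) \<and>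
          ((\<lambda>S. L2_norm mu (\<lambda>x. (\<Sum>s\<in>S. s powr r * P s x) - v x)) \<longlongrightarrow> 0)
            (finite_subsets_at_top (eigenvalues mu T \<inter> {0<..})))"

section \<open>Data distribution and complexity\<close>

definition marginal :: "('a::topological_space \<times> real) measure \<Rightarrow> 'a measure" where
  "marginal rho = distr rho borel fst"

text \<open>\<open>f x = E[y | x]\<close>: conditional expectation with respect to the sigma-algebra generated by
  the first coordinate.\<close>

definition regression_function ::
  "('a::topological_space \<times> real) measure \<Rightarrow> ('a \<Rightarrow> real) \<Rightarrow> bool" where
  "regression_function rho f \<longleftrightarrow>
     f \<in> borel_measurable borel \<and>
     (AE z in rho. real_cond_exp rho (vimage_algebra (space rho) fst borel) snd z = f (fst z))"

definition effective_dim ::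
  "'a measure \<Rightarrow> ('a \<Rightarrow> 'a \<Rightarrow> real) \<Rightarrow> ('a \<Rightarrow> real) set \<Rightarrow>
     (('a \<Rightarrow> real) \<Rightarrow> ('a \<Rightarrow> real) \<Rightarrow> real) \<Rightarrow> real \<Rightarrow> real" where
  "effective_dim mu K H ip l =
     op_trace H ip (\<lambda>f. resolvent H (integral_op mu K) l (integral_op mu K f))"

definition B_complexity ::
  "'a measure \<Rightarrow> ('a \<Rightarrow> 'a \<Rightarrow> real) \<Rightarrow> ('a \<Rightarrow> real) set \<Rightarrow>
     (('a \<Rightarrow> real) \<Rightarrow> ('a \<Rightarrow> real) \<Rightarrow> real) \<Rightarrow> nat \<Rightarrow> real \<Rightarrow> real" where
  "B_complexity mu K H ip n l =
     2 * kappa K / sqrt (real n) *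
       (kappa K / sqrt (real n * l) + sqrt (effective_dim mu K H ip l))"

section \<open>The estimators\<close>

text \<open>
  A data set is given by a family \<open>z\<close> of observations \<open>z i = (x\<^sub>i, y\<^sub>i)\<close> and the finite set \<open>I\<close> of
  the indices that belong to it; vectors with \<open>card I\<close> entries are functions of \<open>i\<close>, used on \<open>I\<close>
  only.
\<close>

definition sampling_op :: "(nat \<Rightarrow> 'a \<times> real) \<Rightarrow> ('a \<Rightarrow> real) \<Rightarrow> nat \<Rightarrow> real" where
  "sampling_op z f = (\<lambda>i. f (fst (z i)))"

definition sampling_adj ::
  "('a \<Rightarrow> 'a \<Rightarrow> real) \<Rightarrow> nat set \<Rightarrow> (nat \<Rightarrow> 'a \<times> real) \<Rightarrow> (nat \<Rightarrow> real) \<Rightarrow> 'a \<Rightarrow> real" where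
  "sampling_adj K I z c = (\<lambda>x. \<Sum>i\<in>I. c i * K (fst (z i)) x)"

definition empirical_op ::
  "('a \<Rightarrow> 'a \<Rightarrow> real) \<Rightarrow> nat set \<Rightarrow> (nat \<Rightarrow> 'a \<times> real) \<Rightarrow> ('a \<Rightarrow> real) \<Rightarrow> 'a \<Rightarrow> real" where
  "empirical_op K I z f = (\<lambda>x. 1 / real (card I) * sampling_adj K I z (sampling_op z f) x)"

definition rkn ::
  "('a \<Rightarrow> 'a \<Rightarrow> real) \<Rightarrow> ('a \<Rightarrow> real) set \<Rightarrow> real \<Rightarrow> nat set \<Rightarrow> (nat \<Rightarrow> 'a \<times> real) \<Rightarrow> 'a \<Rightarrow> real" where
  "rkn K H l I z =
     resolvent H (empirical_op K I z) l
       (\<lambda>x. 1 / real (card I) * sampling_adj K I z (\<lambda>i. snd (z i)) x)"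

definition bcrkn ::
  "('a \<Rightarrow> 'a \<Rightarrow> real) \<Rightarrow> ('a \<Rightarrow> real) set \<Rightarrow> real \<Rightarrow> nat set \<Rightarrow> (nat \<Rightarrow> 'a \<times> real) \<Rightarrow> 'a \<Rightarrow> real" where
  "bcrkn K H l I z =
     (\<lambda>x. rkn K H l I z x + l * resolvent H (empirical_op K I z) l (rkn K H l I z) x)"

definition distributed_bcrkn ::
  "('a \<Rightarrow> 'a \<Rightarrow> real) \<Rightarrow> ('a \<Rightarrow> real) set \<Rightarrow> real \<Rightarrow> nat \<Rightarrow> nat \<Rightarrow> (nat \<Rightarrow> nat set) \<Rightarrow>
     (nat \<Rightarrow> 'a \<times> real) \<Rightarrow> 'a \<Rightarrow> real" where
  "distributed_bcrkn K H l N m D z =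
     (\<lambda>x. \<Sum>j<m. real (card (D j)) / real N * bcrkn K H l (D j) z x)"

definition block_partition :: "nat \<Rightarrow> nat \<Rightarrow> (nat \<Rightarrow> nat set) \<Rightarrow> bool" where
  "block_partition N m D \<longleftrightarrow>
     m \<ge> 1 \<and> (\<Union>j<m. D j) = {..<N} \<and> disjoint_family_on D {..<m} \<and> (\<forall>j<m. D j \<noteq> {})"

end

theory Submission
  imports Defs "HOL-Library.Function_Algebras"
begin

text \<open>
  Write \<open>L\<^sub>D\<close> for the empirical operator, \<open>\<Delta> = L - L\<^sub>D\<close>, and let \<open>q\<close> be \<open>1/\<lambda>\<close> times the squared
  Hilbert-Schmidt norm of \<open>(L + \<lambda>)\<^sup>-\<^sup>1\<^sup>/\<^sup>2 \<Delta>\<close>. Completing the square gives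
  \<open>L + \<lambda> \<le> (2 + q) (L\<^sub>D + \<lambda>)\<close> as quadratic forms, and from this all operator bounds follow with
  polynomial factors in \<open>q\<close>. The squared norm is a double sum of a centered positive semidefinite
  kernel over the sample, so its first and third moments are bounded by adding one observation at
  a time; this replaces exponential concentration inequalities.

  The error of one block is \<open>\<lambda>\<^sup>2 (L\<^sub>D + \<lambda>)\<^sup>-\<^sup>2 f\<close> (bias) plus a noise term that is linear in the
  centered noise. Conditionally on the inputs the noise contributions of different observations
  are orthogonal, which gives the factor \<open>|D\<^sub>j|/|D|\<close> in front of the variance; for the bias terms
  convexity suffices. For \<open>r > 3/2\<close> one factor \<open>L = (L\<^sub>D + \<lambda>) + \<Delta> - \<lambda>\<close> is split off, and the term with
  \<open>\<Delta>\<close> is the source of \<open>\<lambda>\<^sup>2 N(\<lambda>) / |D\<^sub>j|\<close>.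
\<close>

text \<open>\<open>H\<close> is a set of functions with its own \<open>ip\<close>, not a type, so
  bases, Riesz representation and resolvents are built inside the locale, and operators are
  arbitrary maps on functions that are constrained only on \<open>H\<close>. No square root of an
  operator is ever formed: the squared norm of A^(1/2) f is the quadratic form
  \<open>ip (A f) f\<close>, and products such as S^(1/2) R S^(1/2) are estimated by Cauchy-Schwarz
  for such forms. The squared L2 norm of a member of \<open>H\<close> is the form of L itself. The
  exponent 6 of the theorem arises because the bounds are at most cubic in q, while q^3 has
  expectation of order (B / sqrt l)^6. The perturbation term of the bias produces l^2 B^2 without
  the weight |D_j|/|D|, whereas the theorem only admits l^2 N(l) / |D_j| there. The conversion rests
  on N(l) >= trace(L) / (kappa^2 + 1) for l <= 1, so the final constant contains 1 / trace(L). The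
  case trace(L) = 0, in which all L2 errors of members of \<open>H\<close> vanish, is treated
  separately.\<close>

instantiation "fun" :: (type, real_vector) real_vector
begin

definition scaleR_fun :: "real \<Rightarrow> ('a \<Rightarrow> 'b) \<Rightarrow> 'a \<Rightarrow> 'b" where
  "scaleR_fun c f = (\<lambda>x. c *\<^sub>R f x)"

instance
  by standard (auto simp: scaleR_fun_def fun_eq_iff scaleR_add_right scaleR_add_left)

end


lemma scaleR_fun_apply: "(c *\<^sub>R f) x = c *\<^sub>R f x"
  by (simp add: scaleR_fun_def)

lemma sum_fun_apply: "(\<Sum>i\<in>A. f i) x = (\<Sum>i\<in>A. f i x)"
  by (induction A rule: infinite_finite_induct) auto

text \<open>As simplification rules these would also unfold sums and multiples of functions that occur
  as arguments of \<open>ip\<close> or of operators.\<close>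

declare plus_fun_apply [simp del] zero_fun_apply [simp del] minus_apply [simp del]
  uminus_apply [simp del]

lemmas fun_apply = plus_fun_apply zero_fun_apply minus_apply uminus_apply scaleR_fun_apply
  sum_fun_apply

text \<open>Evaluate at t = -p/d. For d = 0 the polynomial is affine in t, and t = -(a+1)/(2p) would
  give the value -1. All later Cauchy-Schwarz inequalities (for forms, integrals and infinite sums)
  go through this lemma.\<close>

lemma nonneg_quadratic_imp_discriminant:
  fixes a p d :: real
  assumes "d \<ge> 0" and nonneg: "\<And>t. a + 2 * t * p + t\<^sup>2 * d \<ge> 0"
  shows "p\<^sup>2 \<le> a * d"
proof (cases "d = 0")
  case True
  have "p = 0"
  proof (rule ccontr)
    assume "p \<noteq> 0"
    then have "2 * (- (a + 1) / (2 * p)) * p = - (a + 1)" by simp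
    then show False using nonneg[of "- (a + 1) / (2 * p)"] True
      by (simp only: mult_zero_right)
  qed
  then show ?thesis using True by simp
next
  case False
  then have "d > 0" using assms(1) by simp
  then show ?thesis using nonneg[of "- p / d"]
    by (simp add: field_simps power2_eq_square)
qed

section \<open>Hilbert space geometry of a reproducing kernel Hilbert space\<close>

context rkhs
begin

lemma H_zero [simp, intro]: "0 \<in> H"
  using zero_mem by (simp add: zero_fun_def)

lemma H_add [simp, intro]: "f \<in> H \<Longrightarrow> g \<in> H \<Longrightarrow> f + g \<in> H"
  using add_mem by (simp add: plus_fun_def)

lemma H_scale [simp, intro]: "f \<in> H \<Longrightarrow> c *\<^sub>R f \<in> H"
  using scale_mem by (simp add: scaleR_fun_def)

lemma H_uminus [simp, intro]: "f \<in> H \<Longrightarrow> - f \<in> H"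
  using H_scale[of f "-1"] by simp

lemma H_diff [simp, intro]: "f \<in> H \<Longrightarrow> g \<in> H \<Longrightarrow> f - g \<in> H"
  using H_add[of f "- g"] by simp

lemma H_sum [simp, intro]: "(\<And>i. i \<in> A \<Longrightarrow> f i \<in> H) \<Longrightarrow> sum f A \<in> H"
  by (induction A rule: infinite_finite_induct) auto

lemma H_kernel [simp, intro]: "K x \<in> H"
  by (rule kernel_mem)

lemma ip_add_left: "f \<in> H \<Longrightarrow> g \<in> H \<Longrightarrow> h \<in> H \<Longrightarrow> ip (f + g) h = ip f h + ip g h"
  using ip_add by (simp add: plus_fun_def)

lemma ip_scale_left: "f \<in> H \<Longrightarrow> h \<in> H \<Longrightarrow> ip (c *\<^sub>R f) h = c * ip f h"
  using ip_scale by (simp add: scaleR_fun_def)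

lemma ip_add_right: "f \<in> H \<Longrightarrow> g \<in> H \<Longrightarrow> h \<in> H \<Longrightarrow> ip h (f + g) = ip h f + ip h g"
  using ip_add_left[of f g h] ip_commute by simp

lemma ip_scale_right: "f \<in> H \<Longrightarrow> h \<in> H \<Longrightarrow> ip h (c *\<^sub>R f) = c * ip h f"
  using ip_scale_left[of f h c] ip_commute by simp

lemma ip_zero_left: "h \<in> H \<Longrightarrow> ip 0 h = 0"
  using ip_scale_left[of 0 h 0] by simp

lemma ip_zero_right: "h \<in> H \<Longrightarrow> ip h 0 = 0"
  using ip_scale_right[of 0 h 0] by simp

lemma ip_uminus_left: "f \<in> H \<Longrightarrow> h \<in> H \<Longrightarrow> ip (- f) h = - ip f h"
  using ip_scale_left[of f h "-1"] by simp

lemma ip_uminus_right: "f \<in> H \<Longrightarrow> h \<in> H \<Longrightarrow> ip h (- f) = - ip h f"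
  using ip_scale_right[of f h "-1"] by simp

lemma ip_diff_left: "f \<in> H \<Longrightarrow> g \<in> H \<Longrightarrow> h \<in> H \<Longrightarrow> ip (f - g) h = ip f h - ip g h"
  using ip_add_left[of f "- g" h] by (simp add: ip_uminus_left)

lemma ip_diff_right: "f \<in> H \<Longrightarrow> g \<in> H \<Longrightarrow> h \<in> H \<Longrightarrow> ip h (f - g) = ip h f - ip h g"
  using ip_add_right[of f "- g" h] by (simp add: ip_uminus_right)

lemma ip_sum_left: "(\<And>i. i \<in> A \<Longrightarrow> f i \<in> H) \<Longrightarrow> h \<in> H \<Longrightarrow> ip (sum f A) h = (\<Sum>i\<in>A. ip (f i) h)"
  by (induction A rule: infinite_finite_induct) (auto simp: ip_zero_left ip_add_left)

lemma ip_sum_right: "(\<And>i. i \<in> A \<Longrightarrow> f i \<in> H) \<Longrightarrow> h \<in> H \<Longrightarrow> ip h (sum f A) = (\<Sum>i\<in>A. ip h (f i))"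
  by (induction A rule: infinite_finite_induct) (auto simp: ip_zero_right ip_add_right)

lemmas ip_linear = ip_add_left ip_add_right ip_scale_left ip_scale_right ip_zero_left ip_zero_right
  ip_uminus_left ip_uminus_right ip_diff_left ip_diff_right ip_sum_left ip_sum_right

lemma ip_eq_0D: "f \<in> H \<Longrightarrow> ip f f = 0 \<Longrightarrow> f = 0"
  using ip_definite by (simp add: zero_fun_def)

lemma reproducing': "f \<in> H \<Longrightarrow> ip (K x) f = f x"
  using reproducing ip_commute kernel_mem by metis

text \<open>Everything is demanded on \<open>H\<close> only, because resolvents are defined by
  \<open>inv_into H\<close> and are arbitrary outside. Boundedness is kept apart, in
  \<open>pos_bdd\<close>.\<close>

definition pos_op :: "(('a \<Rightarrow> real) \<Rightarrow> 'a \<Rightarrow> real) \<Rightarrow> bool" where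
  "pos_op A \<longleftrightarrow>
     (\<forall>f\<in>H. A f \<in> H) \<and> (\<forall>f\<in>H. \<forall>g\<in>H. A (f + g) = A f + A g) \<and>
     (\<forall>c. \<forall>f\<in>H. A (c *\<^sub>R f) = c *\<^sub>R A f) \<and>
     (\<forall>f\<in>H. \<forall>g\<in>H. ip (A f) g = ip f (A g)) \<and> (\<forall>f\<in>H. ip (A f) f \<ge> 0)"

lemma
  assumes "pos_op A"
  shows pos_op_mem: "f \<in> H \<Longrightarrow> A f \<in> H"
    and pos_op_add: "f \<in> H \<Longrightarrow> g \<in> H \<Longrightarrow> A (f + g) = A f + A g"
    and pos_op_scale: "f \<in> H \<Longrightarrow> A (c *\<^sub>R f) = c *\<^sub>R A f"
    and pos_op_sym: "f \<in> H \<Longrightarrow> g \<in> H \<Longrightarrow> ip (A f) g = ip f (A g)"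
    and pos_op_nonneg: "f \<in> H \<Longrightarrow> ip (A f) f \<ge> 0"
  using assms unfolding pos_op_def by auto

lemma pos_op_uminus: "pos_op A \<Longrightarrow> f \<in> H \<Longrightarrow> A (- f) = - A f"
  using pos_op_scale[of A f "-1"] by (simp only: scaleR_minus1_left)

lemma pos_op_zero: "pos_op A \<Longrightarrow> A 0 = 0"
  using pos_op_scale[of A 0 0] by (simp only: scaleR_zero_left H_zero)

lemma pos_op_diff: "pos_op A \<Longrightarrow> f \<in> H \<Longrightarrow> g \<in> H \<Longrightarrow> A (f - g) = A f - A g"
  using pos_op_add[of A f "- g"] pos_op_uminus[of A g] H_uminus[of g]
  by (simp only: diff_conv_add_uminus)

lemmas pos_op_linear = pos_op_mem pos_op_add pos_op_scale pos_op_uminus pos_op_diff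

lemma pos_op_sum:
  assumes "pos_op A" "\<And>i. i \<in> J \<Longrightarrow> f i \<in> H"
  shows "A (sum f J) = (\<Sum>i\<in>J. A (f i))"
  using assms(2)
  by (induction J rule: infinite_finite_induct) (auto simp: pos_op_zero[OF assms(1)] pos_op_linear[OF assms(1)])

lemma pos_op_id: "pos_op (\<lambda>f. f)"
  by (simp add: pos_op_def ip_nonneg)

lemma pos_op_shift:
  assumes "pos_op T" "l \<ge> 0"
  shows "pos_op (\<lambda>f. l *\<^sub>R f + T f)"
  using assms
  by (auto simp: pos_op_def ip_linear ip_nonneg algebra_simps intro!: add_nonneg_nonneg)

text \<open>The discriminant argument for the semi-inner product \<open>ip (A f) g\<close>. This
  inequality does the work that A^(1/2) does on paper.\<close>

lemma pos_op_Cauchy_Schwarz: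
  assumes "pos_op A" "f \<in> H" "g \<in> H"
  shows "(ip (A f) g)\<^sup>2 \<le> ip (A f) f * ip (A g) g"
proof (rule nonneg_quadratic_imp_discriminant)
  show "ip (A g) g \<ge> 0" using assms by (simp add: pos_op_nonneg)
  fix t
  have "ip (A g) f = ip (A f) g"
    using assms by (metis pos_op_sym pos_op_mem ip_commute)
  then have "ip (A (f + t *\<^sub>R g)) (f + t *\<^sub>R g) = ip (A f) f + 2 * t * ip (A f) g + t\<^sup>2 * ip (A g) g"
    using assms
    by (simp add: pos_op_linear[OF assms(1)] ip_linear power2_eq_square algebra_simps)
  then show "ip (A f) f + 2 * t * ip (A f) g + t\<^sup>2 * ip (A g) g \<ge> 0"
    using pos_op_nonneg[OF assms(1), of "f + t *\<^sub>R g"] assms by simp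
qed

lemma Cauchy_Schwarz: "f \<in> H \<Longrightarrow> g \<in> H \<Longrightarrow> (ip f g)\<^sup>2 \<le> ip f f * ip g g"
  using pos_op_Cauchy_Schwarz[OF pos_op_id] by simp

lemma abs_ip_le: "f \<in> H \<Longrightarrow> g \<in> H \<Longrightarrow> \<bar>ip f g\<bar> \<le> sqrt (ip f f) * sqrt (ip g g)"
  using Cauchy_Schwarz[of f g] by (metis real_sqrt_abs real_sqrt_le_iff real_sqrt_mult)

text \<open>Parallelogram law for the form of \<open>A\<close>, with the nonnegative value at
  \<open>f - g\<close> dropped.\<close>

lemma pos_op_quadratic_add_le:
  assumes "pos_op A" "f \<in> H" "g \<in> H"
  shows "ip (A (f + g)) (f + g) \<le> 2 * ip (A f) f + 2 * ip (A g) g"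
proof -
  have "ip (A g) f = ip (A f) g"
    using assms by (metis pos_op_sym pos_op_mem ip_commute)
  moreover have "ip (A (f - g)) (f - g) \<ge> 0" using assms by (simp add: pos_op_nonneg)
  ultimately show ?thesis
    using assms by (simp add: pos_op_linear[OF assms(1)] ip_linear algebra_simps)
qed

lemma ip_add_self_le: "f \<in> H \<Longrightarrow> g \<in> H \<Longrightarrow> ip (f + g) (f + g) \<le> 2 * ip f f + 2 * ip g g"
  using pos_op_quadratic_add_le[OF pos_op_id] by simp

lemma sqrt_ip_triangle:
  assumes "f \<in> H" "g \<in> H"
  shows "sqrt (ip (f + g) (f + g)) \<le> sqrt (ip f f) + sqrt (ip g g)"
proof (rule real_le_lsqrt)
  have "ip (f + g) (f + g) = ip f f + 2 * ip f g + ip g g"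
    using assms ip_commute[of g f] by (simp add: ip_linear algebra_simps)
  also have "\<dots> \<le> ip f f + 2 * (sqrt (ip f f) * sqrt (ip g g)) + ip g g"
    using abs_ip_le[OF assms] by simp
  also have "\<dots> = (sqrt (ip f f) + sqrt (ip g g))\<^sup>2"
    using assms by (simp add: power2_sum ip_nonneg algebra_simps)
  finally show "ip (f + g) (f + g) \<le> (sqrt (ip f f) + sqrt (ip g g))\<^sup>2" .
qed (use assms in \<open>auto intro!: add_nonneg_nonneg simp: ip_nonneg\<close>)

text \<open>Norm convergence in \<open>H\<close>, stated with squared norms. The filter is arbitrary
  because limits are taken both along sequences and along the finite subsets of an index
  set.\<close>

definition hlim :: "('i \<Rightarrow> 'a \<Rightarrow> real) \<Rightarrow> ('a \<Rightarrow> real) \<Rightarrow> 'i filter \<Rightarrow> bool" where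
  "hlim F f Z \<longleftrightarrow> f \<in> H \<and> (\<forall>\<^sub>F i in Z. F i \<in> H) \<and> ((\<lambda>i. ip (F i - f) (F i - f)) \<longlongrightarrow> 0) Z"

lemma hlim_mem: "hlim F f Z \<Longrightarrow> f \<in> H"
  by (simp add: hlim_def)

lemma hlim_ip:
  assumes "hlim F f Z" "g \<in> H"
  shows "((\<lambda>i. ip (F i) g) \<longlongrightarrow> ip f g) Z"
proof -
  have "((\<lambda>i. sqrt (ip (F i - f) (F i - f)) * sqrt (ip g g)) \<longlongrightarrow> sqrt 0 * sqrt (ip g g)) Z"
    using assms unfolding hlim_def by (intro tendsto_intros) auto
  then have lim: "((\<lambda>i. sqrt (ip (F i - f) (F i - f)) * sqrt (ip g g)) \<longlongrightarrow> 0) Z" by simp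
  have "\<forall>\<^sub>F i in Z. norm (ip (F i) g - ip f g) \<le> sqrt (ip (F i - f) (F i - f)) * sqrt (ip g g)"
    using assms unfolding hlim_def
    by (auto elim!: eventually_mono) (metis abs_ip_le H_diff ip_diff_left)
  then have "((\<lambda>i. ip (F i) g - ip f g) \<longlongrightarrow> 0) Z"
    by (rule Lim_null_comparison[OF _ lim])
  then show ?thesis by (simp add: LIM_zero_iff)
qed

text \<open>Point evaluation is the inner product with \<open>K x\<close>, hence continuous. Through
  this, equations and measurability pass to limits pointwise.\<close>

lemma hlim_eval: "hlim F f Z \<Longrightarrow> ((\<lambda>i. F i x) \<longlongrightarrow> f x) Z"
proof -
  assume *: "hlim F f Z"
  have "((\<lambda>i. ip (F i) (K x)) \<longlongrightarrow> ip f (K x)) Z" using hlim_ip[OF * H_kernel] .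
  then have "((\<lambda>i. ip (F i) (K x)) \<longlongrightarrow> f x) Z" using * by (simp add: hlim_def reproducing)
  moreover have "\<forall>\<^sub>F i in Z. ip (F i) (K x) = F i x"
    using * by (auto simp: hlim_def reproducing elim: eventually_mono)
  ultimately show ?thesis by (rule Lim_transform_eventually)
qed

lemma hlim_ip_self:
  assumes "hlim F f Z"
  shows "((\<lambda>i. ip (F i) (F i)) \<longlongrightarrow> ip f f) Z"
proof -
  have f: "f \<in> H" using assms by (simp add: hlim_def)
  have "((\<lambda>i. 2 * ip (F i) f - ip f f + ip (F i - f) (F i - f)) \<longlongrightarrow> 2 * ip f f - ip f f + 0) Z"
    using hlim_ip[OF assms f] assms unfolding hlim_def by (intro tendsto_intros) auto
  moreover have "\<forall>\<^sub>F i in Z. 2 * ip (F i) f - ip f f + ip (F i - f) (F i - f) = ip (F i) (F i)"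
    using assms unfolding hlim_def
    by (auto elim!: eventually_mono simp: ip_linear) (metis ip_commute)
  ultimately show ?thesis using Lim_transform_eventually by fastforce
qed

lemma hlim_op:
  assumes "hlim F f Z" "pos_op A" and bound: "\<And>g. g \<in> H \<Longrightarrow> ip (A g) (A g) \<le> c * ip g g"
  shows "hlim (\<lambda>i. A (F i)) (A f) Z"
proof -
  have lim: "((\<lambda>i. c * ip (F i - f) (F i - f)) \<longlongrightarrow> 0) Z"
    using assms(1) unfolding hlim_def by (auto intro: tendsto_mult_right_zero)
  have "\<forall>\<^sub>F i in Z. norm (ip (A (F i) - A f) (A (F i) - A f)) \<le> c * ip (F i - f) (F i - f)"
    using assms(1) unfolding hlim_def
  proof (elim conjE, elim eventually_mono)
    fix i assume "F i \<in> H" "f \<in> H"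
    then show "norm (ip (A (F i) - A f) (A (F i) - A f)) \<le> c * ip (F i - f) (F i - f)"
      using bound[of "F i - f"] assms(2)
      by (simp add: pos_op_diff[symmetric] pos_op_mem ip_nonneg)
  qed
  then have "((\<lambda>i. ip (A (F i) - A f) (A (F i) - A f)) \<longlongrightarrow> 0) Z"
    by (rule Lim_null_comparison[OF _ lim])
  then show ?thesis
    using assms(1,2) unfolding hlim_def by (auto simp: pos_op_mem elim: eventually_mono)
qed

text \<open>Completeness restated without square roots and with ordered indices, the form in which
  Cauchy estimates are obtained later.\<close>

lemma complete_squared:
  assumes "\<And>n :: nat. F n \<in> H"
    and "\<And>e. e > 0 \<Longrightarrow> \<exists>N. \<forall>m\<ge>N. \<forall>n\<ge>m. ip (F n - F m) (F n - F m) < e"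
  shows "\<exists>f. hlim F f sequentially"
proof -
  have "\<exists>N. \<forall>m\<ge>N. \<forall>n\<ge>N. sqrt (ip (\<lambda>x. F m x - F n x) (\<lambda>x. F m x - F n x)) < e" if e: "e > 0" for e
  proof -
    obtain N where N: "\<forall>m\<ge>N. \<forall>n\<ge>m. ip (F n - F m) (F n - F m) < e\<^sup>2"
      using assms(2)[of "e\<^sup>2"] zero_less_power[OF e, of 2] by blast
    have "ip (F m - F n) (F m - F n) < e\<^sup>2" if "m \<ge> N" "n \<ge> N" for m n
    proof (cases "n \<ge> m")
      case True
      have "ip (F m - F n) (F m - F n) = ip (F n - F m) (F n - F m)"
        using assms(1) by (simp add: ip_linear)
      then show ?thesis using N that True by simp
    qed (use N that in auto)
    moreover have "sqrt (e\<^sup>2) = e" using \<open>e > 0\<close> by simp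
    ultimately have "sqrt (ip (F m - F n) (F m - F n)) < e" if "m \<ge> N" "n \<ge> N" for m n
      using that by (metis real_sqrt_less_mono)
    then show ?thesis by (auto simp: fun_diff_def)
  qed
  then obtain f where f: "f \<in> H"
    "(\<lambda>n. sqrt (ip (\<lambda>x. F n x - f x) (\<lambda>x. F n x - f x))) \<longlonglongrightarrow> 0"
    using complete[of F] assms(1) by blast
  have "(\<lambda>n. (sqrt (ip (F n - f) (F n - f)))\<^sup>2) \<longlonglongrightarrow> 0\<^sup>2"
    using f(2) by (intro tendsto_power) (simp add: fun_diff_def)
  moreover have "(sqrt (ip (F n - f) (F n - f)))\<^sup>2 = ip (F n - f) (F n - f)" for n
    using f(1) assms(1) by (simp add: ip_nonneg)
  ultimately show ?thesis using f(1) assms(1) unfolding hlim_def by auto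
qed

lemma ip_orthogonal_sum:
  assumes "finite F" "\<And>i. i \<in> F \<Longrightarrow> v i \<in> H"
    and "\<And>i j. i \<in> F \<Longrightarrow> j \<in> F \<Longrightarrow> i \<noteq> j \<Longrightarrow> ip (v i) (v j) = 0"
  shows "ip (sum v F) (sum v F) = (\<Sum>i\<in>F. ip (v i) (v i))"
proof -
  have "ip (sum v F) (sum v F) = (\<Sum>i\<in>F. \<Sum>j\<in>F. ip (v i) (v j))"
    using assms by (simp add: ip_sum_left ip_sum_right) (rule sum.swap)
  also have "\<dots> = (\<Sum>i\<in>F. \<Sum>j\<in>F. if i = j then ip (v i) (v i) else 0)"
    using assms by (intro sum.cong) auto
  also have "\<dots> = (\<Sum>i\<in>F. ip (v i) (v i))" using assms by simp
  finally show ?thesis .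
qed

text \<open>Completeness speaks about sequences, but the limit is wanted along all finite subsets.
  The squared norms are summable, so there are increasing finite sets \<open>G n\<close> such that
  everything added later has squared norm at most 1/(n+1). The sums over \<open>G n\<close> are
  Cauchy, and every finite set containing \<open>G n\<close> is compared with them.\<close>

lemma orthogonal_sum_converges:
  assumes mem: "\<And>i. i \<in> J \<Longrightarrow> v i \<in> H"
    and orth: "\<And>i j. i \<in> J \<Longrightarrow> j \<in> J \<Longrightarrow> i \<noteq> j \<Longrightarrow> ip (v i) (v j) = 0"
    and bound: "\<And>F. finite F \<Longrightarrow> F \<subseteq> J \<Longrightarrow> (\<Sum>i\<in>F. ip (v i) (v i)) \<le> C"
  shows "\<exists>w. hlim (sum v) w (finite_subsets_at_top J)"
proof -
  define s where "s i = ip (v i) (v i)" for i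
  have s0: "s i \<ge> 0" if "i \<in> J" for i using mem that by (simp add: s_def ip_nonneg)
  have "s summable_on J"
    using s0 bound by (intro nonneg_bdd_above_summable_on bdd_aboveI2[of _ _ C]) (auto simp: s_def)
  then obtain S where S: "(s has_sum S) J" by (auto simp: summable_on_def)
  have le_S: "sum s F \<le> S" if "finite F" "F \<subseteq> J" for F
    using finite_sum_le_has_sum[OF S] s0 that by auto
  have "\<exists>F. finite F \<and> F \<subseteq> J \<and> dist (sum s F) S \<le> 1 / real (Suc n)" for n
    by (rule has_sum_finite_approximation[OF S]) simp
  then obtain F where F: "\<And>n. finite (F n)" "\<And>n. F n \<subseteq> J" "\<And>n. dist (sum s (F n)) S \<le> 1 / real (Suc n)"
    by metis
  define G where "G n = (\<Union>k\<le>n. F k)" for n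
  have G: "finite (G n)" "G n \<subseteq> J" "F n \<subseteq> G n" for n using F by (auto simp: G_def)
  have G_mono: "G m \<subseteq> G n" if "m \<le> n" for m n using that by (fastforce simp: G_def)
  have tail: "ip (sum v F' - sum v (G n)) (sum v F' - sum v (G n)) \<le> 1 / real (Suc n)"
    if "finite F'" "F' \<subseteq> J" "G n \<subseteq> F'" for F' n
  proof -
    have "sum v F' - sum v (G n) = sum v (F' - G n)" using that by (simp add: sum_diff)
    then have "ip (sum v F' - sum v (G n)) (sum v F' - sum v (G n)) = sum s (F' - G n)"
      unfolding s_def by (simp, intro ip_orthogonal_sum) (use that mem orth in blast)+
    also have "\<dots> \<le> sum s (F' - F n)"
      using that G s0 by (intro sum_mono2) (blast intro: finite_subset)+
    also have "\<dots> = sum s F' - sum s (F n)" using that G(3)[of n] by (intro sum_diff) auto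
    also have "\<dots> \<le> 1 / real (Suc n)"
      using le_S[OF that(1,2)] F(3)[of n] by (simp add: dist_real_def)
    finally show ?thesis .
  qed
  have w_mem: "sum v (G n) \<in> H" for n
    by (rule H_sum) (use G(2)[of n] mem in blast)
  have "\<exists>w. hlim (\<lambda>n. sum v (G n)) w sequentially"
  proof (rule complete_squared)
    fix e :: real assume "e > 0"
    then obtain N where N: "1 / real (Suc N) < e"
      by (metis inverse_eq_divide reals_Archimedean)
    have "ip (sum v (G n) - sum v (G m)) (sum v (G n) - sum v (G m)) < e" if "m \<ge> N" "n \<ge> m" for m n
    proof -
      have "ip (sum v (G n) - sum v (G m)) (sum v (G n) - sum v (G m)) \<le> 1 / real (Suc m)"
        by (rule tail) (use G G_mono that in auto)
      also have "\<dots> \<le> 1 / real (Suc N)" using that by (simp add: frac_le)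
      finally show ?thesis using N by simp
    qed
    then show "\<exists>N. \<forall>m\<ge>N. \<forall>n\<ge>m. ip (sum v (G n) - sum v (G m)) (sum v (G n) - sum v (G m)) < e"
      by blast
  qed (rule w_mem)
  then obtain w where w: "hlim (\<lambda>n. sum v (G n)) w sequentially" by blast
  have w_H: "w \<in> H" using w by (simp add: hlim_def)
  have "((\<lambda>F. ip (sum v F - w) (sum v F - w)) \<longlongrightarrow> 0) (finite_subsets_at_top J)"
  proof (rule tendstoI)
    fix e :: real assume e: "e > 0"
    have "(\<lambda>n. 2 * (1 / real (Suc n)) + 2 * ip (sum v (G n) - w) (sum v (G n) - w)) \<longlonglongrightarrow> 2 * 0 + 2 * 0"
      using w LIMSEQ_inverse_real_of_nat unfolding hlim_def inverse_eq_divide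
      by (intro tendsto_intros) auto
    then have "\<forall>\<^sub>F n in sequentially. 2 * (1 / real (Suc n)) + 2 * ip (sum v (G n) - w) (sum v (G n) - w) < e"
      using e by (intro order_tendstoD(2)) auto
    then obtain n where n: "2 * (1 / real (Suc n)) + 2 * ip (sum v (G n) - w) (sum v (G n) - w) < e"
      by (auto simp: eventually_sequentially)
    have *: "dist (ip (sum v F - w) (sum v F - w)) 0 < e" if "finite F" "G n \<subseteq> F" "F \<subseteq> J" for F
    proof -
      have mem_F: "sum v F \<in> H" using that mem by auto
      have "sum v F - w = (sum v F - sum v (G n)) + (sum v (G n) - w)" by simp
      then have "ip (sum v F - w) (sum v F - w) \<le>
          2 * ip (sum v F - sum v (G n)) (sum v F - sum v (G n)) + 2 * ip (sum v (G n) - w) (sum v (G n) - w)"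
        using ip_add_self_le[of "sum v F - sum v (G n)" "sum v (G n) - w"] mem_F w_mem w_H by auto
      also have "\<dots> < e" using tail[OF that(1,3,2)] n by simp
      finally show ?thesis using ip_nonneg[of "sum v F - w"] mem_F w_H by simp
    qed
    show "\<forall>\<^sub>F F in finite_subsets_at_top J. dist (ip (sum v F - w) (sum v F - w)) 0 < e"
      unfolding eventually_finite_subsets_at_top
      by (rule exI[of _ "G n"], intro conjI allI impI) (use G * in simp_all)
  qed
  moreover have "\<forall>\<^sub>F F in finite_subsets_at_top J. sum v F \<in> H"
    using mem by (intro eventually_finite_subsets_at_top_weakI) auto
  ultimately have "hlim (sum v) w (finite_subsets_at_top J)"
    using w_H by (simp only: hlim_def)
  then show ?thesis by (intro exI[of _ w])
qed

text \<open>Zorn's lemma: a nonzero vector orthogonal to a maximal orthonormal set could be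
  normalized and adjoined to it.\<close>

lemma orthonormal_basis_exists: "\<exists>B. orthonormal_basis H ip B"
proof -
  define Ons where "Ons = {B. B \<subseteq> H \<and> (\<forall>e\<in>B. \<forall>e'\<in>B. ip e e' = (if e = e' then 1 else 0))}"
  have "\<exists>M\<in>Ons. \<forall>X\<in>Ons. M \<subseteq> X \<longrightarrow> X = M"
  proof (rule subset_Zorn')
    fix \<C> assume chain: "subset.chain Ons \<C>"
    have "ip e e' = (if e = e' then 1 else 0)" if ee: "e \<in> \<Union>\<C>" "e' \<in> \<Union>\<C>" for e e'
    proof -
      obtain X Y where XY: "X \<in> \<C>" "Y \<in> \<C>" "e \<in> X" "e' \<in> Y" using ee by blast
      then have "X \<subseteq> Y \<or> Y \<subseteq> X" "X \<in> Ons" "Y \<in> Ons"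
        using chain by (auto simp: subset.chain_def)
      then show ?thesis using XY unfolding Ons_def by blast
    qed
    moreover have "\<Union>\<C> \<subseteq> H" using chain by (auto simp: subset.chain_def Ons_def)
    ultimately show "\<Union>\<C> \<in> Ons" by (auto simp: Ons_def)
  qed
  then obtain B where B: "B \<in> Ons" and max: "\<And>X. X \<in> Ons \<Longrightarrow> B \<subseteq> X \<Longrightarrow> X = B" by blast
  have "f = 0" if f: "f \<in> H" "\<forall>e\<in>B. ip f e = 0" for f
  proof (rule ccontr)
    assume "f \<noteq> 0"
    then have pos: "ip f f > 0" using f ip_nonneg[of f] ip_eq_0D[of f] by fastforce
    define g where "g = (1 / sqrt (ip f f)) *\<^sub>R f"
    have g: "g \<in> H" "ip g g = 1" "\<And>e. e \<in> B \<Longrightarrow> ip g e = 0"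
      using f pos B by (auto simp: g_def ip_linear field_simps Ons_def)
    have "ip e g = 0" if "e \<in> B" for e
      using g that B ip_commute[of e g] by (auto simp: Ons_def)
    then have "insert g B \<in> Ons" using B g by (auto simp: Ons_def)
    then have "g \<in> B" using max[of "insert g B"] by blast
    then show False using g by fastforce
  qed
  then have "orthonormal_basis H ip B"
    using B unfolding orthonormal_basis_def Ons_def zero_fun_def by blast
  then show ?thesis by blast
qed

end

section \<open>Orthonormal expansions: Riesz-Fischer, Bessel, Parseval, Riesz representation\<close>

locale rkhs_basis = rkhs +
  fixes B
  assumes onb: "orthonormal_basis H ip B"
begin

lemma B_mem [simp, intro]: "e \<in> B \<Longrightarrow> e \<in> H"
  using onb by (auto simp: orthonormal_basis_def)

lemma ip_B: "e \<in> B \<Longrightarrow> e' \<in> B \<Longrightarrow> ip e e' = (if e = e' then 1 else 0)"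
  using onb by (auto simp: orthonormal_basis_def)

lemma B_total: "f \<in> H \<Longrightarrow> (\<And>e. e \<in> B \<Longrightarrow> ip f e = 0) \<Longrightarrow> f = 0"
  using onb by (simp add: orthonormal_basis_def zero_fun_def)

text \<open>The Riesz-Fischer theorem: the partial sums of the orthogonal series converge, and the
  coefficient at \<open>e\<close> is constant as soon as the finite set contains
  \<open>e\<close>.\<close>

lemma coefficients_realized:
  assumes "\<And>F. finite F \<Longrightarrow> F \<subseteq> B \<Longrightarrow> (\<Sum>e\<in>F. (c e)\<^sup>2) \<le> C"
  shows "\<exists>w. hlim (\<lambda>F. \<Sum>e\<in>F. c e *\<^sub>R e) w (finite_subsets_at_top B) \<and> (\<forall>e\<in>B. ip w e = c e)"
proof -
  obtain w where w: "hlim (\<lambda>F. \<Sum>e\<in>F. c e *\<^sub>R e) w (finite_subsets_at_top B)"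
    using orthogonal_sum_converges[of B "\<lambda>e. c e *\<^sub>R e" C] assms
    by (auto simp: ip_linear ip_B power2_eq_square subset_iff)
  have "ip w e = c e" if e: "e \<in> B" for e
  proof -
    have "((\<lambda>F. ip (\<Sum>e\<in>F. c e *\<^sub>R e) e) \<longlongrightarrow> ip w e) (finite_subsets_at_top B)"
      using hlim_ip[OF w] e by auto
    moreover have "((\<lambda>F. ip (\<Sum>e\<in>F. c e *\<^sub>R e) e) \<longlongrightarrow> c e) (finite_subsets_at_top B)"
    proof (rule tendsto_eventually)
      have *: "ip (\<Sum>e\<in>F. c e *\<^sub>R e) e = c e" if "finite F" "{e} \<subseteq> F" "F \<subseteq> B" for F
      proof -
        have "ip (\<Sum>e\<in>F. c e *\<^sub>R e) e = (\<Sum>e'\<in>F. c e' * ip e' e)"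
          using that e by (subst ip_sum_left) (auto simp: ip_scale_left subset_iff intro!: sum.cong)
        also have "\<dots> = (\<Sum>e'\<in>F. if e' = e then c e else 0)"
          using that e by (intro sum.cong) (auto simp: ip_B subset_iff)
        also have "\<dots> = c e" using that by simp
        finally show ?thesis .
      qed
      show "\<forall>\<^sub>F F in finite_subsets_at_top B. ip (\<Sum>e\<in>F. c e *\<^sub>R e) e = c e"
        unfolding eventually_finite_subsets_at_top
        by (rule exI[of _ "{e}"], intro conjI allI impI) (use e * in blast)+
    qed
    ultimately show ?thesis
      by (rule tendsto_unique[OF finite_subsets_at_top_neq_bot])
  qed
  then show ?thesis using w by blast
qed

lemma Bessel:
  assumes "f \<in> H" "finite F" "F \<subseteq> B"
  shows "(\<Sum>e\<in>F. (ip f e)\<^sup>2) \<le> ip f f"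
proof -
  define p where "p = (\<Sum>e\<in>F. ip f e *\<^sub>R e)"
  have F: "\<And>e. e \<in> F \<Longrightarrow> e \<in> H" using assms by auto
  have p: "p \<in> H" unfolding p_def using F by auto
  have "ip p p = (\<Sum>e\<in>F. ip (ip f e *\<^sub>R e) (ip f e *\<^sub>R e))"
    unfolding p_def using assms F
    by (intro ip_orthogonal_sum) (auto simp: ip_linear ip_B subset_iff)
  also have "\<dots> = (\<Sum>e\<in>F. (ip f e)\<^sup>2)"
    using assms F by (intro sum.cong) (auto simp: ip_linear ip_B subset_iff power2_eq_square)
  finally have pp: "ip p p = (\<Sum>e\<in>F. (ip f e)\<^sup>2)" .
  have fp: "ip f p = (\<Sum>e\<in>F. (ip f e)\<^sup>2)"
    unfolding p_def using assms F by (simp add: ip_linear power2_eq_square)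
  have "0 \<le> ip (f - p) (f - p)" using p assms by (simp add: ip_nonneg)
  also have "\<dots> = ip f f - 2 * ip f p + ip p p"
    using p assms ip_commute[of p f] by (simp add: ip_linear)
  finally show ?thesis using pp fp by simp
qed

text \<open>Bessel makes the coefficients square summable, so Riesz-Fischer gives some
  \<open>w\<close> with the coefficients of \<open>f\<close>. Totality of \<open>B\<close> forces
  \<open>w = f\<close>.\<close>

lemma basis_expansion:
  assumes "f \<in> H"
  shows "hlim (\<lambda>F. \<Sum>e\<in>F. ip f e *\<^sub>R e) f (finite_subsets_at_top B)"
proof -
  obtain w where w: "hlim (\<lambda>F. \<Sum>e\<in>F. ip f e *\<^sub>R e) w (finite_subsets_at_top B)"
    "\<forall>e\<in>B. ip w e = ip f e"
    using coefficients_realized[of "ip f"] Bessel[OF assms] by blast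
  have "f - w = 0"
    using w assms by (intro B_total) (auto simp: hlim_def ip_linear)
  then show ?thesis using w by simp
qed

lemma Parseval:
  assumes "f \<in> H" "g \<in> H"
  shows "((\<lambda>e. ip f e * ip g e) has_sum ip f g) B"
proof -
  have "((\<lambda>F. ip (\<Sum>e\<in>F. ip f e *\<^sub>R e) g) \<longlongrightarrow> ip f g) (finite_subsets_at_top B)"
    by (rule hlim_ip[OF basis_expansion[OF assms(1)] assms(2)])
  moreover have "\<forall>\<^sub>F F in finite_subsets_at_top B.
      ip (\<Sum>e\<in>F. ip f e *\<^sub>R e) g = (\<Sum>e\<in>F. ip f e * ip g e)"
    using assms
    by (intro eventually_finite_subsets_at_top_weakI)
      (auto simp: ip_sum_left ip_scale_left subset_iff ip_commute[of g] intro!: sum.cong)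
  ultimately show ?thesis unfolding has_sum_def by (rule Lim_transform_eventually)
qed

text \<open>Applying the functional to its own truncation, the sum of
  \<open>\<phi> e *\<^sub>R e\<close> over a finite set, yields S <= C sqrt S for the sum S of the
  squared coefficients. Hence S <= C^2, and Riesz-Fischer supplies the representing vector.\<close>

lemma Riesz:
  assumes add: "\<And>f g. f \<in> H \<Longrightarrow> g \<in> H \<Longrightarrow> \<phi> (f + g) = \<phi> f + \<phi> g"
    and scale: "\<And>c f. f \<in> H \<Longrightarrow> \<phi> (c *\<^sub>R f) = c * \<phi> f"
    and bound: "\<And>f. f \<in> H \<Longrightarrow> \<bar>\<phi> f\<bar> \<le> C * sqrt (ip f f)"
  shows "\<exists>w\<in>H. \<forall>f\<in>H. ip w f = \<phi> f"
proof -
  have zero: "\<phi> 0 = 0" using scale[of 0 0] by simp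
  have \<phi>_sum: "\<phi> (\<Sum>e\<in>F. a e *\<^sub>R e) = (\<Sum>e\<in>F. a e * \<phi> e)" if "F \<subseteq> B" for a F
    using that
  proof (induction F rule: infinite_finite_induct)
    case (insert x F)
    then have "(\<Sum>e\<in>F. a e *\<^sub>R e) \<in> H" by auto
    moreover have "\<phi> (a x *\<^sub>R x + (\<Sum>e\<in>F. a e *\<^sub>R e)) = \<phi> (a x *\<^sub>R x) + \<phi> (\<Sum>e\<in>F. a e *\<^sub>R e)"
      by (rule add) (use insert.prems calculation in auto)
    ultimately have "\<phi> (a x *\<^sub>R x + (\<Sum>e\<in>F. a e *\<^sub>R e)) = a x * \<phi> x + (\<Sum>e\<in>F. a e * \<phi> e)"
      using insert.IH scale[of x "a x"] B_mem insert.prems by (simp only: insert_subset)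
    then show ?case
      unfolding sum.insert[OF insert.hyps] .
  qed (auto simp: zero)
  have "(\<Sum>e\<in>F. (\<phi> e)\<^sup>2) \<le> C\<^sup>2" if F: "finite F" "F \<subseteq> B" for F
  proof -
    define g where "g = (\<Sum>e\<in>F. \<phi> e *\<^sub>R e)"
    define S where "S = (\<Sum>e\<in>F. (\<phi> e)\<^sup>2)"
    have "g \<in> H" unfolding g_def using F by auto
    have "ip g g = (\<Sum>e\<in>F. ip (\<phi> e *\<^sub>R e) (\<phi> e *\<^sub>R e))"
      unfolding g_def using F by (intro ip_orthogonal_sum) (auto simp: ip_linear ip_B subset_iff)
    also have "\<dots> = S" unfolding S_def
      using F by (intro sum.cong) (auto simp: ip_linear ip_B subset_iff power2_eq_square)
    finally have gg: "ip g g = S" .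
    have "\<phi> g = S" unfolding g_def S_def using \<phi>_sum[OF F(2)] by (simp add: power2_eq_square)
    then have "S \<le> C * sqrt S" using bound[OF \<open>g \<in> H\<close>] gg by simp
    moreover have "S \<ge> 0" unfolding S_def by (simp add: sum_nonneg)
    ultimately have "sqrt S * sqrt S \<le> C * sqrt S" by simp
    then have "sqrt S \<le> C \<or> S = 0"
      using \<open>S \<ge> 0\<close> mult_le_cancel_right[of "sqrt S" "sqrt S" C] by auto
    then have "S \<le> C\<^sup>2" using \<open>S \<ge> 0\<close> by (auto simp: sqrt_le_D)
    then show ?thesis unfolding S_def .
  qed
  then obtain w where w: "hlim (\<lambda>F. \<Sum>e\<in>F. \<phi> e *\<^sub>R e) w (finite_subsets_at_top B)"
    "\<forall>e\<in>B. ip w e = \<phi> e"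
    using coefficients_realized[of \<phi>] by blast
  have wH: "w \<in> H" using w(1) by (simp add: hlim_def)
  have "ip w f = \<phi> f" if f: "f \<in> H" for f
  proof -
    let ?p = "\<lambda>F. \<Sum>e\<in>F. ip f e *\<^sub>R e"
    have p: "hlim ?p f (finite_subsets_at_top B)" by (rule basis_expansion[OF f])
    have "((\<lambda>F. ip (?p F) w) \<longlongrightarrow> ip f w) (finite_subsets_at_top B)"
      by (rule hlim_ip[OF p wH])
    moreover have "\<forall>\<^sub>F F in finite_subsets_at_top B. ip (?p F) w = \<phi> (?p F)"
    proof (rule eventually_finite_subsets_at_top_weakI)
      fix F assume F: "finite F" "F \<subseteq> B"
      have "ip (?p F) w = (\<Sum>e\<in>F. ip f e * ip e w)"
        using F wH by (subst ip_sum_left) (auto simp: ip_scale_left subset_iff intro!: sum.cong)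
      also have "\<dots> = (\<Sum>e\<in>F. ip f e * \<phi> e)"
        using F wH w(2) by (intro sum.cong) (auto simp: ip_commute[of _ w] subset_iff)
      finally show "ip (?p F) w = \<phi> (?p F)" using \<phi>_sum[OF F(2)] by simp
    qed
    ultimately have "((\<lambda>F. \<phi> (?p F)) \<longlongrightarrow> ip f w) (finite_subsets_at_top B)"
      by (rule Lim_transform_eventually)
    moreover have "((\<lambda>F. \<phi> (?p F)) \<longlongrightarrow> \<phi> f) (finite_subsets_at_top B)"
    proof -
      have "((\<lambda>F. C * sqrt (ip (?p F - f) (?p F - f))) \<longlongrightarrow> C * sqrt 0) (finite_subsets_at_top B)"
        using p unfolding hlim_def by (intro tendsto_intros) auto
      then have lim: "((\<lambda>F. C * sqrt (ip (?p F - f) (?p F - f))) \<longlongrightarrow> 0) (finite_subsets_at_top B)"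
        by simp
      have "\<forall>\<^sub>F F in finite_subsets_at_top B. norm (\<phi> (?p F) - \<phi> f) \<le> C * sqrt (ip (?p F - f) (?p F - f))"
      proof (rule eventually_finite_subsets_at_top_weakI)
        fix F assume F: "finite F" "F \<subseteq> B"
        have pH: "?p F \<in> H" using F by auto
        have "\<phi> (?p F) = \<phi> ((?p F - f) + f)" by simp
        also have "\<dots> = \<phi> (?p F - f) + \<phi> f" using pH f by (intro add) auto
        finally show "norm (\<phi> (?p F) - \<phi> f) \<le> C * sqrt (ip (?p F - f) (?p F - f))"
          using bound[of "?p F - f"] pH f by simp
      qed
      then have "((\<lambda>F. \<phi> (?p F) - \<phi> f) \<longlongrightarrow> 0) (finite_subsets_at_top B)"
        by (rule Lim_null_comparison[OF _ lim])
      then show ?thesis by (simp add: LIM_zero_iff)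
    qed
    ultimately have "ip f w = \<phi> f"
      using tendsto_unique[OF finite_subsets_at_top_neq_bot] by blast
    then show ?thesis using f wH ip_commute by metis
  qed
  then show ?thesis using wH by blast
qed

end

section \<open>Resolvents\<close>

context rkhs
begin

text \<open>The constant bounds the squared operator norm, which keeps square roots out of the
  estimates.\<close>

definition pos_bdd :: "real \<Rightarrow> (('a \<Rightarrow> real) \<Rightarrow> 'a \<Rightarrow> real) \<Rightarrow> bool" where
  "pos_bdd c T \<longleftrightarrow> c \<ge> 0 \<and> pos_op T \<and> (\<forall>f\<in>H. ip (T f) (T f) \<le> c * ip f f)"

lemma pos_bdd_pos_op: "pos_bdd c T \<Longrightarrow> pos_op T"
  by (simp add: pos_bdd_def)

lemma shift_bounded:
  assumes "pos_bdd c T" "f \<in> H"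
  shows "ip (l *\<^sub>R f + T f) (l *\<^sub>R f + T f) \<le> (2 * l\<^sup>2 + 2 * c) * ip f f"
proof -
  have T: "pos_op T" using assms pos_bdd_pos_op by blast
  have "ip (l *\<^sub>R f + T f) (l *\<^sub>R f + T f) \<le> 2 * ip (l *\<^sub>R f) (l *\<^sub>R f) + 2 * ip (T f) (T f)"
    using assms pos_op_mem[OF T] by (intro ip_add_self_le) auto
  also have "\<dots> \<le> 2 * (l\<^sup>2 * ip f f) + 2 * (c * ip f f)"
    using assms by (simp add: ip_linear power2_eq_square pos_bdd_def)
  finally show ?thesis by (simp add: algebra_simps)
qed

definition res_step :: "real \<Rightarrow> (('a \<Rightarrow> real) \<Rightarrow> 'a \<Rightarrow> real) \<Rightarrow> real \<Rightarrow> ('a \<Rightarrow> real) \<Rightarrow> ('a \<Rightarrow> real) \<Rightarrow> 'a \<Rightarrow> real" where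
  "res_step c T l f g = g - (l / (2 * l\<^sup>2 + 2 * c)) *\<^sub>R (l *\<^sub>R g + T g - f)"

definition res_iter :: "real \<Rightarrow> (('a \<Rightarrow> real) \<Rightarrow> 'a \<Rightarrow> real) \<Rightarrow> real \<Rightarrow> ('a \<Rightarrow> real) \<Rightarrow> nat \<Rightarrow> 'a \<Rightarrow> real" where
  "res_iter c T l f n = (res_step c T l f ^^ n) 0"

text \<open>The map \<open>g \<mapsto> g - t (l g + T g - f)\<close> is a contraction for small \<open>t > 0\<close>, and its fixed point
  is the resolvent.\<close>

lemma res_iter_converges:
  assumes T: "pos_bdd c T" and l: "l > 0" and f: "f \<in> H"
  shows "\<exists>h. hlim (res_iter c T l f) h sequentially \<and> l *\<^sub>R h + T h = f"
proof -
  \<comment> \<open>\<open>D\<close> bounds the squared norm of l + T. The step size t = l/D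
    minimizes the contraction factor 1 - 2tl + t^2 D, and the minimum is \<open>q\<close>.\<close>
  define D where "D = 2 * l\<^sup>2 + 2 * c"
  define t where "t = l / D"
  define q where "q = 1 - l\<^sup>2 / D"
  define S where "S g = l *\<^sub>R g + T g" for g
  define u where "u = res_iter c T l f"
  have Tp: "pos_op T" using T by (simp add: pos_bdd_def)
  have S: "pos_op S" unfolding S_def using pos_op_shift[OF Tp] l by simp
  have c: "c \<ge> 0" using T by (simp add: pos_bdd_def)
  have D: "D > 0" "D \<ge> l\<^sup>2" using l c by (auto simp: D_def add_pos_nonneg)
  have q: "0 \<le> q" "q < 1" using D l by (auto simp: q_def field_simps)
  have u_Suc: "u (Suc n) = u n - t *\<^sub>R (S (u n) - f)" for n
    by (simp add: u_def res_iter_def res_step_def t_def D_def S_def)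
  have u_mem: "u n \<in> H" for n
    by (induction n) (auto simp: u_Suc f pos_op_mem[OF S], simp add: u_def res_iter_def)
  have S_bound: "ip (S g) (S g) \<le> D * ip g g" if "g \<in> H" for g
    unfolding S_def D_def by (rule shift_bounded[OF T that])
  have contract: "ip (g - t *\<^sub>R S g) (g - t *\<^sub>R S g) \<le> q * ip g g" if g: "g \<in> H" for g
  proof -
    have Sg: "S g \<in> H" using pos_op_mem[OF S g] .
    have "ip (S g) g \<ge> l * ip g g"
      using g pos_op_mem[OF Tp g] pos_op_nonneg[OF Tp g] by (simp add: S_def ip_linear)
    then have 1: "2 * t * ip (S g) g \<ge> 2 * t * (l * ip g g)"
      using l D by (intro mult_left_mono) (auto simp: t_def)
    have 2: "t\<^sup>2 * ip (S g) (S g) \<le> t\<^sup>2 * (D * ip g g)"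
      using S_bound[OF g] by (intro mult_left_mono) auto
    have "ip (g - t *\<^sub>R S g) (g - t *\<^sub>R S g) = ip g g - 2 * t * ip (S g) g + t\<^sup>2 * ip (S g) (S g)"
      using g Sg ip_commute[of g "S g"] by (simp add: ip_linear power2_eq_square algebra_simps)
    also have "\<dots> \<le> ip g g - 2 * t * (l * ip g g) + t\<^sup>2 * (D * ip g g)" using 1 2 by linarith
    also have "\<dots> = q * ip g g"
      using D(1) by (simp add: t_def q_def power2_eq_square field_simps)
    finally show ?thesis .
  qed
  define d where "d n = u (Suc n) - u n" for n
  have d_mem: "d n \<in> H" for n using u_mem by (simp add: d_def)
  have d_Suc: "d (Suc n) = d n - t *\<^sub>R S (d n)" for n
  proof -
    have 1: "S (d n) = S (u (Suc n)) - S (u n)"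
      unfolding d_def by (rule pos_op_diff[OF S u_mem u_mem])
    have 2: "d (Suc n) = - (t *\<^sub>R (S (u (Suc n)) - f))"
      using u_Suc[of "Suc n"] by (simp add: d_def)
    have 3: "d n = - (t *\<^sub>R (S (u n) - f))" using u_Suc[of n] by (simp add: d_def)
    show ?thesis unfolding 1 2 by (subst 3) (simp add: algebra_simps)
  qed
  have d_bound: "ip (d n) (d n) \<le> q ^ n * ip (d 0) (d 0)" for n
  proof (induction n)
    case (Suc n)
    have "ip (d (Suc n)) (d (Suc n)) \<le> q * ip (d n) (d n)"
      unfolding d_Suc by (rule contract[OF d_mem])
    also have "\<dots> \<le> q * (q ^ n * ip (d 0) (d 0))" by (rule mult_left_mono[OF Suc q(1)])
    finally show ?case by simp
  qed simp
  define a where "a n = sqrt (ip (d 0) (d 0)) * sqrt q ^ n" for n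
  have d_le: "sqrt (ip (d n) (d n)) \<le> a n" for n
  proof -
    have "sqrt (ip (d n) (d n)) \<le> sqrt (q ^ n * ip (d 0) (d 0))" using d_bound by simp
    also have "\<dots> = a n" by (simp add: a_def real_sqrt_mult real_sqrt_power mult.commute)
    finally show ?thesis .
  qed
  have a_nonneg: "a n \<ge> 0" for n using q d_mem by (simp add: a_def ip_nonneg)
  have "summable a"
    unfolding a_def using q by (intro summable_mult summable_geometric) (simp add: abs_if)
  have tail: "sqrt (ip (u (m + k) - u m) (u (m + k) - u m)) \<le> sum a {m..<m + k}" for m k
  proof (induction k)
    case 0
    then show ?case using ip_zero_left[of 0] by simp
  next
    case (Suc k)
    have eq: "u (m + Suc k) - u m = d (m + k) + (u (m + k) - u m)" by (simp add: d_def)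
    have "sqrt (ip (u (m + Suc k) - u m) (u (m + Suc k) - u m))
        \<le> sqrt (ip (d (m + k)) (d (m + k))) + sqrt (ip (u (m + k) - u m) (u (m + k) - u m))"
      unfolding eq by (rule sqrt_ip_triangle) (use d_mem u_mem in auto)
    also have "\<dots> \<le> a (m + k) + sum a {m..<m + k}" using d_le Suc by (intro add_mono) auto
    finally show ?case by (simp add: add.commute)
  qed
  have "\<exists>h. hlim u h sequentially"
  proof (rule complete_squared)
    fix e :: real assume e: "e > 0"
    then obtain N where N: "\<forall>m\<ge>N. \<forall>n. norm (sum a {m..<n}) < sqrt e"
      using \<open>summable a\<close> unfolding summable_Cauchy by (metis real_sqrt_gt_zero)
    have "ip (u n - u m) (u n - u m) < e" if mn: "m \<ge> N" "n \<ge> m" for m n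
    proof -
      have "sqrt (ip (u n - u m) (u n - u m)) \<le> sum a {m..<n}"
        using tail[of m "n - m"] mn by simp
      also have "\<dots> < sqrt e" using N mn by (metis norm_ge_zero real_norm_def abs_le_D1 order_le_less_trans order_refl)
      finally show ?thesis by simp
    qed
    then show "\<exists>N. \<forall>m\<ge>N. \<forall>n\<ge>m. ip (u n - u m) (u n - u m) < e" by blast
  qed (rule u_mem)
  then obtain h where h: "hlim u h sequentially" by blast
  have Sh: "hlim (\<lambda>n. S (u n)) (S h) sequentially"
    by (rule hlim_op[OF h S S_bound])
  \<comment> \<open>The recursion passes to the limit pointwise, giving h = h - t (S h - f) with t >
    0.\<close>
  have "S h x = f x" for x
  proof -
    have "(\<lambda>n. u n x - t * (S (u n) x - f x)) \<longlonglongrightarrow> h x - t * (S h x - f x)"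
      by (intro tendsto_intros hlim_eval[OF h] hlim_eval[OF Sh])
    moreover have "(\<lambda>n. u n x - t * (S (u n) x - f x)) = (\<lambda>n. u (Suc n) x)"
      by (simp add: u_Suc fun_apply)
    moreover have "(\<lambda>n. u (Suc n) x) \<longlonglongrightarrow> h x"
      using hlim_eval[OF h] by (rule LIMSEQ_Suc)
    ultimately have "h x - t * (S h x - f x) = h x" by (simp add: LIMSEQ_unique)
    moreover have "t > 0" using l D by (simp add: t_def)
    ultimately show ?thesis by simp
  qed
  then have "S h = f" by (rule ext)
  then show ?thesis using h unfolding u_def S_def by blast
qed

lemma shift_inj_on:
  assumes "pos_op T" "l > 0"
  shows "inj_on (\<lambda>f. l *\<^sub>R f + T f) H"
proof (rule inj_onI)
  fix f g assume fg: "f \<in> H" "g \<in> H" "l *\<^sub>R f + T f = l *\<^sub>R g + T g"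
  define d where "d = f - g"
  have d: "d \<in> H" using fg by (simp add: d_def)
  have Td: "T d = T f - T g" unfolding d_def by (rule pos_op_diff[OF assms(1) fg(1,2)])
  have "l *\<^sub>R d + T d = 0" unfolding Td using fg(3) by (simp add: d_def algebra_simps)
  then have "ip (l *\<^sub>R d + T d) d = 0" using d by (simp add: ip_zero_left)
  then have "l * ip d d + ip (T d) d = 0" using d pos_op_mem[OF assms(1) d] by (simp add: ip_linear)
  then have "ip d d = 0"
    using pos_op_nonneg[OF assms(1) d] ip_nonneg[OF d] assms(2)
    by (smt (verit) mult_pos_pos)
  then show "f = g" using ip_eq_0D[OF d] by (simp add: d_def)
qed

lemma resolvent_eq: "resolvent H T l = inv_into H (\<lambda>f. l *\<^sub>R f + T f)"
proof -
  have "(\<lambda>f x. l * f x + T f x) = (\<lambda>f. l *\<^sub>R f + T f)" by (intro ext) (simp add: fun_apply)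
  then show ?thesis unfolding resolvent_def by simp
qed

lemma resolvent_left:
  assumes "pos_op T" "l > 0" "f \<in> H"
  shows "resolvent H T l (l *\<^sub>R f + T f) = f"
  unfolding resolvent_eq using inv_into_f_f[OF shift_inj_on[OF assms(1,2)] assms(3)] .

text \<open>The iteration gives surjectivity of l + T on \<open>H\<close> and
  \<open>shift_inj_on\<close> gives injectivity, so the value of \<open>inv_into\<close> is the
  limit of the iterates.\<close>

lemma resolvent_limit:
  assumes "pos_bdd c T" "l > 0" "f \<in> H"
  shows "hlim (res_iter c T l f) (resolvent H T l f) sequentially"
    and "l *\<^sub>R resolvent H T l f + T (resolvent H T l f) = f"
proof -
  obtain h where h: "hlim (res_iter c T l f) h sequentially" "l *\<^sub>R h + T h = f"
    using res_iter_converges[OF assms] by blast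
  have "resolvent H T l f = h"
    using resolvent_left[of T l h] assms h hlim_mem[OF h(1)] pos_bdd_pos_op by auto
  then show "hlim (res_iter c T l f) (resolvent H T l f) sequentially"
    and "l *\<^sub>R resolvent H T l f + T (resolvent H T l f) = f" using h by auto
qed

text \<open>Linearity is obtained by applying l + T to the claimed value and using that the
  resolvent is its left inverse. Symmetry and positivity are those of the form of l + T at resolvent
  values.\<close>

lemma resolvent_pos_op:
  assumes "pos_bdd c T" "l > 0"
  shows "pos_op (resolvent H T l)"
proof -
  let ?R = "resolvent H T l"
  have T: "pos_op T" using assms pos_bdd_pos_op by blast
  have mem: "?R f \<in> H" if "f \<in> H" for f
    using hlim_mem[OF resolvent_limit(1)[OF assms that]] .
  have eq: "l *\<^sub>R ?R f + T (?R f) = f" if "f \<in> H" for f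
    using resolvent_limit(2)[OF assms that] .
  have add: "?R (f + g) = ?R f + ?R g" if f: "f \<in> H" and g: "g \<in> H" for f g
  proof -
    have "l *\<^sub>R (?R f + ?R g) + T (?R f + ?R g) = (l *\<^sub>R ?R f + T (?R f)) + (l *\<^sub>R ?R g + T (?R g))"
      using mem f g by (simp add: pos_op_add[OF T] algebra_simps)
    also have "\<dots> = f + g" using eq f g by simp
    finally show ?thesis
      using resolvent_left[OF T assms(2), of "?R f + ?R g"] mem f g by auto
  qed
  have scale: "?R (a *\<^sub>R f) = a *\<^sub>R ?R f" if f: "f \<in> H" for a f
  proof -
    have "l *\<^sub>R (a *\<^sub>R ?R f) + T (a *\<^sub>R ?R f) = a *\<^sub>R (l *\<^sub>R ?R f + T (?R f))"
      using mem f by (simp add: pos_op_scale[OF T] algebra_simps)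
    also have "\<dots> = a *\<^sub>R f" using eq f by simp
    finally show ?thesis
      using resolvent_left[OF T assms(2), of "a *\<^sub>R ?R f"] mem f by auto
  qed
  have S: "pos_op (\<lambda>f. l *\<^sub>R f + T f)" using pos_op_shift[OF T] assms by simp
  have sym: "ip (?R f) g = ip f (?R g)" if "f \<in> H" "g \<in> H" for f g
    using pos_op_sym[OF S, of "?R f" "?R g"] mem that eq by simp
  have nonneg: "ip (?R f) f \<ge> 0" if "f \<in> H" for f
    using pos_op_nonneg[OF S, of "?R f"] mem[OF that] eq[OF that] ip_commute[OF that, of "?R f"] by simp
  show ?thesis unfolding pos_op_def
    by (intro conjI ballI allI; (rule mem add scale sym nonneg)?; assumption)
qed

text \<open>With r = R f, the form (r, f) equals l |r|^2 + (T r, r), which gives the first bound.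
  Cauchy-Schwarz between r and f turns it into the second, and the two combine to the third.\<close>

lemma
  assumes T: "pos_bdd c T" and l: "l > 0" and f: "f \<in> H"
  shows resolvent_norm_le_form: "l * ip (resolvent H T l f) (resolvent H T l f) \<le> ip (resolvent H T l f) f"
    and resolvent_form_le: "l * ip (resolvent H T l f) f \<le> ip f f"
    and resolvent_norm_le: "l\<^sup>2 * ip (resolvent H T l f) (resolvent H T l f) \<le> ip f f"
proof -
  let ?r = "resolvent H T l f"
  have Tp: "pos_op T" using T pos_bdd_pos_op by blast
  have r: "?r \<in> H" using pos_op_mem[OF resolvent_pos_op[OF T l] f] .
  have "ip ?r f = ip (l *\<^sub>R ?r + T ?r) ?r"
    using resolvent_limit(2)[OF T l f] ip_commute[OF r f] by simp
  then have form: "ip ?r f = l * ip ?r ?r + ip (T ?r) ?r"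
    using r pos_op_mem[OF Tp r] by (simp add: ip_linear)
  then show 1: "l * ip ?r ?r \<le> ip ?r f" using pos_op_nonneg[OF Tp r] by simp
  have nn: "ip ?r f \<ge> 0" using form ip_nonneg[OF r] pos_op_nonneg[OF Tp r] l by simp
  have "l * (ip ?r f)\<^sup>2 \<le> l * (ip ?r ?r * ip f f)"
    using Cauchy_Schwarz[OF r f] l by simp
  also have "\<dots> \<le> ip ?r f * ip f f"
    using mult_right_mono[OF 1 ip_nonneg[OF f]] by (simp add: algebra_simps)
  finally have "(l * ip ?r f) * ip ?r f \<le> ip f f * ip ?r f" by (simp add: power2_eq_square algebra_simps)
  then show 2: "l * ip ?r f \<le> ip f f"
    using nn ip_nonneg[OF f] by (cases "ip ?r f = 0") auto
  show "l\<^sup>2 * ip ?r ?r \<le> ip f f"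
    using order_trans[OF mult_left_mono[OF 1, of l] 2] l by (simp add: power2_eq_square mult.assoc)
qed

lemma resolvent_pos_bdd:
  assumes "pos_bdd c T" "l > 0"
  shows "pos_bdd (1 / l\<^sup>2) (resolvent H T l)"
  using resolvent_pos_op[OF assms] resolvent_norm_le[OF assms] assms(2)
  unfolding pos_bdd_def by (auto simp: field_simps)

lemma resolvent_op_eq:
  assumes "pos_bdd c T" "l > 0" "f \<in> H"
  shows "resolvent H T l (T f) = f - l *\<^sub>R resolvent H T l f"
proof -
  have R: "pos_op (resolvent H T l)" using resolvent_pos_op[OF assms(1,2)] .
  have T: "pos_op T" using assms pos_bdd_pos_op by blast
  have "resolvent H T l (l *\<^sub>R f + T f) = f" using resolvent_left[OF T assms(2,3)] .
  moreover have "resolvent H T l (l *\<^sub>R f + T f) = l *\<^sub>R resolvent H T l f + resolvent H T l (T f)"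
    using assms(3) pos_op_mem[OF T assms(3)]
    by (simp add: pos_op_add[OF R] pos_op_scale[OF R])
  ultimately show ?thesis by (simp add: eq_diff_eq add.commute)
qed

end

section \<open>Comparison of two resolvents\<close>

text \<open>Expanding the square gives E^2 + E'^2 <= (2 + q) E E'. Drop E'^2 and divide by
  E.\<close>

lemma form_comparison:
  fixes E E' q :: real
  assumes "E \<ge> 0" "E' \<ge> 0" "q \<ge> 0" "(E - E')\<^sup>2 \<le> q * E * E'"
  shows "E \<le> (2 + q) * E'"
proof (cases "E = 0")
  case False
  have "E * E + E' * E' \<le> ((2 + q) * E') * E"
    using assms(4) by (simp add: power2_eq_square algebra_simps)
  then have "E * E \<le> ((2 + q) * E') * E"
    using zero_le_square[of E'] by linarith
  then show ?thesis using False assms(1) by (simp add: mult_le_cancel_right)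
qed (use assms in simp)

text \<open>Recurring device: Cauchy-Schwarz bounds the square of a quadratic form X by a constant
  times X itself, and one factor is cancelled.\<close>

lemma le_if_square_le_mult:
  fixes X c :: real
  assumes "X \<ge> 0" "c \<ge> 0" "X\<^sup>2 \<le> c * X"
  shows "X \<le> c"
  using assms by (cases "X = 0") (auto simp: power2_eq_square)

text \<open>\<open>T\<close> will be the integral operator, \<open>T'\<close> its empirical version, and \<open>Q\<close> the squared
  Hilbert-Schmidt norm of \<open>(T + l)\<^sup>-\<^sup>1\<^sup>/\<^sup>2 (T - T')\<close>.\<close>

locale two_resolvents = rkhs +
  fixes T T' c c' l Q
  assumes T: "pos_bdd c T" and T': "pos_bdd c' T'" and l: "l > 0" and Q_nonneg: "Q \<ge> 0"
    and diff_bound: "f \<in> H \<Longrightarrow> ip (T f - T' f) (T f - T' f) \<le> Q * (l * ip f f + ip (T f) f)"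
begin

abbreviation "R \<equiv> resolvent H T l"
abbreviation "R' \<equiv> resolvent H T' l"

definition "q = Q / l"

definition "S f = l *\<^sub>R f + T f"
definition "S' f = l *\<^sub>R f + T' f"

lemma q_nonneg: "q \<ge> 0"
  using Q_nonneg l by (simp add: q_def)

lemma Tp: "pos_op T" and T'p: "pos_op T'"
  using T T' pos_bdd_pos_op by auto

lemma S: "pos_op S" and S': "pos_op S'"
  unfolding S_def S'_def using pos_op_shift Tp T'p l by auto

lemma R: "pos_op R" and R': "pos_op R'"
  using resolvent_pos_op T T' l by auto

lemmas mem = pos_op_mem[OF Tp] pos_op_mem[OF T'p] pos_op_mem[OF S] pos_op_mem[OF S']
  pos_op_mem[OF R] pos_op_mem[OF R']

lemma S_R: "f \<in> H \<Longrightarrow> S (R f) = f" and S'_R': "f \<in> H \<Longrightarrow> S' (R' f) = f"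
  unfolding S_def S'_def using resolvent_limit(2) T T' l by auto

lemma S_form: "f \<in> H \<Longrightarrow> ip (S f) f = l * ip f f + ip (T f) f"
  by (simp add: S_def ip_linear mem)

lemma S_form_R: "f \<in> H \<Longrightarrow> ip (S (R f)) (R f) = ip (R f) f"
  by (simp add: S_R ip_commute mem)

lemma S'_form_R': "f \<in> H \<Longrightarrow> ip (S' (R' f)) (R' f) = ip (R' f) f"
  by (simp add: S'_R' ip_commute mem)

text \<open>The two forms differ by ((T - T') f, f). Cauchy-Schwarz and \<open>diff_bound\<close>
  bound its square by Q E |f|^2, and l |f|^2 <= E' supplies the missing factor.\<close>

lemma S_form_le:
  assumes f: "f \<in> H"
  shows "ip (S f) f \<le> (2 + q) * ip (S' f) f"
proof (rule form_comparison)
  show nn: "ip (S f) f \<ge> 0" "ip (S' f) f \<ge> 0" using pos_op_nonneg[OF S f] pos_op_nonneg[OF S' f] .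
  have "ip (S' f) f = l * ip f f + ip (T' f) f" using f by (simp add: S'_def ip_linear mem)
  then have le: "l * ip f f \<le> ip (S' f) f" using pos_op_nonneg[OF T'p f] by simp
  have "ip (S f) f - ip (S' f) f = ip (T f - T' f) f"
    using f by (simp add: S_def S'_def ip_linear mem)
  then have "(ip (S f) f - ip (S' f) f)\<^sup>2 \<le> ip (T f - T' f) (T f - T' f) * ip f f"
    using Cauchy_Schwarz[of "T f - T' f" f] f mem by simp
  also have "\<dots> \<le> (Q * ip (S f) f) * ip f f"
    using diff_bound[OF f] f by (intro mult_right_mono) (auto simp: S_form ip_nonneg)
  also have "\<dots> = q * ip (S f) f * (l * ip f f)" using l by (simp add: q_def)
  also have "\<dots> \<le> q * ip (S f) f * ip (S' f) f"
    by (rule mult_left_mono[OF le mult_nonneg_nonneg[OF q_nonneg nn(1)]])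
  finally show "(ip (S f) f - ip (S' f) f)\<^sup>2 \<le> q * ip (S f) f * ip (S' f) f" .
qed (rule q_nonneg)

text \<open>Inversion reverses the order of \<open>S_form_le\<close>. Writing (R' f, f) as (S R' f,
  R f) and applying Cauchy-Schwarz for the form of \<open>S\<close> proves this without operator
  roots.\<close>

lemma R'_form_le:
  assumes f: "f \<in> H"
  shows "ip (R' f) f \<le> (2 + q) * ip (R f) f"
proof (rule le_if_square_le_mult)
  show "0 \<le> ip (R' f) f" "0 \<le> (2 + q) * ip (R f) f"
    using pos_op_nonneg[OF R f] pos_op_nonneg[OF R' f] q_nonneg by auto
  have "(ip (R' f) f)\<^sup>2 = (ip (S (R' f)) (R f))\<^sup>2"
    using pos_op_sym[OF S, of "R' f" "R f"] S_R f mem by simp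
  also have "\<dots> \<le> ip (S (R' f)) (R' f) * ip (S (R f)) (R f)"
    using pos_op_Cauchy_Schwarz[OF S] f mem by simp
  also have "\<dots> \<le> ((2 + q) * ip (S' (R' f)) (R' f)) * ip (S (R f)) (R f)"
    using S_form_le[of "R' f"] pos_op_nonneg[OF S, of "R f"] f mem by (intro mult_right_mono) auto
  also have "\<dots> = (2 + q) * ip (R f) f * ip (R' f) f"
    using f by (simp add: S'_form_R' S_form_R)
  finally show "(ip (R' f) f)\<^sup>2 \<le> (2 + q) * ip (R f) f * ip (R' f) f" .
qed

text \<open>The adjoint of \<open>diff_bound\<close>: the hypothesis controls (T - T') S^(-1/2), the
  conclusion S^(-1/2) (T - T'). It follows by testing the hypothesis at \<open>R y\<close> and
  moving T - T' across the inner product.\<close>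

lemma R_diff_form_le:
  assumes h: "h \<in> H"
  shows "ip (R (T h - T' h)) (T h - T' h) \<le> Q * ip h h"
proof (rule le_if_square_le_mult)
  define y where "y = T h - T' h"
  have y: "y \<in> H" using h mem by (simp add: y_def)
  have Ry: "R y \<in> H" using y mem by simp
  show "0 \<le> ip (R (T h - T' h)) (T h - T' h)" "0 \<le> Q * ip h h"
    using pos_op_nonneg[OF R y] Q_nonneg ip_nonneg[OF h] by (auto simp: y_def)
  have "ip (T (R y) - T' (R y)) h = ip (R y) (T h - T' h)"
    using h Ry mem pos_op_sym[OF Tp Ry h] pos_op_sym[OF T'p Ry h]
    by (simp add: ip_diff_left ip_diff_right)
  then have "ip (R y) y = ip (T (R y) - T' (R y)) h" by (simp add: y_def)
  then have "(ip (R y) y)\<^sup>2 \<le> ip (T (R y) - T' (R y)) (T (R y) - T' (R y)) * ip h h"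
    using Cauchy_Schwarz[of "T (R y) - T' (R y)" h] Ry h mem by simp
  also have "\<dots> \<le> (Q * ip (S (R y)) (R y)) * ip h h"
    using diff_bound[OF Ry] Ry h by (intro mult_right_mono) (auto simp: S_form ip_nonneg)
  also have "\<dots> = Q * ip h h * ip (R y) y" using S_form_R[OF y] by simp
  finally show "(ip (R (T h - T' h)) (T h - T' h))\<^sup>2 \<le> Q * ip h h * ip (R (T h - T' h)) (T h - T' h)"
    by (simp add: y_def)
qed

lemma S_form_R'_le: "f \<in> H \<Longrightarrow> ip (S (R' f)) (R' f) \<le> (2 + q) * ip (R' f) f"
  using S_form_le[of "R' f"] S'_form_R'[of f] mem by simp

text \<open>Since S = S' + (T - T'), the inner resolvent gives k = h + R' (T - T') h, with |k|^2 <=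
  2 (1 + q)^2 |h|^2. Replacing the form of S by that of S' in the outer resolvent costs another 2 +
  q <= 2 (1 + q). The resulting cube is why third moments of q are needed.\<close>

lemma R'_R'_S_bound:
  assumes h: "h \<in> H"
  shows "l * ip (S (R' (R' (S h)))) (R' (R' (S h))) \<le> 4 * (1 + q) ^ 3 * ip h h"
proof -
  define k where "k = R' (S h)"
  define y where "y = T h - T' h"
  have y: "y \<in> H" and k: "k \<in> H" using h mem by (auto simp: y_def k_def)
  have "S h = (l *\<^sub>R h + T' h) + y" by (simp add: S_def y_def)
  then have "k = h + R' y"
    using resolvent_left[OF T'p l h] h y mem by (simp add: k_def pos_op_add[OF R'])
  then have "ip k k \<le> 2 * ip h h + 2 * ip (R' y) (R' y)"
    using ip_add_self_le[of h "R' y"] h y mem by simp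
  moreover have "l * ip (R' y) (R' y) \<le> l * ((2 + q) * q * ip h h)"
  proof -
    have "l * ip (R' y) (R' y) \<le> ip (R' y) y" by (rule resolvent_norm_le_form[OF T' l y])
    also have "\<dots> \<le> (2 + q) * ip (R y) y" by (rule R'_form_le[OF y])
    also have "\<dots> \<le> (2 + q) * (Q * ip h h)"
      using R_diff_form_le[OF h] q_nonneg by (intro mult_left_mono) (auto simp: y_def)
    also have "\<dots> = l * ((2 + q) * q * ip h h)" using l by (simp add: q_def field_simps)
    finally show ?thesis .
  qed
  then have "ip (R' y) (R' y) \<le> (2 + q) * q * ip h h" using l by simp
  ultimately have kk: "ip k k \<le> 2 * (1 + q)\<^sup>2 * ip h h"
    by (simp add: power2_eq_square algebra_simps)
  have "l * ip (S (R' k)) (R' k) \<le> l * ((2 + q) * ip (R' k) k)"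
    using S_form_R'_le[OF k] l by (intro mult_left_mono) auto
  also have "\<dots> = (2 + q) * (l * ip (R' k) k)" by simp
  also have "\<dots> \<le> (2 + q) * ip k k"
    by (rule mult_left_mono[OF resolvent_form_le[OF T' l k]]) (use q_nonneg in linarith)
  also have "\<dots> \<le> (2 * (1 + q)) * (2 * (1 + q)\<^sup>2 * ip h h)"
    by (rule mult_mono[OF _ kk]) (use q_nonneg ip_nonneg[OF k] in simp_all)
  also have "\<dots> = 4 * (1 + q) ^ 3 * ip h h" by (simp add: power2_eq_square power3_eq_cube)
  finally show ?thesis by (simp add: k_def)
qed

text \<open>Says that S^(1/2) R' S^(1/2) has norm at most 2 + q.\<close>

lemma R'_S_bound:
  assumes h: "h \<in> H"
  shows "ip (S (R' (S h))) (R' (S h)) \<le> (2 + q)\<^sup>2 * ip (S h) h"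
proof (rule le_if_square_le_mult)
  define v where "v = R' (S h)"
  have v: "v \<in> H" using h mem by (simp add: v_def)
  have nn: "0 \<le> ip (S v) v" using pos_op_nonneg[OF S v] .
  then show "0 \<le> ip (S (R' (S h))) (R' (S h))" by (simp add: v_def)
  show "0 \<le> (2 + q)\<^sup>2 * ip (S h) h" using pos_op_nonneg[OF S h] by simp
  have "ip (S v) v \<le> (2 + q) * ip v (S h)"
    using S_form_R'_le[of "S h"] h mem by (simp add: v_def)
  then have "(ip (S v) v)\<^sup>2 \<le> ((2 + q) * ip v (S h))\<^sup>2" using nn by (rule power_mono)
  also have "\<dots> = (2 + q)\<^sup>2 * (ip (S v) h)\<^sup>2"
    using pos_op_sym[OF S v h] by (simp add: power_mult_distrib)
  also have "\<dots> \<le> (2 + q)\<^sup>2 * (ip (S v) v * ip (S h) h)"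
    using pos_op_Cauchy_Schwarz[OF S v h] by (intro mult_left_mono) auto
  finally show "(ip (S (R' (S h))) (R' (S h)))\<^sup>2 \<le> (2 + q)\<^sup>2 * ip (S h) h * ip (S (R' (S h))) (R' (S h))"
    by (simp add: v_def algebra_simps)
qed

text \<open>Each exchange between S and S' costs a factor 2 + q, and \<open>R_diff_form_le\<close>
  contributes Q = l q. The bound vanishes with q, which is what makes the perturbation term
  small.\<close>

lemma R'_R'_diff_bound:
  assumes g: "g \<in> H"
  shows "l * ip (S (R' (R' (T g - T' g)))) (R' (R' (T g - T' g))) \<le> (2 + q)\<^sup>2 * q * ip g g"
proof -
  define y where "y = T g - T' g"
  have y: "y \<in> H" using g mem by (simp add: y_def)
  then have v: "R' y \<in> H" using mem by simp
  have "l * (l * ip (S (R' (R' y))) (R' (R' y))) \<le> l * (l * ((2 + q) * ip (R' (R' y)) (R' y)))"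
    using S_form_R'_le[OF v] l by (intro mult_left_mono) auto
  also have "\<dots> = l * (2 + q) * (l * ip (R' (R' y)) (R' y))" by simp
  also have "\<dots> \<le> l * (2 + q) * ip (R' y) (R' y)"
    by (rule mult_left_mono[OF resolvent_form_le[OF T' l v]]) (use q_nonneg l in simp)
  also have "\<dots> = (2 + q) * (l * ip (R' y) (R' y))" by simp
  also have "\<dots> \<le> (2 + q) * ((2 + q) * (Q * ip g g))"
  proof (rule mult_left_mono)
    have "l * ip (R' y) (R' y) \<le> ip (R' y) y" by (rule resolvent_norm_le_form[OF T' l y])
    also have "\<dots> \<le> (2 + q) * ip (R y) y" by (rule R'_form_le[OF y])
    also have "\<dots> \<le> (2 + q) * (Q * ip g g)"
      using R_diff_form_le[OF g] q_nonneg by (intro mult_left_mono) (auto simp: y_def)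
    finally show "l * ip (R' y) (R' y) \<le> (2 + q) * (Q * ip g g)" .
  qed (use q_nonneg in simp)
  also have "\<dots> = l * ((2 + q)\<^sup>2 * q * ip g g)" using l by (simp add: q_def power2_eq_square field_simps)
  finally show ?thesis using l by (simp add: y_def)
qed

text \<open>The bias correction as a spectral filter of T', with filter function g(s) = (s + 2l)/(s
  + l)^2. Its residual 1 - s g(s) is l^2/(s + l)^2, quadratic in l, which is the content of
  \<open>G_T'\<close>.\<close>

definition "G f = R' f + l *\<^sub>R R' (R' f)"

lemma G_mem: "f \<in> H \<Longrightarrow> G f \<in> H"
  by (simp add: G_def mem)

text \<open>Enlarge T' to S' and use S' G k = k + l R' k. Expanding gives (R' k, k) plus terms that
  amount to at most three further copies of it, hence the factor 4. Then R' is exchanged for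
  R.\<close>

lemma G_form_le:
  assumes k: "k \<in> H"
  shows "ip (T' (G k)) (G k) \<le> 4 * (2 + q) * ip (R k) k"
proof -
  have Rk: "R' k \<in> H" and RRk: "R' (R' k) \<in> H" using k mem by auto
  have G: "G k \<in> H" using k by (rule G_mem)
  have "ip (T' (G k)) (G k) \<le> ip (S' (G k)) (G k)"
    using G ip_nonneg[OF G] l by (simp add: S'_def ip_linear mem)
  also have "S' (G k) = k + l *\<^sub>R R' k"
    using S'_R' k Rk RRk by (simp add: G_def pos_op_add[OF S'] pos_op_scale[OF S'])
  also have "ip (k + l *\<^sub>R R' k) (G k) = ip (R' k) k + 2 * (l * ip (R' k) (R' k)) + l * (l * ip (R' (R' k)) (R' k))"
    using k Rk RRk pos_op_sym[OF R' k Rk] ip_commute[OF k Rk] ip_commute[OF RRk Rk]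
      pos_op_sym[OF R' Rk k] ip_commute[OF k RRk]
    by (simp add: G_def ip_linear algebra_simps)
  also have "l * (l * ip (R' (R' k)) (R' k)) \<le> l * ip (R' k) (R' k)"
    using resolvent_form_le[OF T' l Rk] l by (intro mult_left_mono) auto
  also have "ip (R' k) k + 2 * (l * ip (R' k) (R' k)) + l * ip (R' k) (R' k) \<le> 4 * ip (R' k) k"
    using resolvent_norm_le_form[OF T' l k] by simp
  also have "\<dots> \<le> 4 * ((2 + q) * ip (R k) k)" using R'_form_le[OF k] by simp
  finally show ?thesis by (simp add: algebra_simps)
qed

lemma G_T': "f \<in> H \<Longrightarrow> f - G (T' f) = l\<^sup>2 *\<^sub>R R' (R' f)"
proof -
  assume f: "f \<in> H"
  have 1: "R' (T' g) = g - l *\<^sub>R R' g" if "g \<in> H" for g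
    using resolvent_op_eq[OF T' l that] .
  have 2: "R' (f - l *\<^sub>R R' f) = R' f - l *\<^sub>R R' (R' f)"
    using f mem by (simp add: pos_op_diff[OF R'] pos_op_scale[OF R'])
  show ?thesis unfolding G_def 1[OF f] 2 by (simp add: power2_eq_square algebra_simps)
qed

end

section \<open>Mercer kernels and the integral operator\<close>

lemma abs_mult_le_sum_squares: "\<bar>a * b\<bar> \<le> a\<^sup>2 + b\<^sup>2" for a b :: real
  using zero_le_power2[of "a + b"] zero_le_power2[of "a - b"] zero_le_power2[of a] zero_le_power2[of b]
  unfolding power2_sum power2_diff abs_le_iff by linarith

lemma L2_product_integrable:
  assumes "f \<in> L2 M" "g \<in> L2 M"
  shows "integrable M (\<lambda>x. f x * g x)"
proof (rule Bochner_Integration.integrable_bound)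
  show "integrable M (\<lambda>x. (f x)\<^sup>2 + (g x)\<^sup>2)" using assms by (auto simp: L2_def)
  show "(\<lambda>x. f x * g x) \<in> borel_measurable M" using assms by (auto simp: L2_def)
  show "AE x in M. norm (f x * g x) \<le> norm ((f x)\<^sup>2 + (g x)\<^sup>2)"
    using abs_mult_le_sum_squares by simp
qed

lemma L2_Cauchy_Schwarz:
  assumes f: "f \<in> L2 M" and g: "g \<in> L2 M"
  shows "(\<integral>x. f x * g x \<partial>M)\<^sup>2 \<le> (\<integral>x. (f x)\<^sup>2 \<partial>M) * (\<integral>x. (g x)\<^sup>2 \<partial>M)"
proof (rule nonneg_quadratic_imp_discriminant)
  fix t
  note [simp] = L2_product_integrable[OF f g]
  have [simp]: "integrable M (\<lambda>x. (f x)\<^sup>2)" "integrable M (\<lambda>x. (g x)\<^sup>2)"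
    using f g by (auto simp: L2_def)
  have "0 \<le> (\<integral>x. (f x + t * g x)\<^sup>2 \<partial>M)" by simp
  also have "\<dots> = (\<integral>x. (f x)\<^sup>2 + 2 * t * (f x * g x) + t\<^sup>2 * (g x)\<^sup>2 \<partial>M)"
    by (simp add: power2_eq_square algebra_simps)
  also have "\<dots> = (\<integral>x. (f x)\<^sup>2 \<partial>M) + 2 * t * (\<integral>x. f x * g x \<partial>M) + t\<^sup>2 * (\<integral>x. (g x)\<^sup>2 \<partial>M)"
    by simp
  finally show "0 \<le> \<dots>" .
qed simp

locale mercer_rkhs = rkhs K H ip
  for K :: "'a::compact_metric_space \<Rightarrow> 'a \<Rightarrow> real" and H ip +
  fixes mu :: "'a measure"
  assumes mercer: "mercer_kernel K" and prob: "prob_space mu" and sets_mu: "sets mu = sets borel"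

sublocale mercer_rkhs \<subseteq> mu: prob_space mu
  by (rule prob)

context mercer_rkhs
begin

abbreviation "\<kappa> \<equiv> kappa K"
abbreviation "L \<equiv> integral_op mu K"

lemma K_sym: "K x y = K y x"
  using mercer by (simp add: mercer_kernel_def)

lemma K_continuous: "continuous_on UNIV (\<lambda>p. K (fst p) (snd p))"
  using mercer by (simp add: mercer_kernel_def case_prod_beta)

lemma ip_kernel: "ip (K x) (K y) = K x y"
  by (simp add: reproducing)

lemma K_continuous_comp [continuous_intros]:
  "continuous_on S f \<Longrightarrow> continuous_on S g \<Longrightarrow> continuous_on S (\<lambda>x. K (f x) (g x))"
  using continuous_on_compose2[OF K_continuous, of S "\<lambda>x. (f x, g x)"] by (auto intro: continuous_intros)

lemma K_diag_nonneg: "K x x \<ge> 0"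
  using ip_nonneg[OF H_kernel] ip_kernel by simp

lemma kappa_ge_1: "\<kappa> \<ge> 1"
  by (simp add: kappa_def)

text \<open>Compactness of the input space makes the supremum in \<open>kappa\<close> one over a
  bounded set, so that it is an actual upper bound.\<close>

lemma K_diag_le: "K x x \<le> \<kappa>\<^sup>2"
proof -
  have "continuous_on UNIV (\<lambda>x. sqrt (K x x))" by (intro continuous_intros)
  then have "compact (range (\<lambda>x. sqrt (K x x)))"
    using compact_continuous_image[OF _ compact_UNIV] by blast
  then have "bdd_above (range (\<lambda>x. sqrt (K x x)))"
    by (simp add: bounded_imp_bdd_above compact_imp_bounded)
  then have "sqrt (K x x) \<le> (SUP x. sqrt (K x x))" by (rule cSUP_upper[OF UNIV_I])
  then have "sqrt (K x x) \<le> \<kappa>" by (simp add: kappa_def)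
  then show ?thesis by (rule sqrt_le_D)
qed

lemma H_eval_le: "f \<in> H \<Longrightarrow> (f x)\<^sup>2 \<le> \<kappa>\<^sup>2 * ip f f"
proof -
  assume f: "f \<in> H"
  have "(f x)\<^sup>2 \<le> ip f f * ip (K x) (K x)"
    using Cauchy_Schwarz[OF f H_kernel[of x]] f by (simp add: reproducing)
  also have "\<dots> \<le> ip f f * \<kappa>\<^sup>2"
    using K_diag_le ip_nonneg[OF f] by (intro mult_left_mono) (auto simp: ip_kernel)
  finally show ?thesis by (simp add: mult.commute)
qed

lemma H_abs_eval_le: "f \<in> H \<Longrightarrow> \<bar>f x\<bar> \<le> \<kappa> * sqrt (ip f f)"
  using H_eval_le[of f x] kappa_ge_1 real_le_rsqrt[of "\<bar>f x\<bar>"]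
  by (fastforce simp: real_sqrt_mult dest: real_sqrt_le_mono)

text \<open>The increment f y - f x is the inner product of f with K y - K x, whose norm is an
  expression in K and tends to zero.\<close>

lemma H_continuous:
  assumes f: "f \<in> H"
  shows "continuous_on UNIV f"
proof -
  have "isCont f x" for x
  proof -
    define d where "d y = sqrt (ip f f) * sqrt (K y y - 2 * K y x + K x x)" for y
    have "continuous_on UNIV d" unfolding d_def by (intro continuous_intros)
    then have "isCont d x" by (simp add: continuous_on_eq_continuous_at)
    moreover have "d x = 0" by (simp add: d_def)
    ultimately have lim: "(d \<longlongrightarrow> 0) (at x)" by (simp add: isCont_def)
    have "norm (f y - f x) \<le> d y" for y
    proof -
      have "f y - f x = ip f (K y - K x)" using f by (simp add: ip_linear reproducing)
      moreover have "ip (K y - K x) (K y - K x) = K y y - 2 * K y x + K x x"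
        using K_sym[of x y] by (simp add: ip_linear ip_kernel)
      ultimately show ?thesis using abs_ip_le[OF f, of "K y - K x"] by (simp add: d_def)
    qed
    then have "((\<lambda>y. f y - f x) \<longlongrightarrow> 0) (at x)"
      by (intro Lim_null_comparison[OF _ lim]) auto
    then show ?thesis by (simp add: isCont_def LIM_zero_iff)
  qed
  then show ?thesis by (simp add: continuous_at_imp_continuous_on)
qed

lemma borel_measurable_mu: "borel_measurable mu = borel_measurable borel"
  by (rule measurable_cong_sets[OF sets_mu refl])

lemma H_measurable: "f \<in> H \<Longrightarrow> f \<in> borel_measurable borel"
  using H_continuous by (rule borel_measurable_continuous_onI)

lemma H_measurable_mu [measurable]: "f \<in> H \<Longrightarrow> f \<in> borel_measurable mu"
  by (simp add: borel_measurable_mu H_measurable)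

lemma K_measurable_borel [measurable]: "(\<lambda>p. K (fst p) (snd p)) \<in> borel_measurable (borel \<Otimes>\<^sub>M borel)"
  unfolding borel_prod by (rule borel_measurable_continuous_onI[OF K_continuous])

lemma H_L2: "f \<in> H \<Longrightarrow> f \<in> L2 mu"
  unfolding L2_def
proof (clarsimp, rule mu.integrable_const_bound)
  assume f: "f \<in> H"
  show "AE x in mu. norm ((f x)\<^sup>2) \<le> \<kappa>\<^sup>2 * ip f f" using H_eval_le[OF f] by simp
  show "(\<lambda>x. (f x)\<^sup>2) \<in> borel_measurable mu" using f by measurable
qed

lemma L2_times_H: "f \<in> L2 mu \<Longrightarrow> g \<in> H \<Longrightarrow> integrable mu (\<lambda>x. f x * g x)"
  by (simp add: H_L2 L2_product_integrable)

lemma sq_integral_H_le: "f \<in> H \<Longrightarrow> (\<integral>x. (f x)\<^sup>2 \<partial>mu) \<le> \<kappa>\<^sup>2 * ip f f"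
  using mu.integral_le_const[of "\<lambda>x. (f x)\<^sup>2"] H_L2[of f] H_eval_le[of f] by (auto simp: L2_def)

text \<open>The functional g -> integral of f g is bounded on \<open>H\<close>. Its Riesz
  representative, evaluated through \<open>K x\<close>, is the function \<open>L f\<close>. This
  places \<open>L f\<close> in \<open>H\<close> without integrating vectors.\<close>

lemma L_Riesz:
  assumes f: "f \<in> L2 mu"
  shows "L f \<in> H \<and> (\<forall>g\<in>H. ip (L f) g = (\<integral>x. f x * g x \<partial>mu))"
proof -
  obtain B where "orthonormal_basis H ip B" using orthonormal_basis_exists by blast
  then interpret rkhs_basis K H ip B by unfold_locales
  define N where "N = sqrt (\<integral>x. (f x)\<^sup>2 \<partial>mu)"
  have "\<exists>w\<in>H. \<forall>g\<in>H. ip w g = (\<integral>x. f x * g x \<partial>mu)"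
  proof (rule Riesz)
    fix g h assume "g \<in> H" "h \<in> H"
    then show "(\<integral>x. f x * (g + h) x \<partial>mu) = (\<integral>x. f x * g x \<partial>mu) + (\<integral>x. f x * h x \<partial>mu)"
      using L2_times_H[OF f] by (simp add: fun_apply distrib_left)
  next
    fix c g assume "g \<in> H"
    have "(\<integral>x. f x * (c *\<^sub>R g) x \<partial>mu) = (\<integral>x. c * (f x * g x) \<partial>mu)"
      by (simp add: fun_apply algebra_simps)
    then show "(\<integral>x. f x * (c *\<^sub>R g) x \<partial>mu) = c * (\<integral>x. f x * g x \<partial>mu)" by simp
  next
    fix g assume g: "g \<in> H"
    have "(\<integral>x. f x * g x \<partial>mu)\<^sup>2 \<le> (\<integral>x. (f x)\<^sup>2 \<partial>mu) * (\<integral>x. (g x)\<^sup>2 \<partial>mu)"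
      by (rule L2_Cauchy_Schwarz[OF f H_L2[OF g]])
    also have "\<dots> \<le> (\<integral>x. (f x)\<^sup>2 \<partial>mu) * (\<kappa>\<^sup>2 * ip g g)"
      using sq_integral_H_le[OF g] by (intro mult_left_mono) auto
    finally have "sqrt ((\<integral>x. f x * g x \<partial>mu)\<^sup>2) \<le> sqrt ((\<integral>x. (f x)\<^sup>2 \<partial>mu) * (\<kappa>\<^sup>2 * ip g g))"
      by (rule real_sqrt_le_mono)
    then show "\<bar>\<integral>x. f x * g x \<partial>mu\<bar> \<le> (N * \<kappa>) * sqrt (ip g g)"
      using kappa_ge_1 by (simp add: N_def real_sqrt_mult)
  qed
  then obtain w where w: "w \<in> H" "\<And>g. g \<in> H \<Longrightarrow> ip w g = (\<integral>x. f x * g x \<partial>mu)" by blast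
  have "L f x = w x" for x
    using w(2)[OF H_kernel, of x] w(1) by (simp add: integral_op_def reproducing mult.commute)
  then have "L f = w" by (rule ext)
  then show ?thesis using w by blast
qed

lemma L_mem: "f \<in> L2 mu \<Longrightarrow> L f \<in> H" and ip_L: "f \<in> L2 mu \<Longrightarrow> g \<in> H \<Longrightarrow> ip (L f) g = (\<integral>x. f x * g x \<partial>mu)"
  using L_Riesz by auto

text \<open>Because of this identity all L2 errors can be handled as values of the quadratic form of
  L; the form is later abbreviated \<open>sq\<close>.\<close>

lemma ip_L_self: "f \<in> H \<Longrightarrow> ip (L f) f = (\<integral>x. (f x)\<^sup>2 \<partial>mu)"
  using ip_L[OF H_L2, of f f] by (simp add: power2_eq_square)

text \<open>Take g = u and cancel. If u has norm zero, nonnegativity of the right side is read off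
  from the hypothesis at g = f.\<close>

lemma norm_bound_from_form:
  assumes "u \<in> H" "f \<in> H" "\<And>g. g \<in> H \<Longrightarrow> (ip u g)\<^sup>2 \<le> c * ip f f * ip g g"
  shows "ip u u \<le> c * ip f f"
proof (cases "ip u u = 0")
  case True
  have "u = 0" using ip_eq_0D[OF assms(1) True] .
  have "0 \<le> c * ip f f"
  proof (cases "ip f f = 0")
    case False
    have "0 \<le> (ip u f)\<^sup>2" by simp
    also have "\<dots> \<le> c * ip f f * ip f f" by (rule assms(3)[OF assms(2)])
    finally show ?thesis using False ip_nonneg[OF assms(2)] by (simp add: zero_le_mult_iff)
  qed simp
  then show ?thesis using True by simp
next
  case False
  then have "ip u u > 0" using ip_nonneg[OF assms(1)] by simp
  moreover have "ip u u * ip u u \<le> c * ip f f * ip u u"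
    using assms(3)[OF assms(1)] by (simp add: power2_eq_square)
  ultimately show ?thesis by simp
qed

lemma L_pos_bdd: "pos_bdd (\<kappa> ^ 4) L"
proof -
  have L: "L f \<in> H" if "f \<in> H" for f using that by (simp add: H_L2 L_mem)
  have "L (f + g) = L f + L g" if fg: "f \<in> H" "g \<in> H" for f g
  proof
    fix x
    have "integrable mu (\<lambda>t. f t * K x t)" "integrable mu (\<lambda>t. g t * K x t)"
      using L2_times_H[OF H_L2 H_kernel] fg by auto
    then show "L (f + g) x = (L f + L g) x"
      by (simp add: integral_op_def fun_apply distrib_left mult.commute[of "K x _"] distrib_right)
  qed
  moreover have "L (c *\<^sub>R f) = c *\<^sub>R L f" for c f
    by (rule ext) (simp add: integral_op_def fun_apply mult.left_commute)
  moreover have "ip (L f) g = ip f (L g)" if "f \<in> H" "g \<in> H" for f g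
    using that ip_L[OF H_L2] ip_commute[of f "L g"] L by (simp add: mult.commute)
  moreover have "ip (L f) f \<ge> 0" if "f \<in> H" for f using that by (simp add: ip_L_self)
  ultimately have "pos_op L" using L unfolding pos_op_def by (intro conjI ballI allI) auto
  moreover have "ip (L f) (L f) \<le> \<kappa> ^ 4 * ip f f" if f: "f \<in> H" for f
  proof (rule norm_bound_from_form[OF L[OF f] f])
    fix g assume g: "g \<in> H"
    have "(ip (L f) g)\<^sup>2 \<le> (\<integral>x. (f x)\<^sup>2 \<partial>mu) * (\<integral>x. (g x)\<^sup>2 \<partial>mu)"
      using L2_Cauchy_Schwarz[OF H_L2[OF f] H_L2[OF g]] ip_L[OF H_L2[OF f] g] by simp
    also have "\<dots> \<le> (\<kappa>\<^sup>2 * ip f f) * (\<kappa>\<^sup>2 * ip g g)"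
      using sq_integral_H_le[OF f] sq_integral_H_le[OF g] ip_nonneg[OF f] by (intro mult_mono) auto
    finally show "(ip (L f) g)\<^sup>2 \<le> \<kappa> ^ 4 * ip f f * ip g g"
      by (simp add: power4_eq_xxxx power2_eq_square algebra_simps)
  qed
  ultimately show ?thesis by (simp add: pos_bdd_def)
qed

section \<open>The empirical operator on \<open>H\<close>\<close>

lemma empirical_op_eq:
  "empirical_op K I z f = (1 / real (card I)) *\<^sub>R (\<Sum>i\<in>I. f (fst (z i)) *\<^sub>R K (fst (z i)))"
  by (rule ext) (simp add: empirical_op_def sampling_adj_def sampling_op_def fun_apply)

lemma empirical_op_mem: "empirical_op K I z f \<in> H"
  unfolding empirical_op_eq by auto

lemma ip_empirical_op:
  assumes "g \<in> H"
  shows "ip (empirical_op K I z f) g = 1 / real (card I) * (\<Sum>i\<in>I. f (fst (z i)) * g (fst (z i)))"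
  unfolding empirical_op_eq using assms by (simp add: ip_linear reproducing')

lemma empirical_op_pos_bdd: "pos_bdd (\<kappa> ^ 4) (empirical_op K I z)"
proof -
  let ?T = "empirical_op K I z"
  have "?T (f + g) = ?T f + ?T g" for f g
    unfolding empirical_op_eq by (simp add: fun_apply algebra_simps sum.distrib scaleR_add_right)
  moreover have "?T (c *\<^sub>R f) = c *\<^sub>R ?T f" for c f
    unfolding empirical_op_eq by (simp add: fun_apply scaleR_sum_right mult.commute mult.left_commute)
  moreover have "ip (?T f) g = ip f (?T g)" if "f \<in> H" "g \<in> H" for f g
    using that ip_empirical_op[of g I z f] ip_empirical_op[of f I z g] ip_commute[of f "?T g"]
      empirical_op_mem by (simp add: mult.commute)
  moreover have "ip (?T f) f \<ge> 0" if "f \<in> H" for f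
    using that by (simp add: ip_empirical_op sum_nonneg)
  ultimately have "pos_op ?T"
    using empirical_op_mem unfolding pos_op_def by (intro conjI ballI allI) auto
  moreover have "ip (?T f) (?T f) \<le> \<kappa> ^ 4 * ip f f" if f: "f \<in> H" for f
  proof (rule norm_bound_from_form[OF empirical_op_mem f])
    fix g assume g: "g \<in> H"
    define b where "b = (\<kappa> * sqrt (ip f f)) * (\<kappa> * sqrt (ip g g))"
    have b: "b \<ge> 0" using kappa_ge_1 ip_nonneg[OF f] ip_nonneg[OF g] by (simp add: b_def)
    have "\<bar>\<Sum>i\<in>I. f (fst (z i)) * g (fst (z i))\<bar> \<le> (\<Sum>i\<in>I. \<bar>f (fst (z i)) * g (fst (z i))\<bar>)"
      by (rule sum_abs)
    also have "\<dots> \<le> (\<Sum>i\<in>I. b)"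
      unfolding b_def abs_mult using H_abs_eval_le f g kappa_ge_1
      by (intro sum_mono mult_mono) (auto simp: ip_nonneg)
    also have "\<dots> = real (card I) * b" by simp
    finally have "\<bar>ip (?T f) g\<bar> \<le> 1 / real (card I) * (real (card I) * b)"
      using g by (simp add: ip_empirical_op abs_mult field_simps)
    also have "\<dots> \<le> b" using b by (cases "card I = 0") auto
    finally have "(ip (?T f) g)\<^sup>2 \<le> b\<^sup>2" by (rule power2_le_iff_abs_le[THEN iffD2, OF b])
    also have "\<dots> = \<kappa> ^ 4 * ip f f * ip g g"
      using ip_nonneg[OF f] ip_nonneg[OF g]
      by (simp add: b_def power_mult_distrib)
    finally show "(ip (?T f) g)\<^sup>2 \<le> \<kappa> ^ 4 * ip f f * ip g g" .
  qed
  ultimately show ?thesis by (simp add: pos_bdd_def)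
qed

text \<open>The resolvent is a pointwise limit of the iterates, which are measurable for trivial reasons.\<close>

lemma resolvent_measurable:
  assumes T: "\<And>z. pos_bdd c (T z)" and l: "l > 0" and mem: "\<And>z. F z \<in> H"
    and F: "(\<lambda>p. F (fst p) (snd p)) \<in> borel_measurable (N \<Otimes>\<^sub>M borel)"
    and T_measurable: "\<And>G. (\<And>z. G z \<in> H) \<Longrightarrow>
      (\<lambda>p. G (fst p) (snd p)) \<in> borel_measurable (N \<Otimes>\<^sub>M borel) \<Longrightarrow>
      (\<lambda>p. T (fst p) (G (fst p)) (snd p)) \<in> borel_measurable (N \<Otimes>\<^sub>M borel)"
  shows "(\<lambda>p. resolvent H (T (fst p)) l (F (fst p)) (snd p)) \<in> borel_measurable (N \<Otimes>\<^sub>M borel)"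
proof (rule borel_measurable_LIMSEQ_real)
  define u where "u n z = res_iter c (T z) l (F z) n" for n z
  have u_Suc: "u (Suc n) z = u n z - (l / (2 * l\<^sup>2 + 2 * c)) *\<^sub>R (l *\<^sub>R u n z + T z (u n z) - F z)" for n z
    by (simp add: u_def res_iter_def res_step_def)
  have u_mem: "u n z \<in> H" for n z
  proof (induction n)
    case (Suc n)
    then show ?case
      using mem pos_op_mem[OF pos_bdd_pos_op[OF T]] unfolding u_Suc by auto
  qed (simp add: u_def res_iter_def)
  show "(\<lambda>p. u n (fst p) (snd p)) \<in> borel_measurable (N \<Otimes>\<^sub>M borel)" for n
  proof (induction n)
    case (Suc n)
    then have [measurable]: "(\<lambda>p. T (fst p) (u n (fst p)) (snd p)) \<in> borel_measurable (N \<Otimes>\<^sub>M borel)"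
      "(\<lambda>p. u n (fst p) (snd p)) \<in> borel_measurable (N \<Otimes>\<^sub>M borel)"
      using T_measurable u_mem by auto
    note F[measurable]
    show ?case unfolding u_Suc fun_apply by simp
  qed (simp add: u_def res_iter_def fun_apply)
  show "(\<lambda>n. u n (fst p) (snd p)) \<longlonglongrightarrow> resolvent H (T (fst p)) l (F (fst p)) (snd p)" for p
    unfolding u_def by (rule hlim_eval[OF resolvent_limit(1)[OF T l mem]])
qed

end

section \<open>Traces and the Hilbert-Schmidt kernel\<close>

lemma has_sum_finite_sum:
  fixes f :: "'i \<Rightarrow> 'e \<Rightarrow> real"
  assumes "\<And>i. i \<in> I \<Longrightarrow> (f i has_sum s i) J"
  shows "((\<lambda>e. \<Sum>i\<in>I. f i e) has_sum (\<Sum>i\<in>I. s i)) J"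
  using assms by (induction I rule: infinite_finite_induct) (auto intro!: has_sum_add)

text \<open>The termwise condition makes a + 2tp + t^2 d nonnegative for every t, by completing the
  square. Summing gives a nonnegative quadratic polynomial in t.\<close>

lemma has_sum_Cauchy_Schwarz:
  fixes a p d :: "'e \<Rightarrow> real"
  assumes a: "(a has_sum A) J" and p: "(p has_sum P) J" and d: "(d has_sum D) J"
    and nonneg: "\<And>e. e \<in> J \<Longrightarrow> a e \<ge> 0" "\<And>e. e \<in> J \<Longrightarrow> d e \<ge> 0"
    and le: "\<And>e. e \<in> J \<Longrightarrow> (p e)\<^sup>2 \<le> a e * d e"
  shows "P\<^sup>2 \<le> A * D"
proof (rule nonneg_quadratic_imp_discriminant)
  show "D \<ge> 0" by (rule has_sum_nonneg[OF d nonneg(2)])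
  fix t
  have "((\<lambda>e. a e + 2 * t * p e + t\<^sup>2 * d e) has_sum (A + 2 * t * P + t\<^sup>2 * D)) J"
    by (intro has_sum_add has_sum_cmult_right a p d)
  moreover have "a e + 2 * t * p e + t\<^sup>2 * d e \<ge> 0" if e: "e \<in> J" for e
  proof (cases "d e = 0")
    case True
    then show ?thesis using le[OF e] nonneg[OF e] by simp
  next
    case False
    then have "d e > 0" using nonneg(2)[OF e] by simp
    moreover have "d e * (a e + 2 * t * p e + t\<^sup>2 * d e) = (t * d e + p e)\<^sup>2 + (a e * d e - (p e)\<^sup>2)"
      by (simp add: power2_eq_square algebra_simps)
    ultimately show ?thesis
      using le[OF e] zero_le_power2[of "t * d e + p e"] by (smt (verit) mult_pos_neg)
  qed
  ultimately show "0 \<le> A + 2 * t * P + t\<^sup>2 * D" by (rule has_sum_nonneg)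
qed

locale mercer_basis = mercer_rkhs K H ip mu + rkhs_basis K H ip B
  for K :: "'a::compact_metric_space \<Rightarrow> 'a \<Rightarrow> real" and H ip mu B
begin

text \<open>A basis function that vanishes on a countable dense set is zero by continuity, and by
  Bessel's inequality only countably many do not vanish at a given point.\<close>

lemma countable_B: "countable B"
proof -
  obtain X :: "'a set" where X: "countable X" "\<And>U. open U \<Longrightarrow> U \<noteq> {} \<Longrightarrow> \<exists>x\<in>X. x \<in> U"
    using countable_dense_exists by metis
  have c: "countable {e\<in>B. e x \<noteq> 0}" for x
  proof -
    have "(\<lambda>e. (ip (K x) e)\<^sup>2) summable_on B"
      using Bessel[OF H_kernel]
      by (intro nonneg_bdd_above_summable_on bdd_aboveI2[of _ _ "ip (K x) (K x)"]) auto
    then have "countable {e\<in>B. (ip (K x) e)\<^sup>2 \<noteq> 0}"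
      by (rule summable_countable_real)
    moreover have "{e\<in>B. (ip (K x) e)\<^sup>2 \<noteq> 0} = {e\<in>B. e x \<noteq> 0}" by (auto simp: reproducing')
    ultimately show ?thesis by simp
  qed
  have "B \<subseteq> (\<Union>x\<in>X. {e\<in>B. e x \<noteq> 0})"
  proof
    fix e assume e: "e \<in> B"
    then have "ip e e = 1" by (simp add: ip_B)
    then have "e \<noteq> 0" using ip_zero_left[of 0] by auto
    then obtain y where "e y \<noteq> 0" by (auto simp: fun_eq_iff fun_apply)
    moreover have "open (e -` (- {0}))"
      using H_continuous[of e] e by (intro open_vimage) auto
    ultimately obtain x where "x \<in> X" "e x \<noteq> 0" using X(2)[of "e -` (- {0})"] by auto
    then show "e \<in> (\<Union>x\<in>X. {e\<in>B. e x \<noteq> 0})" using e by blast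
  qed
  then show ?thesis by (rule countable_subset) (rule countable_UN[OF X(1) c])
qed

text \<open>A sequence of finite sets exhausting the countable basis. It turns unconditional sums
  into limits of sequences, as required for measurability and dominated convergence.\<close>

definition Bn :: "nat \<Rightarrow> ('a \<Rightarrow> real) set" where
  "Bn n = {e\<in>B. to_nat_on B e < n}"

lemma finite_Bn: "finite (Bn n)"
proof (rule finite_imageD)
  show "finite (to_nat_on B ` Bn n)" by (rule finite_subset[of _ "{..<n}"]) (auto simp: Bn_def)
  show "inj_on (to_nat_on B) (Bn n)"
    using inj_on_to_nat_on[OF countable_B] by (rule inj_on_subset) (auto simp: Bn_def)
qed

lemma Bn_subset: "Bn n \<subseteq> B"
  by (auto simp: Bn_def)

lemma filterlim_Bn: "filterlim Bn (finite_subsets_at_top B) sequentially"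
proof (rule filterlim_finite_subsets_at_top[THEN iffD2], intro allI impI)
  fix X assume X: "finite X \<and> X \<subseteq> B"
  obtain m where m: "\<forall>e\<in>X. to_nat_on B e < m"
    using X finite_nat_set_iff_bounded[of "to_nat_on B ` X"] by auto
  show "\<forall>\<^sub>F n in sequentially. finite (Bn n) \<and> X \<subseteq> Bn n \<and> Bn n \<subseteq> B"
    using eventually_ge_at_top[of m]
  proof (eventually_elim)
    case (elim n)
    then show ?case using m X finite_Bn Bn_subset by (fastforce simp: Bn_def)
  qed
qed

lemma has_sum_LIMSEQ: "(f has_sum (s :: real)) B \<Longrightarrow> (\<lambda>n. sum f (Bn n)) \<longlonglongrightarrow> s"
  unfolding has_sum_def by (rule filterlim_compose[OF _ filterlim_Bn])

text \<open>Parseval for \<open>A (K x)\<close> and \<open>K y\<close>. By symmetry of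
  \<open>A\<close> the coefficient of \<open>A (K x)\<close> at \<open>e\<close> is
  \<open>A e x\<close>.\<close>

lemma op_kernel_has_sum:
  assumes "pos_op A"
  shows "((\<lambda>e. A e x * e y) has_sum A (K x) y) B"
proof -
  have hs: "((\<lambda>e. ip (A (K x)) e * ip (K y) e) has_sum ip (A (K x)) (K y)) B"
    by (rule Parseval) (simp_all add: pos_op_mem[OF assms])
  have eq: "ip (A (K x)) e * ip (K y) e = A e x * e y" if "e \<in> B" for e
    using that pos_op_sym[OF assms] by (simp add: reproducing' pos_op_mem[OF assms])
  show ?thesis
    using has_sum_cong[OF eq, THEN iffD1, OF _ hs] by (simp add: reproducing pos_op_mem[OF assms])
qed

lemma op_kernel_measurable:
  assumes "pos_op A"
  shows "(\<lambda>p. A (K (fst p)) (snd p)) \<in> borel_measurable (borel \<Otimes>\<^sub>M borel)"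
proof (rule borel_measurable_LIMSEQ_real)
  show "(\<lambda>n. \<Sum>e\<in>Bn n. A e (fst p) * e (snd p)) \<longlonglongrightarrow> A (K (fst p)) (snd p)" for p
    by (rule has_sum_LIMSEQ[OF op_kernel_has_sum[OF assms]])
  have [measurable]: "A e \<in> borel_measurable borel" "e \<in> borel_measurable borel" if "e \<in> Bn n" for e n
    using that Bn_subset by (auto intro!: H_measurable pos_op_mem[OF assms])
  show "(\<lambda>p. \<Sum>e\<in>Bn n. A e (fst p) * e (snd p)) \<in> borel_measurable (borel \<Otimes>\<^sub>M borel)" for n
    by measurable
qed

lemma op_kernel_diag_measurable:
  assumes "pos_op A"
  shows "(\<lambda>x. A (K x) x) \<in> borel_measurable mu"
proof -
  have "(\<lambda>x. (x, x)) \<in> borel \<rightarrow>\<^sub>M borel \<Otimes>\<^sub>M borel" by measurable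
  from measurable_compose[OF this op_kernel_measurable[OF assms]]
  show ?thesis unfolding borel_measurable_mu by simp
qed

text \<open>Computes tr(A L) as the integral of the diagonal of the kernel of A. Each summand is the
  integral of A e times e, and the integrands sum pointwise to \<open>A (K x) x\<close>. Bessel
  bounds all finite partial sums by one constant, so sum and integral may be exchanged. The value
  does not involve the basis.\<close>

lemma trace_identity:
  assumes "pos_bdd c A"
  shows "((\<lambda>e. ip (A (L e)) e) has_sum (\<integral>x. A (K x) x \<partial>mu)) B"
    and "integrable mu (\<lambda>x. A (K x) x)"
proof -
  have A: "pos_op A" using assms pos_bdd_pos_op by blast
  define C where "C = c * \<kappa>\<^sup>2 + \<kappa>\<^sup>2"
  have bound: "(\<Sum>e\<in>F. \<bar>A e x * e x\<bar>) \<le> C" if F: "finite F" "F \<subseteq> B" for F x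
  proof -
    have mem: "A (K x) \<in> H" by (simp add: pos_op_mem[OF A])
    have "(\<Sum>e\<in>F. \<bar>A e x * e x\<bar>) \<le> (\<Sum>e\<in>F. (ip (A (K x)) e)\<^sup>2 + (ip (K x) e)\<^sup>2)"
    proof (rule sum_mono)
      fix e assume "e \<in> F"
      then have e: "e \<in> H" using F by auto
      have "A e x = ip (A (K x)) e" using e pos_op_sym[OF A H_kernel e] by (simp add: reproducing' pos_op_mem[OF A])
      moreover have "e x = ip (K x) e" using e by (simp add: reproducing')
      ultimately show "\<bar>A e x * e x\<bar> \<le> (ip (A (K x)) e)\<^sup>2 + (ip (K x) e)\<^sup>2"
        using abs_mult_le_sum_squares by simp
    qed
    also have "\<dots> \<le> ip (A (K x)) (A (K x)) + ip (K x) (K x)"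
      unfolding sum.distrib using Bessel[OF mem F] Bessel[OF H_kernel F] by (intro add_mono)
    also have "\<dots> \<le> c * ip (K x) (K x) + ip (K x) (K x)" using assms by (simp add: pos_bdd_def)
    also have "\<dots> \<le> C"
      unfolding C_def ip_kernel using K_diag_le assms
      by (intro add_mono mult_left_mono) (auto simp: pos_bdd_def)
    finally show ?thesis .
  qed
  have AL: "ip (A (L e)) e = (\<integral>x. A e x * e x \<partial>mu)" if "e \<in> B" for e
  proof -
    have e: "e \<in> H" "A e \<in> H" using that pos_op_mem[OF A] by auto
    have "ip (A (L e)) e = ip (L e) (A e)" using pos_op_sym[OF A L_mem[OF H_L2]] e by simp
    then show ?thesis using e ip_L[OF H_L2] by (simp add: mult.commute)
  qed
  have int: "integrable mu (\<lambda>x. A e x * e x)" if "e \<in> B" for e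
    using that pos_op_mem[OF A] H_L2 by (intro L2_times_H) auto
  have diag: "(\<lambda>x. A (K x) x) \<in> borel_measurable mu" by (rule op_kernel_diag_measurable[OF A])
  have conv: "AE x in mu. (\<lambda>n. \<Sum>e\<in>Bn n. A e x * e x) \<longlonglongrightarrow> A (K x) x"
    using has_sum_LIMSEQ[OF op_kernel_has_sum[OF A]] by simp
  have meas: "(\<lambda>x. \<Sum>e\<in>Bn n. A e x * e x) \<in> borel_measurable mu" for n
    using int Bn_subset by (intro borel_measurable_sum borel_measurable_integrable) auto
  have dom: "AE x in mu. norm (\<Sum>e\<in>Bn n. A e x * e x) \<le> C" for n
    using order_trans[OF sum_abs bound[OF finite_Bn Bn_subset]] by simp
  have const: "integrable mu (\<lambda>_. C)" by simp
  note lim = integral_dominated_convergence[OF diag meas const conv dom]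
  show "integrable mu (\<lambda>x. A (K x) x)"
    by (rule integrable_dominated_convergence[OF diag meas const conv dom])
  \<comment> \<open>The same bound, integrated, shows absolute summability. Only then may the
    unconditional sum be computed along the particular sequence \<open>Bn\<close>.\<close>
  have "(\<Sum>e\<in>F. \<bar>ip (A (L e)) e\<bar>) \<le> C" if F: "finite F" "F \<subseteq> B" for F
  proof -
    have "(\<Sum>e\<in>F. \<bar>ip (A (L e)) e\<bar>) \<le> (\<Sum>e\<in>F. \<integral>x. \<bar>A e x * e x\<bar> \<partial>mu)"
    proof (rule sum_mono)
      fix e assume "e \<in> F"
      then have "ip (A (L e)) e = (\<integral>x. A e x * e x \<partial>mu)" using F AL by blast
      then show "\<bar>ip (A (L e)) e\<bar> \<le> (\<integral>x. \<bar>A e x * e x\<bar> \<partial>mu)"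
        using integral_abs_bound[of mu "\<lambda>x. A e x * e x"] by simp
    qed
    also have "\<dots> = (\<integral>x. (\<Sum>e\<in>F. \<bar>A e x * e x\<bar>) \<partial>mu)"
      using F int by (intro Bochner_Integration.integral_sum[symmetric]) auto
    also have "\<dots> \<le> C"
      using F int bound[OF F]
      by (intro mu.integral_le_const Bochner_Integration.integrable_sum integrable_abs) auto
    finally show ?thesis .
  qed
  then have "(\<lambda>e. norm (ip (A (L e)) e)) summable_on B"
    by (intro nonneg_bdd_above_summable_on bdd_aboveI2[of _ _ C]) auto
  then have hs: "((\<lambda>e. ip (A (L e)) e) has_sum (infsum (\<lambda>e. ip (A (L e)) e) B)) B"
    using abs_summable_summable summable_iff_has_sum_infsum by blast
  have "(\<Sum>e\<in>Bn n. ip (A (L e)) e) = (\<integral>x. (\<Sum>e\<in>Bn n. A e x * e x) \<partial>mu)" for n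
    using AL int Bn_subset[of n] by (subst Bochner_Integration.integral_sum) (auto intro!: sum.cong)
  then have "infsum (\<lambda>e. ip (A (L e)) e) B = (\<integral>x. A (K x) x \<partial>mu)"
    using LIMSEQ_unique[OF has_sum_LIMSEQ[OF hs]] lim by simp
  then show "((\<lambda>e. ip (A (L e)) e) has_sum (\<integral>x. A (K x) x \<partial>mu)) B" using hs by simp
qed

end

section \<open>The effective dimension as an integral, and the kernel of the perturbation\<close>

context mercer_rkhs
begin

abbreviation "R l \<equiv> resolvent H L l"

lemma R_pos_bdd: "l > 0 \<Longrightarrow> pos_bdd (1 / l\<^sup>2) (R l)"
  by (rule resolvent_pos_bdd[OF L_pos_bdd])

lemma R_pos_op: "l > 0 \<Longrightarrow> pos_op (R l)"
  using R_pos_bdd pos_bdd_pos_op by blast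

lemma L_pos_op: "pos_op L"
  using L_pos_bdd pos_bdd_pos_op by blast

lemma ex_basis: "\<exists>B. mercer_basis K H ip mu B"
proof -
  obtain B where "orthonormal_basis H ip B" using orthonormal_basis_exists by blast
  then have "mercer_basis K H ip mu B" by unfold_locales
  then show ?thesis by blast
qed

lemma effective_dim_eq:
  assumes "l > 0"
  shows "effective_dim mu K H ip l = (\<integral>x. R l (K x) x \<partial>mu)"
proof -
  define B where "B = (SOME B. orthonormal_basis H ip B)"
  have "orthonormal_basis H ip B" unfolding B_def using orthonormal_basis_exists by (rule someI_ex)
  then interpret mercer_basis K H ip mu B by unfold_locales
  have "effective_dim mu K H ip l = (\<Sum>\<^sub>\<infinity>e\<in>B. ip (R l (L e)) e)"
    unfolding effective_dim_def op_trace_def B_def ..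
  also have "\<dots> = (\<integral>x. R l (K x) x \<partial>mu)"
    by (rule infsumI[OF trace_identity(1)[OF R_pos_bdd[OF assms]]])
  finally show ?thesis .
qed

lemma R_kernel_diag: "l > 0 \<Longrightarrow> R l (K x) x = ip (R l (K x)) (K x)"
  by (simp add: reproducing pos_op_mem[OF R_pos_op])

lemma R_kernel_integrable: "l > 0 \<Longrightarrow> integrable mu (\<lambda>x. R l (K x) x)"
  using ex_basis mercer_basis.trace_identity(2) R_pos_bdd by blast

text \<open>This is L (L + l)^-1; in this form symmetry and positivity are inherited from the
  resolvent.\<close>

definition P :: "real \<Rightarrow> ('a \<Rightarrow> real) \<Rightarrow> 'a \<Rightarrow> real" where
  "P l f = f - l *\<^sub>R R l f"

lemma P_eq: "l > 0 \<Longrightarrow> f \<in> H \<Longrightarrow> P l f = L (R l f)"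
  using resolvent_limit(2)[OF L_pos_bdd, of l f] by (simp add: P_def algebra_simps)

lemma P_pos_bdd:
  assumes l: "l > 0"
  shows "pos_bdd 4 (P l)"
proof -
  note Rm = pos_op_linear[OF R_pos_op[OF l]]
  have "P l (f + g) = P l f + P l g" if "f \<in> H" "g \<in> H" for f g
    using that by (simp add: P_def Rm algebra_simps)
  moreover have "P l (c *\<^sub>R f) = c *\<^sub>R P l f" if "f \<in> H" for c f
    using that by (simp add: P_def Rm algebra_simps)
  moreover have "P l f \<in> H" if "f \<in> H" for f using that by (simp add: P_def Rm)
  moreover have "ip (P l f) g = ip f (P l g)" if "f \<in> H" "g \<in> H" for f g
    using that pos_op_sym[OF R_pos_op[OF l], of f g] by (simp add: P_def ip_linear Rm)
  moreover have "ip (P l f) f \<ge> 0" if "f \<in> H" for f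
    using that resolvent_form_le[OF L_pos_bdd l that] by (simp add: P_def ip_linear Rm)
  ultimately have "pos_op (P l)" unfolding pos_op_def by (intro conjI ballI allI) auto
  moreover have "ip (P l f) (P l f) \<le> 4 * ip f f" if f: "f \<in> H" for f
  proof -
    have "P l f = f + (- l) *\<^sub>R R l f" by (simp add: P_def)
    then have "ip (P l f) (P l f) \<le> 2 * ip f f + 2 * ip ((- l) *\<^sub>R R l f) ((- l) *\<^sub>R R l f)"
      using ip_add_self_le[of f "(- l) *\<^sub>R R l f"] f Rm by simp
    also have "ip ((- l) *\<^sub>R R l f) ((- l) *\<^sub>R R l f) = l\<^sup>2 * ip (R l f) (R l f)"
      using f by (simp only: ip_linear Rm H_scale) (simp add: power2_eq_square)
    finally show ?thesis using resolvent_norm_le[OF L_pos_bdd l f] by simp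
  qed
  ultimately show ?thesis by (simp add: pos_bdd_def)
qed

definition tau :: "real \<Rightarrow> real" where
  "tau l = (\<integral>x. P l (K x) x \<partial>mu)"

text \<open>\<open>kk l x y\<close> is the Hilbert-Schmidt inner product of \<open>(L + l)\<^sup>-\<^sup>1\<^sup>/\<^sup>2 (K\<^sub>x \<otimes> K\<^sub>x - L)\<close> and
  \<open>(L + l)\<^sup>-\<^sup>1\<^sup>/\<^sup>2 (K\<^sub>y \<otimes> K\<^sub>y - L)\<close>, and \<open>tau l\<close> is the squared norm of \<open>(L + l)\<^sup>-\<^sup>1\<^sup>/\<^sup>2 L\<close>.\<close>

definition kk :: "real \<Rightarrow> 'a \<Rightarrow> 'a \<Rightarrow> real" where
  "kk l x y = K x y * R l (K x) y - P l (K x) x - P l (K y) y + tau l"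

text \<open>For x drawn from mu this is a centered random vector; its sample average is the
  empirical operator minus L, applied to e.\<close>

definition zeta :: "('a \<Rightarrow> real) \<Rightarrow> 'a \<Rightarrow> 'a \<Rightarrow> real" where
  "zeta e x = e x *\<^sub>R K x - L e"

text \<open>The squared Hilbert-Schmidt norm of (L + l)^(-1/2) times the perturbation, not yet
  divided by l. As a double sum it is a function of the inputs to which moment bounds apply.\<close>

definition Q2 :: "real \<Rightarrow> nat set \<Rightarrow> (nat \<Rightarrow> 'a \<times> real) \<Rightarrow> real" where
  "Q2 l I z = (\<Sum>i\<in>I. \<Sum>j\<in>I. kk l (fst (z i)) (fst (z j))) / (real (card I))\<^sup>2"

lemma zeta_mem: "e \<in> H \<Longrightarrow> zeta e x \<in> H"
  by (simp add: zeta_def H_L2 L_mem)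

end

context mercer_basis
begin

text \<open>Expanding both factors gives four series over the basis: the product of kernels and the
  two mixed terms are summed by Parseval, the pure L term by \<open>trace_identity\<close> for
  \<open>P l\<close>.\<close>

lemma kk_has_sum:
  assumes l: "l > 0"
  shows "((\<lambda>e. ip (R l (zeta e x)) (zeta e y)) has_sum kk l x y) B"
proof -
  note R = R_pos_op[OF l] and Rm = pos_op_linear[OF R_pos_op[OF l]]
  have P: "pos_op (P l)" using P_pos_bdd[OF l] pos_bdd_pos_op by blast
  have t1: "((\<lambda>e. R l (K x) y * (ip (K x) e * ip (K y) e)) has_sum (R l (K x) y * ip (K x) (K y))) B"
    by (intro has_sum_cmult_right Parseval) auto
  have t2: "((\<lambda>e. - 1 * (ip (P l (K u)) e * ip (K u) e)) has_sum (- 1 * ip (P l (K u)) (K u))) B" for u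
    by (intro has_sum_cmult_right Parseval) (auto simp: pos_op_mem[OF P])
  have hs: "((\<lambda>e. R l (K x) y * (ip (K x) e * ip (K y) e) + - 1 * (ip (P l (K x)) e * ip (K x) e)
      + - 1 * (ip (P l (K y)) e * ip (K y) e) + ip (P l (L e)) e) has_sum
      (R l (K x) y * ip (K x) (K y) + - 1 * ip (P l (K x)) (K x) + - 1 * ip (P l (K y)) (K y) + tau l)) B"
    unfolding tau_def by (intro has_sum_add t1 t2 trace_identity(1)[OF P_pos_bdd[OF l]])
  have val: "R l (K x) y * ip (K x) (K y) + - 1 * ip (P l (K x)) (K x) + - 1 * ip (P l (K y)) (K y) + tau l
      = kk l x y"
    by (simp add: kk_def ip_kernel reproducing pos_op_mem[OF P])
  have eq: "ip (R l (zeta e x)) (zeta e y) =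
      R l (K x) y * (ip (K x) e * ip (K y) e) + - 1 * (ip (P l (K x)) e * ip (K x) e)
      + - 1 * (ip (P l (K y)) e * ip (K y) e) + ip (P l (L e)) e" if "e \<in> B" for e
  proof -
    have e: "e \<in> H" "L e \<in> H" using that by (auto simp: H_L2 L_mem)
    have RK: "R l (K u) \<in> H" for u by (simp add: Rm)
    have "ip (R l (K u)) (L e) = ip (P l (K u)) e" for u
      using pos_op_sym[OF L_pos_op RK e(1), of u] P_eq[OF l H_kernel, of u] by simp
    moreover have "ip (R l (L e)) (K u) = ip (P l (K u)) e" for u
      using pos_op_sym[OF R e(2) H_kernel, of u] pos_op_sym[OF L_pos_op e(1) RK, of u] P_eq[OF l H_kernel, of u]
        ip_commute[of e "L (R l (K u))"] e RK pos_op_mem[OF L_pos_op] by simp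
    moreover have "ip (R l (L e)) (L e) = ip (P l (L e)) e"
      using pos_op_sym[OF L_pos_op pos_op_mem[OF R e(2)] e(1)] P_eq[OF l e(2)] by simp
    ultimately show ?thesis
      using e RK
      by (simp add: zeta_def Rm ip_linear reproducing reproducing' fun_apply algebra_simps)
  qed
  show ?thesis using has_sum_cong[OF eq, THEN iffD2, OF _ hs] unfolding val .
qed

lemma empirical_diff:
  assumes "finite I" "I \<noteq> {}" "e \<in> H"
  shows "empirical_op K I z e - L e = (1 / real (card I)) *\<^sub>R (\<Sum>i\<in>I. zeta e (fst (z i)))"
proof -
  have "card I > 0" using assms by (simp add: card_gt_0_iff)
  then have "(1 / real (card I)) *\<^sub>R (\<Sum>i\<in>I. L e) = L e"
    by (simp add: sum_constant_scaleR del: sum_constant)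
  then show ?thesis
    unfolding empirical_op_eq zeta_def by (simp add: sum_subtractf scaleR_diff_right)
qed

lemma sum_kk_has_sum:
  assumes l: "l > 0"
  shows "((\<lambda>e. ip (R l (\<Sum>i\<in>I. zeta e (w i))) (\<Sum>j\<in>J. zeta e (v j))) has_sum
    (\<Sum>i\<in>I. \<Sum>j\<in>J. kk l (w i) (v j))) B"
proof -
  have "((\<lambda>e. \<Sum>i\<in>I. \<Sum>j\<in>J. ip (R l (zeta e (w i))) (zeta e (v j))) has_sum
    (\<Sum>i\<in>I. \<Sum>j\<in>J. kk l (w i) (v j))) B"
    by (intro has_sum_finite_sum kk_has_sum l)
  moreover have "(\<Sum>i\<in>I. \<Sum>j\<in>J. ip (R l (zeta e (w i))) (zeta e (v j))) =
      ip (R l (\<Sum>i\<in>I. zeta e (w i))) (\<Sum>j\<in>J. zeta e (v j))" if "e \<in> B" for e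
    using that by (simp add: pos_op_sum[OF R_pos_op[OF l]] pos_op_mem[OF R_pos_op[OF l]] zeta_mem ip_sum_left ip_sum_right)
      (rule sum.swap)
  ultimately show ?thesis by (simp cong: has_sum_cong)
qed

lemma Q2_has_sum:
  assumes l: "l > 0" and I: "finite I" "I \<noteq> {}"
  shows "((\<lambda>e. ip (R l (empirical_op K I z e - L e)) (empirical_op K I z e - L e)) has_sum Q2 l I z) B"
proof -
  let ?c = "1 / (real (card I))\<^sup>2"
  have hs: "((\<lambda>e. ?c * ip (R l (\<Sum>i\<in>I. zeta e (fst (z i)))) (\<Sum>j\<in>I. zeta e (fst (z j)))) has_sum
      (?c * (\<Sum>i\<in>I. \<Sum>j\<in>I. kk l (fst (z i)) (fst (z j))))) B"
    by (intro has_sum_cmult_right sum_kk_has_sum l)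
  have eq: "ip (R l (empirical_op K I z e - L e)) (empirical_op K I z e - L e) =
      ?c * ip (R l (\<Sum>i\<in>I. zeta e (fst (z i)))) (\<Sum>j\<in>I. zeta e (fst (z j)))" if "e \<in> B" for e
  proof -
    have "e \<in> H" using that by auto
    then have "(\<Sum>i\<in>I. zeta e (fst (z i))) \<in> H" by (auto simp: zeta_mem)
    then show ?thesis
      unfolding empirical_diff[OF I \<open>e \<in> H\<close>]
      by (simp add: pos_op_linear[OF R_pos_op[OF l]] ip_linear power2_eq_square)
  qed
  show ?thesis using has_sum_cong[OF eq, THEN iffD2, OF _ hs] by (simp add: Q2_def)
qed

end

section \<open>Perturbation bound and properties of \<open>kk\<close>\<close>

context mercer_rkhs
begin

lemma kk_Cauchy_Schwarz:
  assumes l: "l > 0"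
  shows "(\<Sum>i\<in>I. kk l (w i) y)\<^sup>2 \<le> (\<Sum>i\<in>I. \<Sum>j\<in>I. kk l (w i) (w j)) * kk l y y"
proof -
  obtain B where "mercer_basis K H ip mu B" using ex_basis by blast
  then interpret mercer_basis K H ip mu B .
  note R = R_pos_op[OF l]
  have mem: "(\<Sum>i\<in>I. zeta e (w i)) \<in> H" "zeta e y \<in> H" if "e \<in> B" for e
    using that by (auto simp: zeta_mem)
  show ?thesis
  proof (rule has_sum_Cauchy_Schwarz[OF sum_kk_has_sum[OF l, where I = I and J = I and w = w and v = w] _ kk_has_sum[OF l, of y y]])
    show "((\<lambda>e. ip (R l (\<Sum>i\<in>I. zeta e (w i))) (zeta e y)) has_sum (\<Sum>i\<in>I. kk l (w i) y)) B"
      using sum_kk_has_sum[OF l, where I = I and J = "{y}" and w = w and v = "\<lambda>x. x"] by simp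
  qed (use mem in \<open>auto intro: pos_op_nonneg[OF R] pos_op_Cauchy_Schwarz[OF R]\<close>)
qed

lemma kk_sum_nonneg:
  assumes l: "l > 0"
  shows "(\<Sum>i\<in>I. \<Sum>j\<in>I. kk l (w i) (w j)) \<ge> 0"
proof -
  obtain B where "mercer_basis K H ip mu B" using ex_basis by blast
  then interpret mercer_basis K H ip mu B .
  show ?thesis
    by (rule has_sum_nonneg[OF sum_kk_has_sum[OF l]])
      (intro pos_op_nonneg[OF R_pos_op[OF l]] H_sum zeta_mem B_mem)
qed

lemma Q2_nonneg: "l > 0 \<Longrightarrow> Q2 l I z \<ge> 0"
  unfolding Q2_def using kk_sum_nonneg[where w = "\<lambda>i. fst (z i)" and I = I and l = l] by simp

lemma kk_sym: "l > 0 \<Longrightarrow> kk l x y = kk l y x"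
  using pos_op_sym[OF R_pos_op, of l "K x" "K y"] K_sym[of x y]
  by (simp add: kk_def reproducing reproducing' pos_op_mem[OF R_pos_op])

text \<open>The Hilbert-Schmidt norm dominates the operator norm. With D the perturbation and S = l
  + L, the coefficient (D f, e) equals (S f, R D e). Cauchy-Schwarz for S bounds its square by (S f,
  f) (R D e, D e), and summation over the basis gives \<open>Q2\<close>.\<close>

lemma empirical_diff_bound:
  assumes l: "l > 0" and I: "finite I" "I \<noteq> {}" and f: "f \<in> H"
  shows "ip (L f - empirical_op K I z f) (L f - empirical_op K I z f) \<le> Q2 l I z * (l * ip f f + ip (L f) f)"
proof -
  obtain B where "mercer_basis K H ip mu B" using ex_basis by blast
  then interpret mercer_basis K H ip mu B .
  let ?T = "empirical_op K I z"
  define D where "D g = ?T g - L g" for g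
  note R = R_pos_op[OF l]
  have T: "pos_op ?T" using empirical_op_pos_bdd pos_bdd_pos_op by blast
  have S: "pos_op (\<lambda>f. l *\<^sub>R f + L f)" using pos_op_shift[OF L_pos_op] l by simp
  have Dm: "D g \<in> H" if "g \<in> H" for g using that by (simp add: D_def pos_op_mem[OF T] pos_op_mem[OF L_pos_op])
  have Dsym: "ip (D g) h = ip g (D h)" if "g \<in> H" "h \<in> H" for g h
    using that pos_op_sym[OF T that] pos_op_sym[OF L_pos_op that]
    by (simp add: D_def ip_linear pos_op_mem[OF T] pos_op_mem[OF L_pos_op])
  define E where "E = l * ip f f + ip (L f) f"
  have E: "ip (l *\<^sub>R f + L f) f = E" using f by (simp add: E_def ip_linear pos_op_mem[OF L_pos_op])
  have "ip (D f) (D f) \<le> E * Q2 l I z"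
  proof (rule has_sum_mono[OF Parseval[OF Dm[OF f] Dm[OF f]]])
    show "((\<lambda>e. E * ip (R l (D e)) (D e)) has_sum E * Q2 l I z) B"
      unfolding D_def by (intro has_sum_cmult_right Q2_has_sum l I)
    fix e assume "e \<in> B"
    then have e: "e \<in> H" by auto
    have RD: "R l (D e) \<in> H" using Dm[OF e] pos_op_mem[OF R] by auto
    have eq: "l *\<^sub>R R l (D e) + L (R l (D e)) = D e"
      using resolvent_limit(2)[OF L_pos_bdd l Dm[OF e]] .
    have "(ip (D f) e)\<^sup>2 = (ip (l *\<^sub>R f + L f) (R l (D e)))\<^sup>2"
      using Dsym[OF f e] pos_op_sym[OF S f RD] eq by simp
    also have "\<dots> \<le> ip (l *\<^sub>R f + L f) f * ip (l *\<^sub>R R l (D e) + L (R l (D e))) (R l (D e))"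
      by (rule pos_op_Cauchy_Schwarz[OF S f RD])
    also have "\<dots> = E * ip (R l (D e)) (D e)"
      unfolding E eq using ip_commute[OF Dm[OF e] RD] by simp
    finally show "ip (D f) e * ip (D f) e \<le> E * ip (R l (D e)) (D e)"
      by (simp add: power2_eq_square)
  qed
  moreover have "L f - ?T f = - D f" by (simp add: D_def)
  ultimately show ?thesis
    using Dm[OF f] by (simp add: E_def mult.commute ip_linear del: minus_diff_eq)
qed

lemma two_resolvents_empirical:
  assumes "l > 0" "finite I" "I \<noteq> {}"
  shows "two_resolvents K H ip L (empirical_op K I z) (\<kappa> ^ 4) (\<kappa> ^ 4) l (Q2 l I z)"
  by unfold_locales
    (use assms L_pos_bdd empirical_op_pos_bdd Q2_nonneg empirical_diff_bound in auto)

lemma R_kernel_diag_bounds: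
  assumes l: "l > 0"
  shows "0 \<le> R l (K x) x" "l * R l (K x) x \<le> \<kappa>\<^sup>2" "0 \<le> P l (K x) x" "P l (K x) x \<le> \<kappa>\<^sup>2"
proof -
  have P: "pos_op (P l)" using P_pos_bdd[OF l] pos_bdd_pos_op by blast
  show 1: "0 \<le> R l (K x) x" using pos_op_nonneg[OF R_pos_op[OF l] H_kernel] R_kernel_diag[OF l] by simp
  show "l * R l (K x) x \<le> \<kappa>\<^sup>2"
    using resolvent_form_le[OF L_pos_bdd l H_kernel, of x] K_diag_le[of x] R_kernel_diag[OF l, of x]
    by (simp add: ip_kernel)
  show "0 \<le> P l (K x) x"
    using pos_op_nonneg[OF P H_kernel[of x]] by (simp add: reproducing pos_op_mem[OF P])
  have "P l (K x) x = K x x - l * R l (K x) x" by (simp add: P_def fun_apply)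
  then show "P l (K x) x \<le> \<kappa>\<^sup>2" 
    using mult_nonneg_nonneg[of l "R l (K x) x"] 1 l K_diag_le[of x] by linarith
qed

lemma P_kernel_integrable: "l > 0 \<Longrightarrow> integrable mu (\<lambda>x. P l (K x) x)"
  using ex_basis mercer_basis.trace_identity(2) P_pos_bdd by blast

lemma tau_bounds:
  assumes l: "l > 0"
  shows "0 \<le> tau l" "tau l \<le> \<kappa>\<^sup>2"
  unfolding tau_def
  using R_kernel_diag_bounds[OF l] P_kernel_integrable[OF l]
  by (auto intro!: integral_nonneg_AE mu.integral_le_const)

lemma kk_diag_le:
  assumes l: "0 < l" "l \<le> 1"
  shows "kk l x x \<le> 2 * \<kappa> ^ 4 / l"
proof -
  have \<kappa>: "\<kappa>\<^sup>2 \<ge> 1" using kappa_ge_1 by simp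
  have "R l (K x) x \<le> \<kappa>\<^sup>2 / l"
    using R_kernel_diag_bounds(2)[OF l(1), of x] l by (simp add: field_simps)
  then have "K x x * R l (K x) x \<le> \<kappa>\<^sup>2 * (\<kappa>\<^sup>2 / l)"
    using K_diag_le K_diag_nonneg R_kernel_diag_bounds(1)[OF l(1)] by (intro mult_mono) auto
  \<comment> \<open>Here l <= 1 and kappa >= 1 let the bound on \<open>tau\<close> be absorbed into
    kappa^4 / l.\<close>
  moreover have "\<kappa>\<^sup>2 \<le> \<kappa>\<^sup>2 * (\<kappa>\<^sup>2 / l)"
  proof -
    have "1 \<le> \<kappa>\<^sup>2 / l" using l \<kappa> by (simp add: field_simps)
    then show ?thesis using mult_left_mono[of 1 "\<kappa>\<^sup>2 / l" "\<kappa>\<^sup>2"] by simp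
  qed
  moreover have "kk l x x \<le> K x x * R l (K x) x + tau l"
    unfolding kk_def using R_kernel_diag_bounds(3)[OF l(1), of x] by simp
  moreover have "\<kappa>\<^sup>2 * (\<kappa>\<^sup>2 / l) = \<kappa> ^ 4 / l" by (simp add: power4_eq_xxxx power2_eq_square)
  ultimately show ?thesis using tau_bounds(2)[OF l(1)] by simp
qed

lemma kk_measurable:
  assumes l: "l > 0"
  shows "(\<lambda>p. kk l (fst p) (snd p)) \<in> borel_measurable (borel \<Otimes>\<^sub>M borel)"
proof -
  obtain B where "mercer_basis K H ip mu B" using ex_basis by blast
  then interpret mercer_basis K H ip mu B .
  have P: "pos_op (P l)" using P_pos_bdd[OF l] pos_bdd_pos_op by blast
  note [measurable] = op_kernel_measurable[OF R_pos_op[OF l]]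
    op_kernel_diag_measurable[OF P, unfolded borel_measurable_mu]
  show ?thesis unfolding kk_def by measurable
qed

text \<open>Integrating K x y R(K x) y over y gives the value at x of L R K_x, which is
  \<open>P l (K x) x\<close>; the other diagonal term integrates to \<open>tau l\<close>. Everything
  cancels.\<close>

lemma kk_integral:
  assumes l: "l > 0"
  shows "(\<integral>y. kk l x y \<partial>mu) = 0"
proof -
  have RK: "R l (K x) \<in> H" by (simp add: pos_op_mem[OF R_pos_op[OF l]])
  have int: "integrable mu (\<lambda>y. K x y * R l (K x) y)"
    using L2_times_H[OF H_L2[OF H_kernel] RK] .
  have "(\<integral>y. K x y * R l (K x) y \<partial>mu) = ip (L (R l (K x))) (K x)"
    using ip_L[OF H_L2[OF RK] H_kernel, of x] by (simp add: mult.commute)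
  also have "\<dots> = P l (K x) x"
    using P_eq[OF l H_kernel, of x] RK by (simp add: reproducing pos_op_mem[OF L_pos_op])
  finally have "(\<integral>y. K x y * R l (K x) y \<partial>mu) = P l (K x) x" .
  then show ?thesis
    unfolding kk_def using int P_kernel_integrable[OF l]
    by (simp add: tau_def mu.prob_space)
qed

text \<open>On the diagonal the integrated correction terms amount to -\<open>tau l\<close> <= 0 and
  are dropped. K x x is bounded by kappa^2, and the diagonal of the resolvent kernel integrates to
  the effective dimension.\<close>

lemma kk_diag_integral_le:
  assumes l: "l > 0"
  shows "(\<integral>x. kk l x x \<partial>mu) \<le> \<kappa>\<^sup>2 * effective_dim mu K H ip l"
proof -
  obtain B where "mercer_basis K H ip mu B" using ex_basis by blast
  then interpret mercer_basis K H ip mu B .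
  have diag: "(\<lambda>x. K x x) \<in> borel_measurable mu"
    unfolding borel_measurable_mu by (intro borel_measurable_continuous_onI continuous_intros)
  have le: "K x x * R l (K x) x \<le> \<kappa>\<^sup>2 * R l (K x) x" for x
    using K_diag_le R_kernel_diag_bounds(1)[OF l] by (intro mult_right_mono) auto
  have int: "integrable mu (\<lambda>x. K x x * R l (K x) x)"
  proof (rule Bochner_Integration.integrable_bound)
    show "integrable mu (\<lambda>x. \<kappa>\<^sup>2 * R l (K x) x)" using R_kernel_integrable[OF l] by simp
    show "AE x in mu. norm (K x x * R l (K x) x) \<le> norm (\<kappa>\<^sup>2 * R l (K x) x)"
      using le K_diag_nonneg R_kernel_diag_bounds(1)[OF l] by (simp add: abs_mult)
    show "(\<lambda>x. K x x * R l (K x) x) \<in> borel_measurable mu"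
      using diag op_kernel_diag_measurable[OF R_pos_op[OF l]] by measurable
  qed
  have "(\<integral>x. kk l x x \<partial>mu) = (\<integral>x. K x x * R l (K x) x \<partial>mu) - tau l"
    unfolding kk_def using int P_kernel_integrable[OF l] by (simp add: tau_def mu.prob_space)
  also have "\<dots> \<le> (\<integral>x. \<kappa>\<^sup>2 * R l (K x) x \<partial>mu)"
    using tau_bounds(1)[OF l] integral_mono[OF int _ le] R_kernel_integrable[OF l] by fastforce
  also have "\<dots> = \<kappa>\<^sup>2 * effective_dim mu K H ip l" using effective_dim_eq[OF l] by simp
  finally show ?thesis .
qed

end

section \<open>Moments of a sum of independent centered vectors\<close>

text \<open>Replaces one observation by an independent copy. Both sides reduce to the same integral
  over the remaining coordinates, since the inner integral no longer depends on coordinate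
  i.\<close>

lemma resample_integral:
  fixes rho :: "'x measure" and f :: "('i \<Rightarrow> 'x) \<Rightarrow> real"
  assumes rho: "prob_space rho" and J: "finite J" "i \<in> J"
    and f: "f \<in> borel_measurable (PiM J (\<lambda>_. rho))"
    and bound: "\<And>z. z \<in> space (PiM J (\<lambda>_. rho)) \<Longrightarrow> \<bar>f z\<bar> \<le> b"
  shows "(\<integral>z. f z \<partial>PiM J (\<lambda>_. rho)) = (\<integral>z. (\<integral>w. f (z(i := w)) \<partial>rho) \<partial>PiM J (\<lambda>_. rho))"
proof -
  interpret rho: prob_space rho by (rule rho)
  interpret product_prob_space "\<lambda>_. rho" UNIV by unfold_locales
  interpret PJ: prob_space "PiM J (\<lambda>_. rho)" by (intro prob_space_PiM rho)
  define F where "F z = (\<integral>w. f (z(i := w)) \<partial>rho)" for z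
  have J_eq: "insert i J = J" "insert i (J - {i}) = J" using J by auto
  have upd: "z(i := w) \<in> space (PiM J (\<lambda>_. rho))" if "z \<in> space (PiM J (\<lambda>_. rho))" "w \<in> space rho" for z w
    using that J by (auto simp: space_PiM PiE_iff extensional_def)
  have "(\<lambda>(z, w). z(i := w)) \<in> PiM J (\<lambda>_. rho) \<Otimes>\<^sub>M rho \<rightarrow>\<^sub>M PiM (insert i J) (\<lambda>_. rho)"
    by (rule measurable_add_dim)
  then have "(\<lambda>(z, w). z(i := w)) \<in> PiM J (\<lambda>_. rho) \<Otimes>\<^sub>M rho \<rightarrow>\<^sub>M PiM J (\<lambda>_. rho)" by (simp only: J_eq)
  from measurable_compose[OF this f]
  have pair_meas: "(\<lambda>(z, w). f (z(i := w))) \<in> borel_measurable (PiM J (\<lambda>_. rho) \<Otimes>\<^sub>M rho)"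
    by (simp add: case_prod_beta)
  from pair_meas have F_meas: "F \<in> borel_measurable (PiM J (\<lambda>_. rho))"
    unfolding F_def by (rule rho.borel_measurable_lebesgue_integral)
  have F_bound: "\<bar>F z\<bar> \<le> b" if z: "z \<in> space (PiM J (\<lambda>_. rho))" for z
  proof -
    have meas: "(\<lambda>w. f (z(i := w))) \<in> borel_measurable rho"
      using measurable_Pair2[OF pair_meas z] by simp
    have AE: "AE w in rho. \<bar>f (z(i := w))\<bar> \<le> b"
      by (rule AE_I2) (rule bound[OF upd[OF z]])
    have "integrable rho (\<lambda>w. f (z(i := w)))"
      by (rule rho.integrable_const_bound[OF _ meas]) (use AE in simp)
    then have "(\<integral>w. \<bar>f (z(i := w))\<bar> \<partial>rho) \<le> b"
      by (intro rho.integral_le_const integrable_abs AE)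
    then show ?thesis unfolding F_def by (rule order_trans[OF integral_abs_bound])
  qed
  have int_f: "integrable (PiM J (\<lambda>_. rho)) f"
    by (rule PJ.integrable_const_bound[of _ b, OF _ f]) (simp add: AE_I2 bound)
  have int_F: "integrable (PiM J (\<lambda>_. rho)) F"
    by (rule PJ.integrable_const_bound[of _ b, OF _ F_meas]) (simp add: AE_I2 F_bound)
  have ins: "(\<integral>z. g z \<partial>PiM J (\<lambda>_. rho)) = (\<integral>z. (\<integral>w. g (z(i := w)) \<partial>rho) \<partial>PiM (J - {i}) (\<lambda>_. rho))"
    if "integrable (PiM J (\<lambda>_. rho)) g" for g :: "('i \<Rightarrow> 'x) \<Rightarrow> real"
    using product_integral_insert[of "J - {i}" i g] that J unfolding J_eq by simp
  have "(\<integral>z. F z \<partial>PiM J (\<lambda>_. rho)) = (\<integral>z. F z \<partial>PiM (J - {i}) (\<lambda>_. rho))"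
    using ins[OF int_F] by (simp add: F_def rho.prob_space)
  also have "\<dots> = (\<integral>z. f z \<partial>PiM J (\<lambda>_. rho))" using ins[OF int_f] by (simp add: F_def)
  finally show "(\<integral>z. f z \<partial>PiM J (\<lambda>_. rho)) = (\<integral>z. (\<integral>w. f (z(i := w)) \<partial>rho) \<partial>PiM J (\<lambda>_. rho))"
    by (simp add: F_def)
qed

text \<open>Put y = 2c + d; then y^2 <= 10 t d and y <= 3 t. The terms linear in c are kept exactly
  because they will have mean zero. The constants are 2 + 10 = 12 and 3 + 6 * 10 = 63.\<close>

lemma
  fixes t c d :: real
  assumes d: "0 \<le> d" "d \<le> t" and c: "c\<^sup>2 \<le> t * d"
  shows power2_increment_le: "(t + 2 * c + d)\<^sup>2 \<le> t\<^sup>2 + 4 * (t * c) + 12 * (t * d)"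
    and power3_increment_le: "(t + 2 * c + d) ^ 3 \<le> t ^ 3 + 6 * (t\<^sup>2 * c) + 63 * (t\<^sup>2 * d)"
proof -
  define y where "y = 2 * c + d"
  have t: "t \<ge> 0" using d by simp
  have "d\<^sup>2 \<le> t * d" using d by (simp add: power2_eq_square mult_right_mono)
  moreover have "y\<^sup>2 \<le> 8 * c\<^sup>2 + 2 * d\<^sup>2"
    using zero_le_power2[of "2 * c - d"] by (simp add: y_def power2_eq_square algebra_simps)
  ultimately have y2: "y\<^sup>2 \<le> 10 * (t * d)" using c by simp
  have "c\<^sup>2 \<le> t\<^sup>2" using c d t mult_left_mono[of d t t] by (simp add: power2_eq_square)
  then have "\<bar>c\<bar> \<le> t" using t by (metis abs_le_square_iff abs_of_nonneg)
  then have y3: "y \<le> 3 * t" using d by (simp add: y_def)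
  have "(t + y)\<^sup>2 = t\<^sup>2 + 2 * (t * y) + y\<^sup>2" by (simp add: power2_eq_square algebra_simps)
  then show "(t + 2 * c + d)\<^sup>2 \<le> t\<^sup>2 + 4 * (t * c) + 12 * (t * d)"
    using y2 by (simp add: y_def algebra_simps)
  have "y * y\<^sup>2 \<le> (3 * t) * y\<^sup>2" using y3 by (rule mult_right_mono) simp
  then have "(t + y) ^ 3 \<le> t ^ 3 + 3 * (t\<^sup>2 * y) + 6 * t * y\<^sup>2"
    by (simp add: power3_eq_cube power2_eq_square algebra_simps)
  also have "\<dots> \<le> t ^ 3 + 3 * (t\<^sup>2 * y) + 6 * t * (10 * (t * d))"
    using y2 t by (intro add_mono mult_left_mono) auto
  also have "\<dots> = t ^ 3 + 6 * (t\<^sup>2 * c) + 63 * (t\<^sup>2 * d)"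
    by (simp add: y_def power2_eq_square algebra_simps)
  finally show "(t + 2 * c + d) ^ 3 \<le> t ^ 3 + 6 * (t\<^sup>2 * c) + 63 * (t\<^sup>2 * d)" by (simp add: y_def add.assoc)
qed

text \<open>\<open>k x y\<close> plays the role of the inner product of two centered random vectors; of the Hilbert
  space structure only the Cauchy-Schwarz inequality is used.\<close>

locale centered_kernel =
  fixes rho :: "'x measure" and k :: "'x \<Rightarrow> 'x \<Rightarrow> real" and b v :: real
  assumes rho: "prob_space rho"
    and k_measurable: "(\<lambda>p. k (fst p) (snd p)) \<in> borel_measurable (rho \<Otimes>\<^sub>M rho)"
    and k_sym: "k x y = k y x"
    and k_sum_nonneg: "\<And>(I :: nat set) w. (\<Sum>i\<in>I. \<Sum>j\<in>I. k (w i) (w j)) \<ge> 0"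
    and k_Cauchy_Schwarz: "\<And>(I :: nat set) w y.
      (\<Sum>i\<in>I. k (w i) y)\<^sup>2 \<le> (\<Sum>i\<in>I. \<Sum>j\<in>I. k (w i) (w j)) * k y y"
    and k_diag_le: "k x x \<le> b"
    and k_centered: "(\<integral>y. k x y \<partial>rho) = 0"
    and k_variance: "(\<integral>x. k x x \<partial>rho) \<le> v"
begin

lemma k_diag_nonneg: "k x x \<ge> 0"
  using k_sum_nonneg[where I = "{0}" and w = "\<lambda>_. x"] by simp

lemma b_nonneg: "b \<ge> 0"
  using k_diag_nonneg k_diag_le by (rule order_trans)

lemma v_nonneg: "v \<ge> 0"
  by (rule order_trans[OF Bochner_Integration.integral_nonneg k_variance]) (rule k_diag_nonneg)

lemma k_abs_le: "\<bar>k x y\<bar> \<le> b"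
proof (rule power2_le_imp_le)
  have "(k x y)\<^sup>2 \<le> k x x * k y y"
    using k_Cauchy_Schwarz[where I = "{0}" and w = "\<lambda>_. x" and y = y] by simp
  also have "\<dots> \<le> b * b" using k_diag_le k_diag_nonneg b_nonneg by (intro mult_mono) auto
  finally show "\<bar>k x y\<bar>\<^sup>2 \<le> b\<^sup>2" by (simp add: power2_eq_square)
qed (rule b_nonneg)

lemma k_row_measurable: "x \<in> space rho \<Longrightarrow> k x \<in> borel_measurable rho"
  using measurable_compose[OF _ k_measurable, of "\<lambda>y. (x, y)" rho] by simp

lemma k_row_integrable: "x \<in> space rho \<Longrightarrow> integrable rho (k x)"
proof -
  assume x: "x \<in> space rho"
  interpret rho: prob_space rho by (rule rho)
  show ?thesis
    by (rule rho.integrable_const_bound[of _ b]) (simp_all add: k_abs_le k_row_measurable[OF x])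
qed

lemma k_comp_measurable [measurable]:
  "f \<in> N \<rightarrow>\<^sub>M rho \<Longrightarrow> g \<in> N \<rightarrow>\<^sub>M rho \<Longrightarrow> (\<lambda>z. k (f z) (g z)) \<in> borel_measurable N"
  using measurable_compose[OF measurable_Pair[of f N rho g rho] k_measurable] by simp

text \<open>The squared norm of a sum of random vectors, shifted by \<open>b\<close> so that every
  diagonal value \<open>k x x\<close> is at most \<open>t\<close>, as the increment inequalities
  require.\<close>

definition t :: "nat set \<Rightarrow> (nat \<Rightarrow> 'x) \<Rightarrow> real" where
  "t I z = b + (\<Sum>i\<in>I. \<Sum>j\<in>I. k (z i) (z j))"

lemma t_ge: "t I z \<ge> b"
  using k_sum_nonneg by (simp add: t_def)

lemma t_bound: "\<bar>t I z\<bar> \<le> b + real (card I) * (real (card I) * b)"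
proof -
  have "\<bar>\<Sum>i\<in>I. \<Sum>j\<in>I. k (z i) (z j)\<bar> \<le> (\<Sum>i\<in>I. \<Sum>j\<in>I. b)"
    by (intro order_trans[OF sum_abs] sum_mono k_abs_le)
  then show ?thesis using b_nonneg by (simp add: t_def)
qed

lemma t_insert:
  assumes "finite I" "i \<notin> I"
  shows "t (insert i I) z = t I z + 2 * (\<Sum>j\<in>I. k (z j) (z i)) + k (z i) (z i)"
proof -
  have "(\<Sum>j\<in>I. k (z i) (z j)) = (\<Sum>j\<in>I. k (z j) (z i))"
    by (intro sum.cong refl k_sym)
  then show ?thesis using assms by (simp add: t_def sum.distrib)
qed

context
  fixes J :: "nat set"
  assumes J: "finite J"
begin

abbreviation "PJ \<equiv> PiM J (\<lambda>_. rho)"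

lemma t_measurable: "I \<subseteq> J \<Longrightarrow> t I \<in> borel_measurable PJ"
  unfolding t_def by (intro borel_measurable_add borel_measurable_sum k_comp_measurable) auto

lemma bounded_integrable:
  assumes "f \<in> borel_measurable PJ" "\<And>z. \<bar>f z\<bar> \<le> (C :: real)"
  shows "integrable PJ f"
proof -
  interpret PJ: prob_space PJ by (intro prob_space_PiM rho)
  show ?thesis by (rule PJ.integrable_const_bound[of _ C]) (simp_all add: assms)
qed

text \<open>Observation i does not occur in \<open>t I\<close>. Integrating it out first annihilates
  the cross term, because the kernel is centered, and replaces the diagonal term by at most
  v.\<close>

lemma
  assumes I: "I \<subseteq> J" "i \<in> J" "i \<notin> I"
  shows moment_cross: "integrable PJ (\<lambda>z. t I z ^ p * (\<Sum>j\<in>I. k (z j) (z i)))"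
      "(\<integral>z. t I z ^ p * (\<Sum>j\<in>I. k (z j) (z i)) \<partial>PJ) = 0"
    and moment_diag: "integrable PJ (\<lambda>z. t I z ^ p * k (z i) (z i))"
      "(\<integral>z. t I z ^ p * k (z i) (z i) \<partial>PJ) \<le> v * (\<integral>z. t I z ^ p \<partial>PJ)"
    and moment_integrable: "integrable PJ (\<lambda>z. t I z ^ p)"
proof -
  note [measurable] = t_measurable[OF I(1)]
  have [measurable]: "(\<lambda>z. z j) \<in> PJ \<rightarrow>\<^sub>M rho" if "j \<in> J" for j
    using that by (rule measurable_component_singleton)
  define C where "C = b + real (card I) * (real (card I) * b)"
  have tp: "\<bar>t I z ^ p\<bar> \<le> C ^ p" for z
    unfolding power_abs C_def by (intro power_mono t_bound) auto
  have C: "C \<ge> 0" using b_nonneg by (simp add: C_def)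
  have t_upd: "t I (z(i := w)) = t I z" for z w
    unfolding t_def using I(3) by (intro arg_cong2[of _ _ _ _ "(+)"] sum.cong refl) auto
  have I_J: "j \<in> J" if "j \<in> I" for j using that I by auto
  have cross_meas: "(\<lambda>z. t I z ^ p * (\<Sum>j\<in>I. k (z j) (z i))) \<in> borel_measurable PJ"
    using I I_J by measurable
  have cross_upd: "(\<Sum>j\<in>I. k ((z(i := w)) j) ((z(i := w)) i)) = (\<Sum>j\<in>I. k (z j) w)" for z w
    using I(3) by (intro sum.cong refl) auto
  have cross_bound: "\<bar>t I z ^ p * (\<Sum>j\<in>I. k (z j) (z i))\<bar> \<le> C ^ p * (\<Sum>j\<in>I. b)" for z
    unfolding abs_mult using C tp
    by (intro mult_mono order_trans[OF sum_abs] sum_mono k_abs_le) auto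
  show "integrable PJ (\<lambda>z. t I z ^ p * (\<Sum>j\<in>I. k (z j) (z i)))"
    by (rule bounded_integrable[OF cross_meas cross_bound])
  have "(\<integral>z. t I z ^ p * (\<Sum>j\<in>I. k (z j) (z i)) \<partial>PJ)
      = (\<integral>z. (\<integral>w. t I z ^ p * (\<Sum>j\<in>I. k (z j) w) \<partial>rho) \<partial>PJ)"
    using resample_integral[OF rho J I(2) cross_meas cross_bound] by (simp only: t_upd cross_upd)
  also have "\<dots> = (\<integral>z. 0 \<partial>PJ)"
  proof (rule Bochner_Integration.integral_cong[OF refl])
    fix z assume z: "z \<in> space PJ"
    have "z j \<in> space rho" if "j \<in> I" for j using z I_J[OF that] by (auto simp: space_PiM)
    then show "(\<integral>w. t I z ^ p * (\<Sum>j\<in>I. k (z j) w) \<partial>rho) = 0"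
      using k_row_integrable k_centered by (simp add: Bochner_Integration.integral_sum)
  qed
  finally show "(\<integral>z. t I z ^ p * (\<Sum>j\<in>I. k (z j) (z i)) \<partial>PJ) = 0" by simp
  have diag_meas: "(\<lambda>z. t I z ^ p * k (z i) (z i)) \<in> borel_measurable PJ"
    using I(2) by measurable
  have diag_bound: "\<bar>t I z ^ p * k (z i) (z i)\<bar> \<le> C ^ p * b" for z
    unfolding abs_mult using C tp by (intro mult_mono k_abs_le) auto
  show "integrable PJ (\<lambda>z. t I z ^ p * k (z i) (z i))"
    by (rule bounded_integrable[OF diag_meas diag_bound])
  have tp_meas: "(\<lambda>z. t I z ^ p) \<in> borel_measurable PJ" by measurable
  show int: "integrable PJ (\<lambda>z. t I z ^ p)"
    by (rule bounded_integrable[OF tp_meas tp])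
  have "(\<integral>z. t I z ^ p * k (z i) (z i) \<partial>PJ) = (\<integral>z. (\<integral>w. t I z ^ p * k w w \<partial>rho) \<partial>PJ)"
    using resample_integral[OF rho J I(2) diag_meas diag_bound] by (simp add: t_upd)
  also have "\<dots> = (\<integral>z. t I z ^ p * (\<integral>w. k w w \<partial>rho) \<partial>PJ)" by simp
  also have "\<dots> \<le> (\<integral>z. t I z ^ p * v \<partial>PJ)"
  proof (rule integral_mono)
    fix z
    show "t I z ^ p * (\<integral>w. k w w \<partial>rho) \<le> t I z ^ p * v"
      using k_variance t_ge[of I z] b_nonneg by (intro mult_left_mono zero_le_power) auto
  qed (use int in auto)
  finally show "(\<integral>z. t I z ^ p * k (z i) (z i) \<partial>PJ) \<le> v * (\<integral>z. t I z ^ p \<partial>PJ)"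
    by (simp add: mult.commute)
qed

lemma moment_step:
  assumes I: "finite I" "I \<subseteq> J" "i \<in> J" "i \<notin> I"
  shows "(\<integral>z. t (insert i I) z \<partial>PJ) \<le> (\<integral>z. t I z \<partial>PJ) + v"
    and "(\<integral>z. (t (insert i I) z)\<^sup>2 \<partial>PJ) \<le> (\<integral>z. (t I z)\<^sup>2 \<partial>PJ) + 12 * v * (\<integral>z. t I z \<partial>PJ)"
    and "(\<integral>z. t (insert i I) z ^ 3 \<partial>PJ) \<le> (\<integral>z. t I z ^ 3 \<partial>PJ) + 63 * v * (\<integral>z. (t I z)\<^sup>2 \<partial>PJ)"
proof -
  interpret PJ: prob_space PJ by (intro prob_space_PiM rho)
  define c where "c z = (\<Sum>j\<in>I. k (z j) (z i))" for z
  define d where "d z = k (z i) (z i)" for z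
  note int = moment_integrable[OF I(2-4)] moment_cross(1)[OF I(2-4), folded c_def]
    moment_diag(1)[OF I(2-4), folded d_def]
  note cross = moment_cross(2)[OF I(2-4), folded c_def]
  note diag = moment_diag(2)[OF I(2-4), folded d_def]
  have t_eq: "t (insert i I) z = t I z + 2 * c z + d z" for z
    unfolding c_def d_def by (rule t_insert[OF I(1,4)])
  have t0: "t I z \<ge> 0" for z using t_ge b_nonneg order_trans by blast
  have d: "0 \<le> d z" "d z \<le> t I z" for z
    using k_diag_nonneg k_diag_le t_ge order_trans unfolding d_def by blast+
  have c: "(c z)\<^sup>2 \<le> t I z * d z" for z
  proof -
    have "(c z)\<^sup>2 \<le> (\<Sum>i\<in>I. \<Sum>j\<in>I. k (z i) (z j)) * d z"
      unfolding c_def d_def by (rule k_Cauchy_Schwarz)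
    also have "\<dots> \<le> t I z * d z" using d b_nonneg by (intro mult_right_mono) (auto simp: t_def)
    finally show ?thesis .
  qed
  have ins: "insert i I \<subseteq> J" using I by auto
  have int': "integrable PJ (\<lambda>z. t (insert i I) z ^ p)" for p
  proof (rule bounded_integrable)
    show "(\<lambda>z. t (insert i I) z ^ p) \<in> borel_measurable PJ"
      using t_measurable[OF ins] by measurable
    show "\<bar>t (insert i I) z ^ p\<bar> \<le> (b + real (card (insert i I)) * (real (card (insert i I)) * b)) ^ p" for z
      unfolding power_abs by (intro power_mono t_bound) auto
  qed
  have "(\<integral>z. t (insert i I) z \<partial>PJ) = (\<integral>z. t I z ^ 1 + 2 * (t I z ^ 0 * c z) + t I z ^ 0 * d z \<partial>PJ)"
    by (simp add: t_eq)
  also have "\<dots> = (\<integral>z. t I z ^ 1 \<partial>PJ) + 2 * (\<integral>z. t I z ^ 0 * c z \<partial>PJ) + (\<integral>z. t I z ^ 0 * d z \<partial>PJ)"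
    using int[of 0] int[of 1] by simp
  also have "\<dots> \<le> (\<integral>z. t I z ^ 1 \<partial>PJ) + v"
    using cross[of 0] diag[of 0] by (simp add: PJ.prob_space)
  finally show "(\<integral>z. t (insert i I) z \<partial>PJ) \<le> (\<integral>z. t I z \<partial>PJ) + v" by simp
  have "(\<integral>z. (t (insert i I) z)\<^sup>2 \<partial>PJ) \<le> (\<integral>z. (t I z)\<^sup>2 + 4 * (t I z ^ 1 * c z) + 12 * (t I z ^ 1 * d z) \<partial>PJ)"
    using int[of 1] int[of 2] int'[of 2] power2_increment_le[OF d c] by (intro integral_mono) (auto simp: t_eq)
  also have "\<dots> = (\<integral>z. (t I z)\<^sup>2 \<partial>PJ) + 4 * (\<integral>z. t I z ^ 1 * c z \<partial>PJ) + 12 * (\<integral>z. t I z ^ 1 * d z \<partial>PJ)"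
    using int[of 1] int[of 2] by simp
  also have "\<dots> \<le> (\<integral>z. (t I z)\<^sup>2 \<partial>PJ) + 12 * v * (\<integral>z. t I z \<partial>PJ)"
    using cross[of 1] diag[of 1] by simp
  finally show "(\<integral>z. (t (insert i I) z)\<^sup>2 \<partial>PJ) \<le> (\<integral>z. (t I z)\<^sup>2 \<partial>PJ) + 12 * v * (\<integral>z. t I z \<partial>PJ)" .
  have "(\<integral>z. t (insert i I) z ^ 3 \<partial>PJ) \<le> (\<integral>z. t I z ^ 3 + 6 * ((t I z)\<^sup>2 * c z) + 63 * ((t I z)\<^sup>2 * d z) \<partial>PJ)"
    using int[of 2] int[of 3] int'[of 3] power3_increment_le[OF d c] by (intro integral_mono) (auto simp: t_eq)
  also have "\<dots> = (\<integral>z. t I z ^ 3 \<partial>PJ) + 6 * (\<integral>z. (t I z)\<^sup>2 * c z \<partial>PJ) + 63 * (\<integral>z. (t I z)\<^sup>2 * d z \<partial>PJ)"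
    using int[of 2] int[of 3] by simp
  also have "\<dots> \<le> (\<integral>z. t I z ^ 3 \<partial>PJ) + 63 * v * (\<integral>z. (t I z)\<^sup>2 \<partial>PJ)"
    using cross[of 2] diag[of 2] by simp
  finally show "(\<integral>z. t (insert i I) z ^ 3 \<partial>PJ) \<le> (\<integral>z. t I z ^ 3 \<partial>PJ) + 63 * v * (\<integral>z. (t I z)\<^sup>2 \<partial>PJ)" .
qed

text \<open>Induction over I inside the fixed product over J. With X the bound for I, the recursions
  close because 12 = 6 * 2 for the second moment and 63 * 6 = 126 * 3 for the third.\<close>

lemma
  assumes "I \<subseteq> J"
  shows moment1: "(\<integral>z. t I z \<partial>PJ) \<le> b + real (card I) * v"
    and moment3: "(\<integral>z. t I z ^ 3 \<partial>PJ) \<le> 126 * (b + real (card I) * v) ^ 3"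
proof -
  interpret PJ: prob_space PJ by (intro prob_space_PiM rho)
  have "finite I" using assms J finite_subset by blast
  then have "(\<integral>z. t I z \<partial>PJ) \<le> b + real (card I) * v \<and>
      (\<integral>z. (t I z)\<^sup>2 \<partial>PJ) \<le> 6 * (b + real (card I) * v)\<^sup>2 \<and>
      (\<integral>z. t I z ^ 3 \<partial>PJ) \<le> 126 * (b + real (card I) * v) ^ 3"
    using assms
  proof (induction I)
    case empty
    show ?case using b_nonneg by (simp add: t_def PJ.prob_space)
  next
    case (insert i I)
    define X where "X = b + real (card I) * v"
    have X: "X \<ge> 0" using b_nonneg v_nonneg by (simp add: X_def)
    have X': "b + real (card (insert i I)) * v = X + v"
      using insert by (simp add: X_def algebra_simps)
    have IH: "(\<integral>z. t I z \<partial>PJ) \<le> X" "(\<integral>z. (t I z)\<^sup>2 \<partial>PJ) \<le> 6 * X\<^sup>2" "(\<integral>z. t I z ^ 3 \<partial>PJ) \<le> 126 * X ^ 3"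
      using insert by (auto simp: X_def)
    note step = moment_step[of I i]
    have v: "v * (\<integral>z. t I z \<partial>PJ) \<le> v * X" "v * (\<integral>z. (t I z)\<^sup>2 \<partial>PJ) \<le> v * (6 * X\<^sup>2)"
      using IH v_nonneg by (auto intro: mult_left_mono)
    have "6 * X\<^sup>2 + 12 * (v * X) \<le> 6 * (X + v)\<^sup>2"
      by (simp add: power2_eq_square algebra_simps)
    moreover have "126 * X ^ 3 + 63 * (v * (6 * X\<^sup>2)) \<le> 126 * (X + v) ^ 3"
      using X v_nonneg by (simp add: power3_eq_cube power2_eq_square algebra_simps)
    ultimately show ?case
      unfolding X' using step IH v insert by (auto simp: mult.assoc)
  qed
  then show "(\<integral>z. t I z \<partial>PJ) \<le> b + real (card I) * v"
    "(\<integral>z. t I z ^ 3 \<partial>PJ) \<le> 126 * (b + real (card I) * v) ^ 3" by auto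
qed

end

end

section \<open>The source condition\<close>

text \<open>Enlarge s to l + s in the numerator, then use that the exponent e - 2 is not positive.
  The restriction e <= 2 is what limits the smoothness that one resolvent can exploit.\<close>

lemma powr_div_square_le:
  fixes s l e :: real
  assumes "0 < s" "0 < l" "0 \<le> e" "e \<le> 2"
  shows "s powr e / (l + s)\<^sup>2 \<le> l powr (e - 2)"
proof -
  have "s powr e / (l + s)\<^sup>2 \<le> (l + s) powr e / (l + s)\<^sup>2"
    using assms by (intro divide_right_mono powr_mono2) auto
  also have "\<dots> = (l + s) powr (e - 2)" using assms by (simp add: powr_diff)
  also have "\<dots> \<le> l powr (e - 2)" using assms by (intro powr_mono2') auto
  finally show ?thesis .
qed

context rkhs
begin

lemma hlim_add:
  assumes "hlim F f Z" "hlim G g Z"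
  shows "hlim (\<lambda>i. F i + G i) (f + g) Z"
proof -
  have mem: "\<forall>\<^sub>F i in Z. F i \<in> H \<and> G i \<in> H" "f \<in> H" "g \<in> H"
    using assms unfolding hlim_def by (auto intro: eventually_conj)
  have "((\<lambda>i. 2 * ip (F i - f) (F i - f) + 2 * ip (G i - g) (G i - g)) \<longlongrightarrow> 2 * 0 + 2 * 0) Z"
    using assms unfolding hlim_def by (intro tendsto_intros) auto
  then have lim: "((\<lambda>i. 2 * ip (F i - f) (F i - f) + 2 * ip (G i - g) (G i - g)) \<longlongrightarrow> 0) Z" by simp
  have "\<forall>\<^sub>F i in Z. norm (ip (F i + G i - (f + g)) (F i + G i - (f + g)))
      \<le> 2 * ip (F i - f) (F i - f) + 2 * ip (G i - g) (G i - g)"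
    using mem(1)
  proof eventually_elim
    case (elim i)
    have eq: "F i + G i - (f + g) = (F i - f) + (G i - g)" by simp
    show ?case unfolding eq
      using ip_add_self_le[of "F i - f" "G i - g"] ip_nonneg[of "(F i - f) + (G i - g)"] elim mem(2,3)
      by simp
  qed
  then have "((\<lambda>i. ip (F i + G i - (f + g)) (F i + G i - (f + g))) \<longlongrightarrow> 0) Z"
    by (rule Lim_null_comparison[OF _ lim])
  then show ?thesis
    using mem unfolding hlim_def by (auto elim: eventually_mono)
qed

lemma hlim_cong:
  assumes "hlim F f Z" and eq: "\<forall>\<^sub>F i in Z. F i = G i"
  shows "hlim G f Z"
  unfolding hlim_def
proof (intro conjI)
  show "f \<in> H" using assms(1) by (rule hlim_mem)
  show "\<forall>\<^sub>F i in Z. G i \<in> H"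
    using eq assms(1)[unfolded hlim_def, THEN conjunct2, THEN conjunct1] by eventually_elim simp
  have "\<forall>\<^sub>F i in Z. ip (F i - f) (F i - f) = ip (G i - f) (G i - f)"
    using eq by eventually_elim simp
  then show "((\<lambda>i. ip (G i - f) (G i - f)) \<longlongrightarrow> 0) Z"
    by (rule tendsto_cong[THEN iffD1])
      (rule assms(1)[unfolded hlim_def, THEN conjunct2, THEN conjunct2])
qed

text \<open>By polarization, from the convergence of squared norms.\<close>

lemma hlim_ip_both:
  assumes "hlim F f Z" "hlim G g Z"
  shows "((\<lambda>i. ip (F i) (G i)) \<longlongrightarrow> ip f g) Z"
proof -
  have mem: "\<forall>\<^sub>F i in Z. F i \<in> H \<and> G i \<in> H" "f \<in> H" "g \<in> H"
    using assms unfolding hlim_def by (auto intro: eventually_conj)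
  have eq: "(ip (a + b) (a + b) - ip a a - ip b b) / 2 = ip a b" if "a \<in> H" "b \<in> H" for a b
    using that ip_commute[of a b] by (simp add: ip_linear)
  have "((\<lambda>i. (ip (F i + G i) (F i + G i) - ip (F i) (F i) - ip (G i) (G i)) / 2) \<longlongrightarrow>
      (ip (f + g) (f + g) - ip f f - ip g g) / 2) Z"
    by (intro tendsto_intros hlim_ip_self hlim_add assms) simp
  then have "((\<lambda>i. (ip (F i + G i) (F i + G i) - ip (F i) (F i) - ip (G i) (G i)) / 2) \<longlongrightarrow> ip f g) Z"
    using eq mem by simp
  then show ?thesis
    by (rule Lim_transform_eventually) (use mem(1) eq in \<open>auto elim: eventually_mono\<close>)
qed

end

section \<open>Spectral powers as orthogonal series of eigenfunctions in \<open>H\<close>\<close>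

context mercer_rkhs
begin

abbreviation "spec \<equiv> eigenvalues mu L \<inter> {0<..}"

context
  fixes u :: "'a \<Rightarrow> real" and p :: "real \<Rightarrow> 'a \<Rightarrow> real"
  assumes u: "u \<in> L2 mu"
    and p: "\<And>s. s \<in> spec \<Longrightarrow> is_projection mu (eigenspace mu L s) u (p s)"
begin

text \<open>The projection \<open>p s\<close> is determined only almost everywhere. Since it is an
  eigenfunction, L (p s) / s agrees with it almost everywhere and lies in \<open>H\<close>.\<close>

definition phi :: "real \<Rightarrow> 'a \<Rightarrow> real" where
  "phi s = (1 / s) *\<^sub>R L (p s)"

definition U :: real where
  "U = (\<integral>x. (u x)\<^sup>2 \<partial>mu)"

lemma U_nonneg: "U \<ge> 0"
  by (simp add: U_def)

context
  fixes s assumes s: "s \<in> spec"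
begin

lemma p_L2: "p s \<in> L2 mu" and p_eigen: "AE x in mu. L (p s) x = s * p s x"
  using p[OF s] by (auto simp: is_projection_def eigenspace_def)

lemma s_pos: "s > 0"
  using s by simp

lemma phi_mem: "phi s \<in> H"
  unfolding phi_def using L_mem[OF p_L2] by auto

lemma phi_AE: "AE x in mu. phi s x = p s x"
  using p_eigen s_pos by (auto simp: phi_def fun_apply field_simps elim: AE_mp)

lemma L_phi: "L (phi s) = s *\<^sub>R phi s"
proof
  fix x
  have "L (phi s) x = (\<integral>t. K x t * p s t \<partial>mu)"
    unfolding integral_op_def using phi_AE phi_mem p_L2
    by (intro integral_cong_AE) (auto simp: L2_def intro!: borel_measurable_times)
  then show "L (phi s) x = (s *\<^sub>R phi s) x"
    using s_pos by (simp add: phi_def fun_apply integral_op_def)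
qed

lemma inner_u_phi: "(\<integral>x. u x * phi s x \<partial>mu) = ip (L (phi s)) (phi s)"
proof -
  have "L2_inner mu (\<lambda>x. u x - p s x) (p s) = 0"
    using p[OF s] unfolding is_projection_def by blast
  then have "(\<integral>x. u x * p s x \<partial>mu) = (\<integral>x. p s x * p s x \<partial>mu)"
    using L2_product_integrable[OF u p_L2] L2_product_integrable[OF p_L2 p_L2]
    by (simp add: L2_inner_def left_diff_distrib)
  moreover have "(\<integral>x. u x * p s x \<partial>mu) = (\<integral>x. u x * phi s x \<partial>mu)"
    using phi_AE phi_mem p_L2 u by (intro integral_cong_AE) (auto simp: L2_def intro!: borel_measurable_times)
  moreover have "(\<integral>x. p s x * p s x \<partial>mu) = (\<integral>x. (phi s x)\<^sup>2 \<partial>mu)"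
    using phi_AE phi_mem p_L2
    by (intro integral_cong_AE) (auto simp: L2_def power2_eq_square intro!: borel_measurable_times)
  ultimately show ?thesis using ip_L_self[OF phi_mem] by simp
qed

lemma eigenvalue_le: "phi s = 0 \<or> s \<le> \<kappa>\<^sup>2"
proof (cases "phi s = 0")
  case False
  then have "ip (phi s) (phi s) > 0" using ip_nonneg[OF phi_mem] ip_eq_0D[OF phi_mem] by fastforce
  moreover have "s * ip (phi s) (phi s) \<le> \<kappa>\<^sup>2 * ip (phi s) (phi s)"
    using sq_integral_H_le[OF phi_mem] ip_L_self[OF phi_mem] L_phi phi_mem by (simp add: ip_linear)
  ultimately show ?thesis by simp
qed simp

lemma R_phi: "l > 0 \<Longrightarrow> R l (phi s) = (1 / (l + s)) *\<^sub>R phi s"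
proof -
  assume l: "l > 0"
  have "R l ((l + s) *\<^sub>R phi s) = phi s"
    using resolvent_left[OF L_pos_op l phi_mem] L_phi by (simp add: scaleR_add_left)
  then have "(l + s) *\<^sub>R R l (phi s) = phi s"
    using pos_op_scale[OF R_pos_op[OF l] phi_mem] by simp
  then have "(1 / (l + s)) *\<^sub>R ((l + s) *\<^sub>R R l (phi s)) = (1 / (l + s)) *\<^sub>R phi s" by simp
  then show ?thesis using l s_pos by simp
qed

end

lemma phi_orthogonal:
  assumes "s \<in> spec" "s' \<in> spec" "s \<noteq> s'"
  shows "ip (phi s) (phi s') = 0"
proof -
  note m = phi_mem[OF assms(1)] phi_mem[OF assms(2)]
  have "s * ip (phi s) (phi s') = s' * ip (phi s) (phi s')"
    using pos_op_sym[OF L_pos_op m] m by (simp add: L_phi[OF assms(1)] L_phi[OF assms(2)] ip_linear)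
  then show ?thesis using assms(3) by simp
qed

text \<open>The squared L2 norm of the projection of u onto the eigenspace of s; the squared norm of
  \<open>phi s\<close> in \<open>H\<close> is the mass divided by s.\<close>

definition mass :: "real \<Rightarrow> real" where
  "mass s = ip (L (phi s)) (phi s)"

lemma mass_eq: "s \<in> spec \<Longrightarrow> mass s = s * ip (phi s) (phi s)"
  using phi_mem[of s] by (simp add: mass_def L_phi ip_linear)

lemma mass_nonneg: "s \<in> spec \<Longrightarrow> mass s \<ge> 0"
  using mass_eq s_pos phi_mem by (simp add: ip_nonneg)

lemma
  assumes F: "finite F" "F \<subseteq> spec"
  shows ip_phi_sum: "ip (\<Sum>s\<in>F. a s *\<^sub>R phi s) (\<Sum>s\<in>F. a s *\<^sub>R phi s) = (\<Sum>s\<in>F. (a s)\<^sup>2 / s * mass s)"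
    and ip_L_phi_sum: "ip (L (\<Sum>s\<in>F. a s *\<^sub>R phi s)) (\<Sum>s\<in>F. a s *\<^sub>R phi s) = (\<Sum>s\<in>F. (a s)\<^sup>2 * mass s)"
proof -
  have mem: "s \<in> F \<Longrightarrow> phi s \<in> H" for s using F phi_mem by auto
  have "ip (\<Sum>s\<in>F. a s *\<^sub>R phi s) (\<Sum>s\<in>F. a s *\<^sub>R phi s) = (\<Sum>s\<in>F. ip (a s *\<^sub>R phi s) (a s *\<^sub>R phi s))"
    using F mem phi_orthogonal by (intro ip_orthogonal_sum) (auto simp: ip_linear subset_iff)
  also have "\<dots> = (\<Sum>s\<in>F. (a s)\<^sup>2 / s * mass s)"
  proof (rule sum.cong[OF refl])
    fix s assume "s \<in> F"
    then have "s \<in> spec" "phi s \<in> H" using F mem by auto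
    then show "ip (a s *\<^sub>R phi s) (a s *\<^sub>R phi s) = (a s)\<^sup>2 / s * mass s"
      using s_pos[of s] mass_eq[of s] by (simp add: ip_linear power2_eq_square)
  qed
  finally show "ip (\<Sum>s\<in>F. a s *\<^sub>R phi s) (\<Sum>s\<in>F. a s *\<^sub>R phi s) = (\<Sum>s\<in>F. (a s)\<^sup>2 / s * mass s)" .
  have L_sum: "L (\<Sum>s\<in>F. a s *\<^sub>R phi s) = (\<Sum>s\<in>F. (a s * s) *\<^sub>R phi s)"
  proof -
    have "L (\<Sum>s\<in>F. a s *\<^sub>R phi s) = (\<Sum>s\<in>F. L (a s *\<^sub>R phi s))"
      by (rule pos_op_sum[OF L_pos_op]) (use mem in auto)
    also have "\<dots> = (\<Sum>s\<in>F. (a s * s) *\<^sub>R phi s)"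
    proof (rule sum.cong[OF refl])
      fix s assume "s \<in> F"
      then have "s \<in> spec" "phi s \<in> H" using F mem by auto
      then show "L (a s *\<^sub>R phi s) = (a s * s) *\<^sub>R phi s"
        using pos_op_scale[OF L_pos_op, of "phi s" "a s"] L_phi[of s] by simp
    qed
    finally show ?thesis .
  qed
  have "ip (L (\<Sum>s\<in>F. a s *\<^sub>R phi s)) (\<Sum>s\<in>F. a s *\<^sub>R phi s)
      = (\<Sum>s\<in>F. \<Sum>s'\<in>F. ip ((a s * s) *\<^sub>R phi s) (a s' *\<^sub>R phi s'))"
  proof -
    have "(\<Sum>s'\<in>F. a s' *\<^sub>R phi s') \<in> H" using mem by auto
    then have "ip (L (\<Sum>s\<in>F. a s *\<^sub>R phi s)) (\<Sum>s\<in>F. a s *\<^sub>R phi s)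
        = (\<Sum>s\<in>F. ip ((a s * s) *\<^sub>R phi s) (\<Sum>s'\<in>F. a s' *\<^sub>R phi s'))"
      unfolding L_sum by (intro ip_sum_left) (use mem in auto)
    also have "\<dots> = (\<Sum>s\<in>F. \<Sum>s'\<in>F. ip ((a s * s) *\<^sub>R phi s) (a s' *\<^sub>R phi s'))"
      by (intro sum.cong[OF refl] ip_sum_right) (use mem in auto)
    finally show ?thesis .
  qed
  also have "\<dots> = (\<Sum>s\<in>F. \<Sum>s'\<in>F. if s = s' then (a s)\<^sup>2 * mass s else 0)"
  proof (intro sum.cong[OF refl])
    fix s s' assume "s \<in> F" "s' \<in> F"
    then have "s \<in> spec" "s' \<in> spec" "phi s \<in> H" "phi s' \<in> H" using F mem by auto
    then show "ip ((a s * s) *\<^sub>R phi s) (a s' *\<^sub>R phi s') = (if s = s' then (a s)\<^sup>2 * mass s else 0)"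
      using phi_orthogonal[of s s'] mass_eq[of s]
      by (cases "s = s'") (simp_all add: ip_linear power2_eq_square)
  qed
  also have "\<dots> = (\<Sum>s\<in>F. (a s)\<^sup>2 * mass s)" using F by simp
  finally show "ip (L (\<Sum>s\<in>F. a s *\<^sub>R phi s)) (\<Sum>s\<in>F. a s *\<^sub>R phi s) = (\<Sum>s\<in>F. (a s)\<^sup>2 * mass s)" .
qed

text \<open>Bessel's inequality in L2: for the sum w of the projections, the integral of u w and
  that of w^2 both equal the total mass, and Cauchy-Schwarz cancels one factor.\<close>

lemma sum_mass_le:
  assumes F: "finite F" "F \<subseteq> spec"
  shows "(\<Sum>s\<in>F. mass s) \<le> U"
proof (rule le_if_square_le_mult)
  define w where "w = (\<Sum>s\<in>F. phi s)"
  have mem: "phi s \<in> H" if "s \<in> F" for s using that F phi_mem by auto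
  have w: "w \<in> H" unfolding w_def using mem by auto
  show "0 \<le> (\<Sum>s\<in>F. mass s)" using F mass_nonneg by (intro sum_nonneg) auto
  show "0 \<le> U" by (rule U_nonneg)
  have "(\<integral>x. u x * w x \<partial>mu) = (\<integral>x. (\<Sum>s\<in>F. u x * phi s x) \<partial>mu)"
    by (simp add: w_def sum_fun_apply sum_distrib_left)
  also have "\<dots> = (\<Sum>s\<in>F. \<integral>x. u x * phi s x \<partial>mu)"
    by (intro Bochner_Integration.integral_sum L2_times_H[OF u mem])
  also have "\<dots> = (\<Sum>s\<in>F. mass s)" using F inner_u_phi by (intro sum.cong) (auto simp: mass_def)
  finally have uw: "(\<integral>x. u x * w x \<partial>mu) = (\<Sum>s\<in>F. mass s)" .
  have "(\<integral>x. (w x)\<^sup>2 \<partial>mu) = (\<Sum>s\<in>F. mass s)"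
    using ip_L_self[OF w] ip_L_phi_sum[OF F, of "\<lambda>_. 1"] by (simp add: w_def)
  then show "(\<Sum>s\<in>F. mass s)\<^sup>2 \<le> U * (\<Sum>s\<in>F. mass s)"
    using L2_Cauchy_Schwarz[OF u H_L2[OF w]] uw by (simp add: U_def)
qed

text \<open>The weight is bounded only where the mass is positive, because
  \<open>eigenvalue_le\<close> bounds s by kappa^2 only when \<open>phi s\<close> is
  nonzero.\<close>

lemma sum_weighted_mass_le:
  assumes F: "finite F" "F \<subseteq> spec" and c: "c \<ge> 0" "\<And>s. s \<in> F \<Longrightarrow> mass s > 0 \<Longrightarrow> b s \<le> c"
  shows "(\<Sum>s\<in>F. b s * mass s) \<le> c * U"
proof -
  have "(\<Sum>s\<in>F. b s * mass s) \<le> (\<Sum>s\<in>F. c * mass s)"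
  proof (rule sum_mono)
    fix s assume s: "s \<in> F"
    then have "mass s \<ge> 0" using F mass_nonneg by auto
    then show "b s * mass s \<le> c * mass s" using c(2)[OF s] by (cases "mass s = 0") auto
  qed
  also have "\<dots> \<le> c * U"
    using sum_mass_le[OF F] c(1) by (simp add: sum_distrib_left[symmetric] mult_left_mono)
  finally show ?thesis .
qed

text \<open>The squared norm of a summand in \<open>H\<close> is s^(2a-1) times its mass. The
  exponent is nonnegative exactly for a >= 1/2, so it is bounded for s <= kappa^2.\<close>

lemma powr_combination_converges:
  assumes a: "a \<ge> 1 / 2"
  shows "\<exists>g. hlim (\<lambda>F. \<Sum>s\<in>F. s powr a *\<^sub>R phi s) g (finite_subsets_at_top spec)"
proof (rule orthogonal_sum_converges)
  fix s assume "s \<in> spec"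
  then show "s powr a *\<^sub>R phi s \<in> H" using phi_mem by auto
next
  fix s s' assume "s \<in> spec" "s' \<in> spec" "s \<noteq> s'"
  then show "ip (s powr a *\<^sub>R phi s) (s' powr a *\<^sub>R phi s') = 0"
    using phi_orthogonal[of s s'] phi_mem by (simp add: ip_linear)
next
  fix F assume F: "finite F" "F \<subseteq> spec"
  have eq: "(s powr a)\<^sup>2 / s = s powr (2 * a - 1)" if "s \<in> F" for s
  proof -
    have "s > 0" using that F s_pos by auto
    then show ?thesis by (simp add: powr_diff power2_eq_square powr_add[symmetric])
  qed
  have "(\<Sum>s\<in>F. ip (s powr a *\<^sub>R phi s) (s powr a *\<^sub>R phi s)) = (\<Sum>s\<in>F. (s powr a)\<^sup>2 / s * mass s)"
  proof (rule sum.cong[OF refl])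
    fix s assume "s \<in> F"
    then have "s \<in> spec" using F by auto
    then show "ip (s powr a *\<^sub>R phi s) (s powr a *\<^sub>R phi s) = (s powr a)\<^sup>2 / s * mass s"
      using s_pos[of s] mass_eq[of s] phi_mem[of s] by (simp add: ip_linear power2_eq_square)
  qed
  also have "\<dots> \<le> (\<kappa>\<^sup>2) powr (2 * a - 1) * U"
  proof (rule sum_weighted_mass_le[OF F])
    fix s assume "s \<in> F" "mass s > 0"
    then have s: "s \<in> spec" "phi s \<noteq> 0"
      using F ip_zero_right by (auto simp: mass_def L_pos_op[THEN pos_op_zero])
    then have "s \<le> \<kappa>\<^sup>2" using eigenvalue_le by auto
    then show "(s powr a)\<^sup>2 / s \<le> (\<kappa>\<^sup>2) powr (2 * a - 1)"
      unfolding eq[OF \<open>s \<in> F\<close>] using a s_pos[OF s(1)] by (intro powr_mono2) auto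
  qed simp
  finally show "(\<Sum>s\<in>F. ip (s powr a *\<^sub>R phi s) (s powr a *\<^sub>R phi s)) \<le> (\<kappa>\<^sup>2) powr (2 * a - 1) * U" .
qed

text \<open>On finite partial sums the resolvent acts by 1/(l + s), and
  \<open>powr_div_square_le\<close> applies with e = 2a - 1 and e = 2a; the conditions a <= 3/2 and
  a <= 1 say e <= 2. The bounds then pass to the limit.\<close>

lemma resolvent_source_bounds:
  assumes g: "hlim (\<lambda>F. \<Sum>s\<in>F. s powr a *\<^sub>R phi s) g (finite_subsets_at_top spec)"
    and a: "a \<ge> 1 / 2" and l: "l > 0"
  shows "a \<le> 3 / 2 \<Longrightarrow> ip (R l g) (R l g) \<le> l powr (2 * a - 3) * U"
    and "a \<le> 1 \<Longrightarrow> ip (L (R l g)) (R l g) \<le> l powr (2 * a - 2) * U"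
proof -
  let ?Z = "finite_subsets_at_top spec"
  define c where "c s = s powr a / (l + s)" for s
  define h where "h F = R l (\<Sum>s\<in>F. s powr a *\<^sub>R phi s)" for F
  have h_eq: "h F = (\<Sum>s\<in>F. c s *\<^sub>R phi s)" if F: "finite F" "F \<subseteq> spec" for F
  proof -
    have "h F = (\<Sum>s\<in>F. R l (s powr a *\<^sub>R phi s))"
      unfolding h_def by (rule pos_op_sum[OF R_pos_op[OF l]]) (use F phi_mem in auto)
    also have "\<dots> = (\<Sum>s\<in>F. c s *\<^sub>R phi s)"
    proof (rule sum.cong[OF refl])
      fix s assume "s \<in> F"
      then have "s \<in> spec" using F by auto
      then show "R l (s powr a *\<^sub>R phi s) = c s *\<^sub>R phi s"
        using pos_op_scale[OF R_pos_op[OF l] phi_mem, of s "s powr a"] R_phi[of s l] l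
        by (simp add: c_def)
    qed
    finally show ?thesis .
  qed
  have h_lim: "hlim h (R l g) ?Z"
    unfolding h_def
    by (rule hlim_op[OF g R_pos_op[OF l]]) (use R_pos_bdd[OF l, unfolded pos_bdd_def] in blast)
  have Lh_lim: "hlim (\<lambda>F. L (h F)) (L (R l g)) ?Z"
    by (rule hlim_op[OF h_lim L_pos_op]) (use L_pos_bdd[unfolded pos_bdd_def] in blast)
  show "ip (R l g) (R l g) \<le> l powr (2 * a - 3) * U" if "a \<le> 3 / 2"
  proof (rule tendsto_upperbound[OF hlim_ip_self[OF h_lim]])
    show "\<forall>\<^sub>F F in ?Z. ip (h F) (h F) \<le> l powr (2 * a - 3) * U"
    proof (rule eventually_finite_subsets_at_top_weakI)
      fix F assume F: "finite F" "F \<subseteq> spec"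
      have "(\<Sum>s\<in>F. (c s)\<^sup>2 / s * mass s) \<le> l powr (2 * a - 3) * U"
      proof (rule sum_weighted_mass_le[OF F])
        fix s assume "s \<in> F"
        then have s: "s > 0" using F s_pos by auto
        have "(c s)\<^sup>2 / s = s powr (2 * a - 1) / (l + s)\<^sup>2"
          using s by (simp add: c_def powr_diff power2_eq_square powr_add[symmetric])
        also have "\<dots> \<le> l powr ((2 * a - 1) - 2)"
          using s l a that by (intro powr_div_square_le) auto
        finally show "(c s)\<^sup>2 / s \<le> l powr (2 * a - 3)" by simp
      qed simp
      then show "ip (h F) (h F) \<le> l powr (2 * a - 3) * U"
        unfolding h_eq[OF F] ip_phi_sum[OF F] .
    qed
  qed simp
  show "ip (L (R l g)) (R l g) \<le> l powr (2 * a - 2) * U" if "a \<le> 1"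
  proof (rule tendsto_upperbound[OF hlim_ip_both[OF Lh_lim h_lim]])
    show "\<forall>\<^sub>F F in ?Z. ip (L (h F)) (h F) \<le> l powr (2 * a - 2) * U"
    proof (rule eventually_finite_subsets_at_top_weakI)
      fix F assume F: "finite F" "F \<subseteq> spec"
      have "(\<Sum>s\<in>F. (c s)\<^sup>2 * mass s) \<le> l powr (2 * a - 2) * U"
      proof (rule sum_weighted_mass_le[OF F])
        fix s assume "s \<in> F"
        then have s: "s > 0" using F s_pos by auto
        have "(c s)\<^sup>2 = s powr (2 * a) / (l + s)\<^sup>2"
          using s by (simp add: c_def power2_eq_square powr_add[symmetric])
        also have "\<dots> \<le> l powr (2 * a - 2)"
          using s l a that by (intro powr_div_square_le) auto
        finally show "(c s)\<^sup>2 \<le> l powr (2 * a - 2)" .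
      qed simp
      then show "ip (L (h F)) (h F) \<le> l powr (2 * a - 2) * U"
        unfolding h_eq[OF F] ip_L_phi_sum[OF F] .
    qed
  qed simp
qed

text \<open>The spectral series converges to f in L2 and to g in \<open>H\<close>. Convergence in
  \<open>H\<close> implies convergence in L2, so the integral of (f - g)^2 is below every value of a
  quantity tending to zero.\<close>

lemma spectral_limit_AE:
  assumes f: "f \<in> L2 mu"
    and lim: "((\<lambda>S. L2_norm mu (\<lambda>x. (\<Sum>s\<in>S. s powr r * p s x) - f x)) \<longlongrightarrow> 0) (finite_subsets_at_top spec)"
    and g: "hlim (\<lambda>F. \<Sum>s\<in>F. s powr r *\<^sub>R phi s) g (finite_subsets_at_top spec)"
  shows "AE x in mu. f x = g x"
proof -
  let ?Z = "finite_subsets_at_top spec"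
  have gH: "g \<in> H" using g by (simp add: hlim_def)
  define G where "G F = (\<Sum>s\<in>F. s powr r *\<^sub>R phi s)" for F
  define w where "w x = f x - g x" for x
  have f_meas [measurable]: "f \<in> borel_measurable mu" using f by (simp add: L2_def)
  have int: "integrable mu (\<lambda>x. (f x - h x)\<^sup>2)" if h: "h \<in> H" for h
  proof -
    have "integrable mu (\<lambda>x. (f x)\<^sup>2 + (h x)\<^sup>2 - 2 * (f x * h x))"
      using f H_L2[OF h] L2_times_H[OF f h] by (auto simp: L2_def)
    then show ?thesis by (simp only: power2_diff mult.assoc)
  qed
  have bound: "(\<integral>x. (w x)\<^sup>2 \<partial>mu) \<le>
      2 * (L2_norm mu (\<lambda>x. (\<Sum>s\<in>F. s powr r * p s x) - f x))\<^sup>2 + 2 * (\<kappa>\<^sup>2 * ip (G F - g) (G F - g))"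
    if F: "finite F" "F \<subseteq> spec" for F
  proof -
    have GF: "G F \<in> H" unfolding G_def by (intro H_sum H_scale phi_mem) (use F in auto)
    have "AE x in mu. \<forall>s\<in>F. phi s x = p s x"
      using F phi_AE by (intro AE_finite_allI) auto
    then have AE: "AE x in mu. (\<Sum>s\<in>F. s powr r * p s x) = G F x"
      by eventually_elim (simp add: G_def fun_apply)
    have [measurable]: "p s \<in> borel_measurable mu" if "s \<in> F" for s
      using that F p_L2 by (auto simp: L2_def)
    have GFm [measurable]: "G F \<in> borel_measurable mu" using GF by measurable
    have "(L2_norm mu (\<lambda>x. (\<Sum>s\<in>F. s powr r * p s x) - f x))\<^sup>2
        = (\<integral>x. ((\<Sum>s\<in>F. s powr r * p s x) - f x)\<^sup>2 \<partial>mu)"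
      by (simp add: L2_norm_def L2_inner_def power2_eq_square[symmetric])
    also have "\<dots> = (\<integral>x. (f x - G F x)\<^sup>2 \<partial>mu)"
      using AE by (intro integral_cong_AE) (auto simp: power2_commute elim!: AE_mp)
    finally have norm_eq: "(L2_norm mu (\<lambda>x. (\<Sum>s\<in>F. s powr r * p s x) - f x))\<^sup>2 = (\<integral>x. (f x - G F x)\<^sup>2 \<partial>mu)" .
    have diff: "G F - g \<in> H" using GF gH by simp
    have int2: "integrable mu (\<lambda>x. ((G F - g) x)\<^sup>2)" using H_L2[OF diff] by (simp add: L2_def)
    have "(\<integral>x. (w x)\<^sup>2 \<partial>mu) \<le> (\<integral>x. 2 * (f x - G F x)\<^sup>2 + 2 * ((G F - g) x)\<^sup>2 \<partial>mu)"
    proof (rule integral_mono)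
      show "integrable mu (\<lambda>x. (w x)\<^sup>2)" unfolding w_def by (rule int[OF gH])
      show "integrable mu (\<lambda>x. 2 * (f x - G F x)\<^sup>2 + 2 * ((G F - g) x)\<^sup>2)"
        using int[OF GF] int2 by simp
      fix x
      have "(a + b)\<^sup>2 \<le> 2 * a\<^sup>2 + 2 * b\<^sup>2" for a b :: real
        using zero_le_power2[of "a - b"] by (simp add: power2_sum power2_diff)
      from this[of "f x - G F x" "(G F - g) x"]
      show "(w x)\<^sup>2 \<le> 2 * (f x - G F x)\<^sup>2 + 2 * ((G F - g) x)\<^sup>2" by (simp add: w_def fun_apply)
    qed
    also have "\<dots> = 2 * (\<integral>x. (f x - G F x)\<^sup>2 \<partial>mu) + 2 * (\<integral>x. ((G F - g) x)\<^sup>2 \<partial>mu)"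
      using int[OF GF] int2 by simp
    also have "\<dots> \<le> 2 * (\<integral>x. (f x - G F x)\<^sup>2 \<partial>mu) + 2 * (\<kappa>\<^sup>2 * ip (G F - g) (G F - g))"
      using sq_integral_H_le[OF diff] by simp
    finally show ?thesis unfolding norm_eq .
  qed
  have "((\<lambda>F. 2 * (L2_norm mu (\<lambda>x. (\<Sum>s\<in>F. s powr r * p s x) - f x))\<^sup>2 + 2 * (\<kappa>\<^sup>2 * ip (G F - g) (G F - g)))
      \<longlongrightarrow> 2 * 0\<^sup>2 + 2 * (\<kappa>\<^sup>2 * 0)) ?Z"
    using g unfolding hlim_def G_def by (intro tendsto_intros lim) auto
  then have "(\<integral>x. (w x)\<^sup>2 \<partial>mu) \<le> 2 * 0\<^sup>2 + 2 * (\<kappa>\<^sup>2 * 0)"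
    by (rule tendsto_lowerbound) (auto intro!: eventually_finite_subsets_at_top_weakI bound)
  then have "(\<integral>x. (w x)\<^sup>2 \<partial>mu) = 0" by (intro antisym) auto
  then have "AE x in mu. (w x)\<^sup>2 = 0"
    using int[OF gH] by (subst (asm) integral_nonneg_eq_0_iff_AE) (auto simp: w_def)
  then show ?thesis by eventually_elim (simp add: w_def)
qed

end

definition source :: "real \<Rightarrow> real \<Rightarrow> ('a \<Rightarrow> real) \<Rightarrow> bool" where
  "source r C f \<longleftrightarrow>
     (\<forall>l>0. \<exists>h\<in>H. f = l *\<^sub>R h + L h \<and> ip h h \<le> l powr (2 * r - 3) * C) \<or>
     (\<exists>g\<in>H. f = L g \<and> ip g g \<le> C \<and>
       (\<forall>l>0. \<exists>h\<in>H. g = l *\<^sub>R h + L h \<and> ip h h \<le> l powr (2 * r - 5) * C \<and> ip (L h) h \<le> l powr (2 * r - 4) * C))"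

text \<open>Writing \<open>f = L\<^sup>r u\<close> as \<open>(L + l) h\<close> turns the exponent \<open>r\<close> into a bound on the norm of \<open>h\<close>, so
  that no fractional powers of operators occur later on. For \<open>r > 3/2\<close> one factor \<open>L\<close> is split
  off first.\<close>

lemma spectral_power_source:
  assumes u: "u \<in> L2 mu" and r: "1 / 2 \<le> r" "r \<le> 2" and sp: "is_spectral_power mu L r u f"
  shows "\<exists>fH\<in>H. (AE x in mu. f x = fH x) \<and> (\<exists>C\<ge>0. source r C fH)"
proof -
  obtain p where f: "f \<in> L2 mu" and p: "\<And>s. s \<in> spec \<Longrightarrow> is_projection mu (eigenspace mu L s) u (p s)"
    and lim: "((\<lambda>S. L2_norm mu (\<lambda>x. (\<Sum>s\<in>S. s powr r * p s x) - f x)) \<longlongrightarrow> 0) (finite_subsets_at_top spec)"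
    using sp unfolding is_spectral_power_def by blast
  let ?phi = "phi p" and ?Z = "finite_subsets_at_top spec"
  have U0: "U u \<ge> 0" by (rule U_nonneg[OF u p])
  show ?thesis
  proof (cases "r \<le> 3 / 2")
    case True
    obtain g where g: "hlim (\<lambda>F. \<Sum>s\<in>F. s powr r *\<^sub>R ?phi s) g ?Z"
      using powr_combination_converges[OF u p r(1)] by blast
    have gH: "g \<in> H" using g by (simp add: hlim_def)
    have "\<exists>h\<in>H. g = l *\<^sub>R h + L h \<and> ip h h \<le> l powr (2 * r - 3) * U u" if l: "l > 0" for l
    proof (rule bexI[of _ "R l g"], intro conjI)
      show "g = l *\<^sub>R R l g + L (R l g)" using resolvent_limit(2)[OF L_pos_bdd l gH] by simp
      show "ip (R l g) (R l g) \<le> l powr (2 * r - 3) * U u"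
        by (rule resolvent_source_bounds(1)[OF u p g r(1) l True])
      show "R l g \<in> H" by (rule pos_op_mem[OF R_pos_op[OF l] gH])
    qed
    then have "source r (U u) g" unfolding source_def by (intro disjI1 allI impI)
    moreover have "AE x in mu. f x = g x" by (rule spectral_limit_AE[OF u p f lim g])
    ultimately show ?thesis using gH U0 by (intro bexI[of _ g] conjI exI[of _ "U u"])
  next
    case False
    define a where "a = r - 1"
    have a: "1 / 2 \<le> a" "a \<le> 1" using False r by (auto simp: a_def)
    obtain g where g: "hlim (\<lambda>F. \<Sum>s\<in>F. s powr a *\<^sub>R ?phi s) g ?Z"
      using powr_combination_converges[OF u p a(1)] by blast
    have gH: "g \<in> H" using g by (simp add: hlim_def)
    have "hlim (\<lambda>F. L (\<Sum>s\<in>F. s powr a *\<^sub>R ?phi s)) (L g) ?Z"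
      by (rule hlim_op[OF g L_pos_op]) (use L_pos_bdd[unfolded pos_bdd_def] in blast)
    moreover have "\<forall>\<^sub>F F in ?Z. L (\<Sum>s\<in>F. s powr a *\<^sub>R ?phi s) = (\<Sum>s\<in>F. s powr r *\<^sub>R ?phi s)"
    proof (rule eventually_finite_subsets_at_top_weakI)
      fix F assume F: "finite F" "F \<subseteq> spec"
      have "L (\<Sum>s\<in>F. s powr a *\<^sub>R ?phi s) = (\<Sum>s\<in>F. L (s powr a *\<^sub>R ?phi s))"
        by (rule pos_op_sum[OF L_pos_op]) (use F phi_mem[OF u p] in auto)
      also have "\<dots> = (\<Sum>s\<in>F. s powr r *\<^sub>R ?phi s)"
      proof (rule sum.cong[OF refl])
        fix s assume "s \<in> F"
        then have s: "s \<in> spec" "s > 0" using F by auto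
        then have "s powr a * s = s powr r" by (simp add: a_def powr_diff)
        then show "L (s powr a *\<^sub>R ?phi s) = s powr r *\<^sub>R ?phi s"
          using pos_op_scale[OF L_pos_op phi_mem[OF u p s(1)], of "s powr a"] L_phi[OF u p s(1)] by simp
      qed
      finally show "L (\<Sum>s\<in>F. s powr a *\<^sub>R ?phi s) = (\<Sum>s\<in>F. s powr r *\<^sub>R ?phi s)" .
    qed
    ultimately have Lg: "hlim (\<lambda>F. \<Sum>s\<in>F. s powr r *\<^sub>R ?phi s) (L g) ?Z"
      by (rule hlim_cong)
    \<comment> \<open>\<open>source\<close> uses a single constant for the norm of g and for the
      resolvent bounds.\<close>
    define C where "C = max (U u) (ip g g)"
    have C: "U u \<le> C" "ip g g \<le> C" "C \<ge> 0" using U0 by (auto simp: C_def)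
    have X: "\<exists>h\<in>H. g = l *\<^sub>R h + L h \<and> ip h h \<le> l powr (2 * r - 5) * C \<and> ip (L h) h \<le> l powr (2 * r - 4) * C"
      if l: "l > 0" for l
    proof (rule bexI[of _ "R l g"], intro conjI)
      show "g = l *\<^sub>R R l g + L (R l g)" using resolvent_limit(2)[OF L_pos_bdd l gH] by simp
      have "ip (R l g) (R l g) \<le> l powr (2 * a - 3) * U u"
        using resolvent_source_bounds(1)[OF u p g a(1) l] a by simp
      also have "\<dots> \<le> l powr (2 * r - 5) * C"
        using C(1) by (intro mult_mono) (auto simp: a_def U0)
      finally show "ip (R l g) (R l g) \<le> l powr (2 * r - 5) * C" .
      have "ip (L (R l g)) (R l g) \<le> l powr (2 * a - 2) * U u"
        using resolvent_source_bounds(2)[OF u p g a(1) l] a by simp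
      also have "\<dots> \<le> l powr (2 * r - 4) * C"
        using C(1) by (intro mult_mono) (auto simp: a_def U0)
      finally show "ip (L (R l g)) (R l g) \<le> l powr (2 * r - 4) * C" .
      show "R l g \<in> H" by (rule pos_op_mem[OF R_pos_op[OF l] gH])
    qed
    have "source r C (L g)"
      unfolding source_def
    proof (rule disjI2, rule bexI[OF _ gH], intro conjI allI impI)
      fix l :: real assume "0 < l"
      then show "\<exists>h\<in>H. g = l *\<^sub>R h + L h \<and> ip h h \<le> l powr (2 * r - 5) * C \<and> ip (L h) h \<le> l powr (2 * r - 4) * C"
        by (rule X)
    qed (auto intro: C)
    moreover have "AE x in mu. f x = L g x" by (rule spectral_limit_AE[OF u p f lim Lg])
    ultimately show ?thesis
      using pos_op_mem[OF L_pos_op gH] C(3) by (intro bexI[of _ "L g"] conjI exI[of _ C])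
  qed
qed

end

section \<open>Pointwise error bounds\<close>

context rkhs
begin

text \<open>Jensen's inequality for the form of \<open>A\<close>. With u the average, (A u, u) is
  the weighted mean of (A u, a_j) <= ((A u, u) + (A a_j, a_j)) / 2, and half of (A u, u) is moved to
  the left.\<close>

lemma pos_op_convex:
  assumes A: "pos_op A" and J: "finite J" and w: "\<And>j. j \<in> J \<Longrightarrow> w j \<ge> 0" "(\<Sum>j\<in>J. w j) = 1"
    and a: "\<And>j. j \<in> J \<Longrightarrow> a j \<in> H"
  shows "ip (A (\<Sum>j\<in>J. w j *\<^sub>R a j)) (\<Sum>j\<in>J. w j *\<^sub>R a j) \<le> (\<Sum>j\<in>J. w j * ip (A (a j)) (a j))"
proof -
  define u where "u = (\<Sum>j\<in>J. w j *\<^sub>R a j)"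
  have u: "u \<in> H" unfolding u_def using a by auto
  have Au: "A u \<in> H" using pos_op_mem[OF A u] .
  have two: "2 * ip (A u) v \<le> ip (A u) u + ip (A v) v" if v: "v \<in> H" for v
  proof -
    have "ip (A v) u = ip (A u) v"
      using pos_op_sym[OF A u v] ip_commute[OF u pos_op_mem[OF A v]] by simp
    moreover have "0 \<le> ip (A (u - v)) (u - v)" using u v by (simp add: pos_op_nonneg[OF A])
    ultimately show ?thesis using u v by (simp add: pos_op_linear[OF A] ip_linear)
  qed
  have "ip (A u) u = (\<Sum>j\<in>J. w j * ip (A u) (a j))"
    using a Au by (subst (2) u_def) (simp add: ip_linear)
  also have "\<dots> \<le> (\<Sum>j\<in>J. w j * ((ip (A u) u + ip (A (a j)) (a j)) / 2))"
  proof (intro sum_mono mult_left_mono)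
    show "ip (A u) (a j) \<le> (ip (A u) u + ip (A (a j)) (a j)) / 2" if "j \<in> J" for j
      using two[OF a[OF that]] by simp
  qed (rule w)
  also have "\<dots> = (\<Sum>j\<in>J. w j) * ip (A u) u / 2 + (\<Sum>j\<in>J. w j * ip (A (a j)) (a j)) / 2"
    by (simp add: sum_distrib_right sum_divide_distrib sum.distrib[symmetric] field_simps)
  finally show ?thesis using w(2) by (simp add: u_def)
qed

end

text \<open>The difference is 3 (1 + q) (q - 1)^2. This lemma and the next two reduce the
  polynomials in q to 1, q and q^3, whose expectations are bounded later.\<close>

lemma one_plus_cube_le: "(1 + q) ^ 3 \<le> 4 * (1 + q ^ 3)" if "q \<ge> 0" for q :: real
proof -
  have "0 \<le> 3 * (1 + q) * (q - 1)\<^sup>2" using that by simp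
  then show ?thesis by (simp add: power3_eq_cube power2_eq_square algebra_simps)
qed

lemma two_plus_square_le: "(2 + q)\<^sup>2 \<le> 16 * (1 + q ^ 3)" if "q \<ge> 0" for q :: real
proof -
  have "(2 + q)\<^sup>2 \<le> 4 * (1 + q) ^ 3"
    using that by (simp add: power3_eq_cube power2_eq_square algebra_simps)
  also have "\<dots> \<le> 16 * (1 + q ^ 3)" using one_plus_cube_le[OF that] by simp
  finally show ?thesis .
qed

text \<open>The right side has to vanish at q = 0, so that the perturbation term keeps its small
  factor.\<close>

lemma two_plus_square_times_le: "(2 + q)\<^sup>2 * q \<le> 8 * (q + q ^ 3)" if "q \<ge> 0" for q :: real
proof -
  have "0 \<le> q * (2 - q)\<^sup>2 + q * (q * (q * 6))" using that by simp
  then have "0 \<le> q * ((2 - q)\<^sup>2 + 6 * q * q)" by (simp add: algebra_simps)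
  then show ?thesis by (simp add: power3_eq_cube power2_eq_square algebra_simps)
qed

section \<open>The deterministic bias bound\<close>

context mercer_rkhs
begin

abbreviation "sq f \<equiv> ip (L f) f"
abbreviation "edim l \<equiv> effective_dim mu K H ip l"
abbreviation "Bc n l \<equiv> B_complexity mu K H ip n l"

definition RE :: "real \<Rightarrow> nat set \<Rightarrow> (nat \<Rightarrow> 'a \<times> real) \<Rightarrow> ('a \<Rightarrow> real) \<Rightarrow> 'a \<Rightarrow> real" where
  "RE l I z = resolvent H (empirical_op K I z) l"

definition GE :: "real \<Rightarrow> nat set \<Rightarrow> (nat \<Rightarrow> 'a \<times> real) \<Rightarrow> ('a \<Rightarrow> real) \<Rightarrow> 'a \<Rightarrow> real" where
  "GE l I z f = RE l I z f + l *\<^sub>R RE l I z (RE l I z f)"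

definition bias :: "real \<Rightarrow> nat set \<Rightarrow> (nat \<Rightarrow> 'a \<times> real) \<Rightarrow> ('a \<Rightarrow> real) \<Rightarrow> 'a \<Rightarrow> real" where
  "bias l I z f = l\<^sup>2 *\<^sub>R RE l I z (RE l I z f)"

lemma RE_pos_op: "l > 0 \<Longrightarrow> pos_op (RE l I z)"
  unfolding RE_def by (rule resolvent_pos_op[OF empirical_op_pos_bdd])

lemma RE_norm_le: "l > 0 \<Longrightarrow> f \<in> H \<Longrightarrow> l\<^sup>2 * ip (RE l I z f) (RE l I z f) \<le> ip f f"
  unfolding RE_def by (rule resolvent_norm_le[OF empirical_op_pos_bdd])

lemma sq_nonneg: "f \<in> H \<Longrightarrow> sq f \<ge> 0"
  by (rule pos_op_nonneg[OF L_pos_op])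

lemma sq_le: "f \<in> H \<Longrightarrow> sq f \<le> \<kappa>\<^sup>2 * ip f f"
  by (simp add: ip_L_self sq_integral_H_le)

text \<open>In the low smoothness case f = S h and \<open>R'_R'_S_bound\<close> suffices. In the
  high case the double resolvent of f splits into \<open>v1\<close>, \<open>v2\<close>,
  \<open>v3\<close>, bounded by \<open>R'_S_bound\<close>, \<open>R'_R'_diff_bound\<close> and
  \<open>R'_R'_S_bound\<close>. The constants are 4 * 32 + 2 * 16 = 160 and 4 * 8 = 32.\<close>

lemma bias_pointwise_le:
  fixes z :: "nat \<Rightarrow> 'a \<times> real"
  assumes src: "source r C f" and C: "C \<ge> 0" and l: "0 < l" and I: "finite I" "I \<noteq> {}"
  defines "q \<equiv> Q2 l I z / l"
  shows "sq (bias l I z f) \<le> 160 * C * l powr (2 * r) * (1 + q ^ 3) + 32 * C * l ^ 3 * (q + q ^ 3)"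
proof -
  interpret D: two_resolvents K H ip L "empirical_op K I z" "\<kappa> ^ 4" "\<kappa> ^ 4" l "Q2 l I z"
    using l I by (rule two_resolvents_empirical)
  let ?R = "resolvent H (empirical_op K I z) l"
  have q_eq: "D.q = q" by (simp add: D.q_def q_def)
  have q: "q \<ge> 0" using D.q_nonneg by (simp add: q_eq)
  note R = D.R' and S = D.S
  have mem: "?R v \<in> H" if "v \<in> H" for v using that by (rule pos_op_mem[OF R])
  have sq_le_S: "sq v \<le> ip (D.S v) v" if "v \<in> H" for v
    using that D.S_form[OF that] l ip_nonneg[OF that] by simp
  have S_scale: "ip (D.S (c *\<^sub>R v)) (c *\<^sub>R v) = c\<^sup>2 * ip (D.S v) v" if "v \<in> H" for c v
    using that by (simp add: pos_op_scale[OF S] ip_linear pos_op_mem[OF S] power2_eq_square)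
  have l4: "l ^ 4 = l ^ 3 * l" "l ^ 6 = l ^ 5 * l" by (simp_all add: eval_nat_numeral)
  have powr_l: "l ^ k * l powr e = l powr (real k + e)" for k e
    using l by (simp add: powr_add powr_realpow)
  have third: "0 \<le> 32 * C * l ^ 3 * (q + q ^ 3)" using C l q by simp
  have RRS: "l * ip (D.S (?R (?R (D.S h)))) (?R (?R (D.S h))) \<le> 16 * (1 + q ^ 3) * ip h h" if h: "h \<in> H" for h
  proof -
    have "4 * (1 + q) ^ 3 * ip h h \<le> 16 * (1 + q ^ 3) * ip h h"
      using one_plus_cube_le[OF q] ip_nonneg[OF h] by (intro mult_right_mono) auto
    then show ?thesis using D.R'_R'_S_bound[OF h] by (simp add: q_eq)
  qed
  consider (low) "\<forall>l>0. \<exists>h\<in>H. f = l *\<^sub>R h + L h \<and> ip h h \<le> l powr (2 * r - 3) * C"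
    | (high) "\<exists>g\<in>H. f = L g \<and> ip g g \<le> C \<and>
       (\<forall>l>0. \<exists>h\<in>H. g = l *\<^sub>R h + L h \<and> ip h h \<le> l powr (2 * r - 5) * C \<and> ip (L h) h \<le> l powr (2 * r - 4) * C)"
    using src unfolding source_def by blast
  then show ?thesis
  proof cases
    case low
    then obtain h where h: "h \<in> H" "f = D.S h" "ip h h \<le> l powr (2 * r - 3) * C"
      using l unfolding D.S_def by blast
    define v where "v = ?R (?R (D.S h))"
    have v: "v \<in> H" using h pos_op_mem[OF S] by (simp add: v_def mem)
    have "bias l I z f = l\<^sup>2 *\<^sub>R v" by (simp add: bias_def RE_def v_def h(2))
    then have "sq (bias l I z f) \<le> (l\<^sup>2)\<^sup>2 * ip (D.S v) v"
      using sq_le_S[of "l\<^sup>2 *\<^sub>R v"] S_scale[OF v, of "l\<^sup>2"] v by simp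
    also have "\<dots> = l ^ 3 * (l * ip (D.S v) v)" by (simp add: eval_nat_numeral)
    also have "\<dots> \<le> l ^ 3 * (16 * (1 + q ^ 3) * ip h h)"
      using RRS[OF h(1)] l by (intro mult_left_mono) (auto simp: v_def)
    also have "\<dots> \<le> l ^ 3 * (16 * (1 + q ^ 3) * (l powr (2 * r - 3) * C))"
      using h(3) l q by (intro mult_left_mono) auto
    also have "\<dots> = 16 * C * (l ^ 3 * l powr (2 * r - 3)) * (1 + q ^ 3)" by (simp add: algebra_simps)
    also have "l ^ 3 * l powr (2 * r - 3) = l powr (2 * r)" by (simp add: powr_l)
    also have "16 * C * l powr (2 * r) * (1 + q ^ 3) \<le> 160 * C * l powr (2 * r) * (1 + q ^ 3)"
      using C q by (intro mult_right_mono) auto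
    finally show ?thesis using third by simp
  next
    case high
    then obtain g where g: "g \<in> H" "f = L g" "ip g g \<le> C"
      and gh: "\<forall>l>0. \<exists>h\<in>H. g = l *\<^sub>R h + L h \<and> ip h h \<le> l powr (2 * r - 5) * C \<and> ip (L h) h \<le> l powr (2 * r - 4) * C"
      by blast
    from gh l obtain h where h: "h \<in> H" "g = D.S h" "ip h h \<le> l powr (2 * r - 5) * C"
      "ip (L h) h \<le> l powr (2 * r - 4) * C"
      unfolding D.S_def by blast
    define y where "y = L g - empirical_op K I z g"
    define v1 where "v1 = ?R g"
    define v2 where "v2 = ?R (?R y)"
    define v3 where "v3 = ?R (?R g)"
    have y: "y \<in> H" using g by (simp add: y_def H_L2 L_mem empirical_op_mem)
    have v: "v1 \<in> H" "v2 \<in> H" "v3 \<in> H" using g y by (auto simp: v1_def v2_def v3_def mem)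
    have "f = (l *\<^sub>R g + empirical_op K I z g) + y + (- l) *\<^sub>R g" by (simp add: y_def g(2))
    then have "?R f = ?R (l *\<^sub>R g + empirical_op K I z g) + ?R y + (- l) *\<^sub>R ?R g"
      using g(1) y by (simp only: pos_op_add[OF R] pos_op_scale[OF R] H_add H_scale empirical_op_mem)
    also have "?R (l *\<^sub>R g + empirical_op K I z g) = g" by (rule resolvent_left[OF D.T'p l g(1)])
    finally have RR: "?R (?R f) = v1 + v2 + (- l) *\<^sub>R v3"
      using g(1) y mem by (simp only: pos_op_add[OF R] pos_op_scale[OF R] H_add H_scale v1_def v2_def v3_def)
    have "bias l I z f = (l\<^sup>2 *\<^sub>R v1 + l\<^sup>2 *\<^sub>R v2) + (- (l ^ 3)) *\<^sub>R v3"
      unfolding bias_def RE_def RR by (simp add: algebra_simps eval_nat_numeral)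
    then have "sq (bias l I z f) \<le> ip (D.S ((l\<^sup>2 *\<^sub>R v1 + l\<^sup>2 *\<^sub>R v2) + (- (l ^ 3)) *\<^sub>R v3))
        ((l\<^sup>2 *\<^sub>R v1 + l\<^sup>2 *\<^sub>R v2) + (- (l ^ 3)) *\<^sub>R v3)"
      using sq_le_S v by (simp only: H_add H_scale)
    also have "\<dots> \<le> 2 * ip (D.S (l\<^sup>2 *\<^sub>R v1 + l\<^sup>2 *\<^sub>R v2)) (l\<^sup>2 *\<^sub>R v1 + l\<^sup>2 *\<^sub>R v2)
        + 2 * ip (D.S ((- (l ^ 3)) *\<^sub>R v3)) ((- (l ^ 3)) *\<^sub>R v3)"
      by (rule pos_op_quadratic_add_le[OF S]) (use v in auto)
    also have "ip (D.S (l\<^sup>2 *\<^sub>R v1 + l\<^sup>2 *\<^sub>R v2)) (l\<^sup>2 *\<^sub>R v1 + l\<^sup>2 *\<^sub>R v2)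
        \<le> 2 * ip (D.S (l\<^sup>2 *\<^sub>R v1)) (l\<^sup>2 *\<^sub>R v1) + 2 * ip (D.S (l\<^sup>2 *\<^sub>R v2)) (l\<^sup>2 *\<^sub>R v2)"
      by (rule pos_op_quadratic_add_le[OF S]) (use v in auto)
    finally have *: "sq (bias l I z f) \<le> 2 * (2 * ip (D.S (l\<^sup>2 *\<^sub>R v1)) (l\<^sup>2 *\<^sub>R v1)
        + 2 * ip (D.S (l\<^sup>2 *\<^sub>R v2)) (l\<^sup>2 *\<^sub>R v2))
        + 2 * ip (D.S ((- (l ^ 3)) *\<^sub>R v3)) ((- (l ^ 3)) *\<^sub>R v3)" by simp
    have "sq (bias l I z f) \<le> 4 * (l ^ 4 * ip (D.S v1) v1) + 4 * (l ^ 4 * ip (D.S v2) v2)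
        + 2 * (l ^ 6 * ip (D.S v3) v3)"
      using *[unfolded S_scale[OF v(1)] S_scale[OF v(2)] S_scale[OF v(3)]] by simp
    also have "l ^ 4 * ip (D.S v1) v1 \<le> 32 * C * l powr (2 * r) * (1 + q ^ 3)"
    proof -
      \<comment> \<open>Both bounds on h in the source condition enter, as the form of S is l (h, h)
        + (L h, h).\<close>
      have Sh: "ip (D.S h) h \<le> 2 * (l powr (2 * r - 4) * C)"
      proof -
        have "l * ip h h \<le> l * (l powr (2 * r - 5) * C)" using h(3) l by (intro mult_left_mono) auto
        also have "\<dots> = l ^ 1 * l powr (2 * r - 5) * C" by simp
        also have "\<dots> = l powr (2 * r - 4) * C" unfolding powr_l by simp
        finally show ?thesis using h(4) D.S_form[OF h(1)] by simp
      qed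
      have "ip (D.S v1) v1 \<le> (2 + q)\<^sup>2 * ip (D.S h) h"
        using D.R'_S_bound[OF h(1)] by (simp add: v1_def h(2) q_eq)
      also have "\<dots> \<le> (16 * (1 + q ^ 3)) * (2 * (l powr (2 * r - 4) * C))"
        using two_plus_square_le[OF q] Sh q pos_op_nonneg[OF S h(1)] by (intro mult_mono) auto
      finally have "l ^ 4 * ip (D.S v1) v1 \<le> l ^ 4 * ((16 * (1 + q ^ 3)) * (2 * (l powr (2 * r - 4) * C)))"
        using l by (intro mult_left_mono) auto
      also have "\<dots> = 32 * C * (l ^ 4 * l powr (2 * r - 4)) * (1 + q ^ 3)" by (simp add: algebra_simps)
      also have "l ^ 4 * l powr (2 * r - 4) = l powr (2 * r)" by (simp add: powr_l)
      finally show ?thesis .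
    qed
    also have "l ^ 4 * ip (D.S v2) v2 \<le> 8 * C * l ^ 3 * (q + q ^ 3)"
    proof -
      have "l * ip (D.S v2) v2 \<le> (2 + q)\<^sup>2 * q * ip g g"
        using D.R'_R'_diff_bound[OF g(1)] by (simp add: v2_def y_def q_eq)
      also have "\<dots> \<le> (8 * (q + q ^ 3)) * C"
        by (rule mult_mono[OF two_plus_square_times_le[OF q] g(3)])
          (use q ip_nonneg[OF g(1)] in simp_all)
      finally have "l ^ 3 * (l * ip (D.S v2) v2) \<le> l ^ 3 * ((8 * (q + q ^ 3)) * C)"
        using l by (intro mult_left_mono) auto
      then show ?thesis by (simp add: l4 algebra_simps)
    qed
    also have "l ^ 6 * ip (D.S v3) v3 \<le> 16 * C * l powr (2 * r) * (1 + q ^ 3)"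
    proof -
      have "l ^ 6 * ip (D.S v3) v3 = l ^ 5 * (l * ip (D.S v3) v3)" by (simp add: l4)
      also have "\<dots> \<le> l ^ 5 * (16 * (1 + q ^ 3) * (l powr (2 * r - 5) * C))"
      proof (rule mult_left_mono)
        have "l * ip (D.S v3) v3 \<le> 16 * (1 + q ^ 3) * ip h h" using RRS[OF h(1)] by (simp add: v3_def h(2))
        also have "\<dots> \<le> 16 * (1 + q ^ 3) * (l powr (2 * r - 5) * C)"
          using h(3) q by (intro mult_left_mono) auto
        finally show "l * ip (D.S v3) v3 \<le> 16 * (1 + q ^ 3) * (l powr (2 * r - 5) * C)" .
      qed (use l in simp)
      also have "\<dots> = 16 * C * (l ^ 5 * l powr (2 * r - 5)) * (1 + q ^ 3)" by (simp add: algebra_simps)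
      also have "l ^ 5 * l powr (2 * r - 5) = l powr (2 * r)" by (simp add: powr_l)
      finally show ?thesis .
    qed
    finally show ?thesis by (simp add: algebra_simps)
  qed
qed

section \<open>The filter of one block and its trace\<close>

lemma GE_sym:
  assumes "l > 0" "f \<in> H" "g \<in> H"
  shows "ip (GE l I z f) g = ip f (GE l I z g)"
  using assms pos_op_sym[OF RE_pos_op[OF assms(1), of I z]] pos_op_mem[OF RE_pos_op[OF assms(1), of I z]]
  by (simp add: GE_def ip_linear)

lemma GE_mem: "l > 0 \<Longrightarrow> f \<in> H \<Longrightarrow> GE l I z f \<in> H"
  by (simp add: GE_def pos_op_mem[OF RE_pos_op])

lemma GE_pos_op:
  assumes l: "l > 0"
  shows "pos_op (GE l I z)"
proof -
  note R = RE_pos_op[OF l, of I z]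
  note m = pos_op_linear[OF R]
  have "GE l I z (f + g) = GE l I z f + GE l I z g" if "f \<in> H" "g \<in> H" for f g
    using that by (simp add: GE_def m algebra_simps)
  moreover have "GE l I z (c *\<^sub>R f) = c *\<^sub>R GE l I z f" if "f \<in> H" for c f
    using that by (simp add: GE_def m algebra_simps)
  moreover have "ip (GE l I z f) f \<ge> 0" if f: "f \<in> H" for f
  proof -
    have "ip (RE l I z (RE l I z f)) f = ip (RE l I z f) (RE l I z f)"
      using pos_op_sym[OF R m(1)[OF f] f] .
    then show ?thesis
      using f l pos_op_nonneg[OF R f] ip_nonneg[OF m(1)[OF f]] by (simp add: GE_def ip_linear m)
  qed
  ultimately show ?thesis
    unfolding pos_op_def using GE_mem[OF l] GE_sym[OF l] by (intro conjI ballI allI) auto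
qed

text \<open>A crude bound, used to keep the noise weights bounded and hence the noise integrable; it
  does not enter the rate.\<close>

lemma GE_norm_le:
  assumes l: "l > 0" and f: "f \<in> H"
  shows "ip (GE l I z f) (GE l I z f) \<le> 4 / l\<^sup>2 * ip f f"
proof -
  note m = pos_op_mem[OF RE_pos_op[OF l, of I z]]
  let ?f = "RE l I z f"
  have "ip (GE l I z f) (GE l I z f) \<le> 2 * ip ?f ?f + 2 * ip (l *\<^sub>R RE l I z ?f) (l *\<^sub>R RE l I z ?f)"
    unfolding GE_def using f m by (intro ip_add_self_le) auto
  also have "ip (l *\<^sub>R RE l I z ?f) (l *\<^sub>R RE l I z ?f) = l\<^sup>2 * ip (RE l I z ?f) (RE l I z ?f)"
    using f m by (simp add: ip_linear power2_eq_square)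
  also have "2 * ip ?f ?f + 2 * (l\<^sup>2 * ip (RE l I z ?f) (RE l I z ?f)) \<le> 4 * ip ?f ?f"
    using RE_norm_le[OF l m[OF f]] by simp
  also have "\<dots> \<le> 4 * (ip f f / l\<^sup>2)" using RE_norm_le[OF l f] l by (simp add: field_simps)
  finally show ?thesis by simp
qed

text \<open>Symmetry gives G(K_{x_i})(x) = G(K_x)(x_i). The sum over the sample of squared values at
  x is therefore n times the empirical form of G K_x, which \<open>G_form_le\<close> bounds by the
  diagonal of the resolvent kernel. Integrating over x yields the effective dimension.\<close>

lemma GE_trace_le:
  assumes l: "0 < l" and I: "finite I" "I \<noteq> {}"
  shows "(\<Sum>i\<in>I. sq (GE l I z (K (fst (z i))))) \<le> real (card I) * (4 * (2 + Q2 l I z / l)) * edim l"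
proof -
  interpret D: two_resolvents K H ip L "empirical_op K I z" "\<kappa> ^ 4" "\<kappa> ^ 4" l "Q2 l I z"
    using l I by (rule two_resolvents_empirical)
  define G where "G = GE l I z"
  have G_D: "G f = D.G f" for f by (simp add: G_def GE_def RE_def D.G_def)
  have mem: "G f \<in> H" if "f \<in> H" for f using that l by (simp add: G_def GE_mem)
  have n: "real (card I) > 0" using I by (simp add: card_gt_0_iff)
  have int: "integrable mu (\<lambda>x. (G (K y) x)\<^sup>2)" for y
    using H_L2[OF mem[OF H_kernel]] by (simp add: L2_def)
  have "(\<Sum>i\<in>I. sq (G (K (fst (z i))))) = (\<integral>x. (\<Sum>i\<in>I. (G (K (fst (z i))) x)\<^sup>2) \<partial>mu)"
    using mem int by (simp add: ip_L_self Bochner_Integration.integral_sum)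
  also have "\<dots> \<le> (\<integral>x. real (card I) * (4 * (2 + D.q)) * R l (K x) x \<partial>mu)"
  proof (rule integral_mono)
    show "integrable mu (\<lambda>x. \<Sum>i\<in>I. (G (K (fst (z i))) x)\<^sup>2)"
      using int by (intro Bochner_Integration.integrable_sum)
    show "integrable mu (\<lambda>x. real (card I) * (4 * (2 + D.q)) * R l (K x) x)"
      using R_kernel_integrable[OF l] by simp
    fix x
    have "G (K y) x = G (K x) y" for y
      using GE_sym[OF l H_kernel H_kernel, of I z y x] mem[OF H_kernel]
      by (simp add: G_def reproducing reproducing')
    then have "(\<Sum>i\<in>I. (G (K (fst (z i))) x)\<^sup>2) = real (card I) * ip (empirical_op K I z (G (K x))) (G (K x))"
      using n mem[OF H_kernel] by (simp add: ip_empirical_op power2_eq_square)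
    also have "\<dots> \<le> real (card I) * (4 * (2 + D.q) * ip (R l (K x)) (K x))"
      using D.G_form_le[OF H_kernel[of x]] n by (intro mult_left_mono) (auto simp: G_D)
    also have "\<dots> = real (card I) * (4 * (2 + D.q)) * R l (K x) x"
      using R_kernel_diag[OF l] by simp
    finally show "(\<Sum>i\<in>I. (G (K (fst (z i))) x)\<^sup>2) \<le> real (card I) * (4 * (2 + D.q)) * R l (K x) x" .
  qed
  also have "\<dots> = real (card I) * (4 * (2 + D.q)) * edim l" by (simp add: effective_dim_eq[OF l])
  finally show ?thesis by (simp add: G_def D.q_def)
qed

section \<open>The complexity measures\<close>

lemma edim_nonneg: "l > 0 \<Longrightarrow> edim l \<ge> 0"
  using R_kernel_diag_bounds(1) by (simp add: effective_dim_eq)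

context
  fixes n :: nat and l :: real
  assumes n: "n > 0" and l: "l > 0"
begin

lemma Bc_nonneg: "Bc n l \<ge> 0"
  unfolding B_complexity_def using kappa_ge_1 l edim_nonneg[OF l] by simp

lemma Bc_square: "(Bc n l)\<^sup>2 = 4 * \<kappa>\<^sup>2 / n * (\<kappa> / sqrt (n * l) + sqrt (edim l))\<^sup>2"
  unfolding B_complexity_def using n by (simp add: power_mult_distrib power_divide)

text \<open>For a, b >= 0 the square (a + b)^2 lies between a^2 + b^2 and twice that, so B^2 is
  comparable to this expression, the form in which the moment bounds arrive. The next lemma is the
  other half.\<close>

lemma Bc_square_lower: "4 * \<kappa>\<^sup>2 / n * (\<kappa>\<^sup>2 / (n * l) + edim l) \<le> (Bc n l)\<^sup>2"
proof -
  have "\<kappa>\<^sup>2 / (n * l) + edim l = (\<kappa> / sqrt (n * l))\<^sup>2 + (sqrt (edim l))\<^sup>2"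
    using n l edim_nonneg[OF l] by (simp add: power_divide)
  also have "\<dots> \<le> (\<kappa> / sqrt (n * l) + sqrt (edim l))\<^sup>2"
    using kappa_ge_1 n l edim_nonneg[OF l] by (simp add: power2_sum)
  finally show ?thesis unfolding Bc_square using n by (intro mult_left_mono) auto
qed

lemma Bc_square_upper: "(Bc n l)\<^sup>2 \<le> 8 * \<kappa>\<^sup>2 / n * (\<kappa>\<^sup>2 / (n * l) + edim l)"
proof -
  have "(a + b)\<^sup>2 \<le> 2 * (a\<^sup>2 + b\<^sup>2)" for a b :: real
    using zero_le_power2[of "a - b"] by (simp add: power2_sum power2_diff)
  then have "(\<kappa> / sqrt (n * l) + sqrt (edim l))\<^sup>2 \<le> 2 * ((\<kappa> / sqrt (n * l))\<^sup>2 + (sqrt (edim l))\<^sup>2)" .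
  also have "\<dots> = 2 * (\<kappa>\<^sup>2 / (n * l) + edim l)"
    using n l edim_nonneg[OF l] by (simp add: power_divide)
  finally have "4 * \<kappa>\<^sup>2 / n * (\<kappa> / sqrt (n * l) + sqrt (edim l))\<^sup>2 \<le> 4 * \<kappa>\<^sup>2 / n * (2 * (\<kappa>\<^sup>2 / (n * l) + edim l))"
    using n by (intro mult_left_mono) auto
  also have "\<dots> = 8 * \<kappa>\<^sup>2 / n * (\<kappa>\<^sup>2 / (n * l) + edim l)" by simp
  finally show ?thesis unfolding Bc_square .
qed

lemma Bc_ratio_lower: "2 * \<kappa>\<^sup>2 / (n * l) \<le> Bc n l / sqrt l"
proof -
  have "2 * \<kappa> / sqrt n * (\<kappa> / sqrt (n * l)) \<le> Bc n l"
    unfolding B_complexity_def using kappa_ge_1 edim_nonneg[OF l] by (intro mult_left_mono) auto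
  then have "2 * \<kappa> / sqrt n * (\<kappa> / sqrt (n * l)) / sqrt l \<le> Bc n l / sqrt l"
    using l by (intro divide_right_mono) auto
  moreover have "2 * \<kappa> / sqrt n * (\<kappa> / sqrt (n * l)) / sqrt l = 2 * \<kappa>\<^sup>2 / (n * l)"
    using n l by (simp add: real_sqrt_mult power2_eq_square field_simps)
  ultimately show ?thesis by simp
qed

lemma edim_div_le_Bc_square: "edim l / n \<le> (Bc n l)\<^sup>2"
proof -
  have "\<kappa>\<^sup>2 \<ge> 1" using kappa_ge_1 by simp
  then have "1 * (edim l / n) \<le> (4 * \<kappa>\<^sup>2) * (edim l / n)"
    using edim_nonneg[OF l] by (intro mult_right_mono) auto
  also have "\<dots> \<le> 4 * \<kappa>\<^sup>2 / n * (\<kappa>\<^sup>2 / (n * l) + edim l)"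
    using l by (simp add: distrib_left)
  also have "\<dots> \<le> (Bc n l)\<^sup>2" by (rule Bc_square_lower)
  finally show ?thesis by simp
qed

end

section \<open>The trace of L against the effective dimension\<close>

definition trace :: real where
  "trace = (\<integral>x. K x x \<partial>mu)"

lemma K_diag_integrable: "integrable mu (\<lambda>x. K x x)"
proof (rule mu.integrable_const_bound[of _ "\<kappa>\<^sup>2"])
  show "(\<lambda>x. K x x) \<in> borel_measurable mu"
    unfolding borel_measurable_mu by (intro borel_measurable_continuous_onI continuous_intros)
qed (simp add: K_diag_nonneg K_diag_le)

lemma trace_nonneg: "trace \<ge> 0"
  using K_diag_nonneg by (simp add: trace_def)

text \<open>Serves the degenerate case: if the trace is zero, every member of \<open>H\<close>
  vanishes in L2.\<close>

lemma sq_le_trace: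
  assumes f: "f \<in> H"
  shows "sq f \<le> trace * ip f f"
proof -
  have "(\<integral>x. (f x)\<^sup>2 \<partial>mu) \<le> (\<integral>x. K x x * ip f f \<partial>mu)"
  proof (rule integral_mono)
    show "integrable mu (\<lambda>x. (f x)\<^sup>2)" using H_L2[OF f] by (simp add: L2_def)
    show "integrable mu (\<lambda>x. K x x * ip f f)" using K_diag_integrable by simp
    show "(f x)\<^sup>2 \<le> K x x * ip f f" for x
      using Cauchy_Schwarz[OF f H_kernel[of x]] f by (simp add: reproducing ip_kernel mult.commute)
  qed
  then show ?thesis using ip_L_self[OF f] by (simp add: trace_def)
qed

text \<open>Cauchy-Schwarz for the form of S = l + L at R K_x and K_x gives (K x x)^2 <= R(K_x)(x)
  (S K_x, K_x). For l <= 1 the last factor is at most (kappa^2 + 1) K x x; cancel K x x and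
  integrate.\<close>

lemma trace_le_edim:
  assumes l: "0 < l" "l \<le> 1"
  shows "trace \<le> (\<kappa>\<^sup>2 + 1) * edim l"
proof -
  have S: "pos_op (\<lambda>f. l *\<^sub>R f + L f)" using pos_op_shift[OF L_pos_op] l by simp
  have R: "R l (K x) \<in> H" for x by (simp add: pos_op_mem[OF R_pos_op[OF l(1)]])
  have le: "K x x \<le> (\<kappa>\<^sup>2 + 1) * R l (K x) x" for x
  proof -
    have LK: "L (K x) \<in> H" by (simp add: pos_op_mem[OF L_pos_op])
    have eq: "l *\<^sub>R R l (K x) + L (R l (K x)) = K x"
      by (rule resolvent_limit(2)[OF L_pos_bdd l(1) H_kernel])
    have "(K x x)\<^sup>2 = (ip (l *\<^sub>R R l (K x) + L (R l (K x))) (K x))\<^sup>2" unfolding eq by (simp add: ip_kernel)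
    also have "\<dots> \<le> ip (l *\<^sub>R R l (K x) + L (R l (K x))) (R l (K x)) * ip (l *\<^sub>R K x + L (K x)) (K x)"
      by (rule pos_op_Cauchy_Schwarz[OF S R H_kernel])
    also have "ip (l *\<^sub>R R l (K x) + L (R l (K x))) (R l (K x)) = R l (K x) x"
      unfolding eq using R by (simp add: reproducing')
    also have "ip (l *\<^sub>R K x + L (K x)) (K x) = l * K x x + ip (L (K x)) (K x)"
      using LK by (simp only: ip_linear H_scale H_kernel ip_kernel)
    also have "R l (K x) x * (l * K x x + ip (L (K x)) (K x)) \<le> R l (K x) x * ((\<kappa>\<^sup>2 + 1) * K x x)"
    proof (rule mult_left_mono)
      have "l * K x x \<le> 1 * K x x" using l K_diag_nonneg by (intro mult_right_mono) auto
      then show "l * K x x + ip (L (K x)) (K x) \<le> (\<kappa>\<^sup>2 + 1) * K x x"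
        using sq_le[OF H_kernel, of x] by (simp add: ip_kernel algebra_simps)
    qed (rule R_kernel_diag_bounds(1)[OF l(1)])
    finally have "(K x x)\<^sup>2 \<le> ((\<kappa>\<^sup>2 + 1) * R l (K x) x) * K x x" by (simp add: algebra_simps)
    then show ?thesis
      by (rule le_if_square_le_mult[OF K_diag_nonneg, rotated])
        (use R_kernel_diag_bounds(1)[OF l(1), of x] in simp)
  qed
  have "trace \<le> (\<integral>x. (\<kappa>\<^sup>2 + 1) * R l (K x) x \<partial>mu)"
    unfolding trace_def using K_diag_integrable R_kernel_integrable[OF l(1)] le by (intro integral_mono) auto
  then show ?thesis by (simp add: effective_dim_eq[OF l(1)])
qed

text \<open>Trades B^2 for N(l)/n. The summand of B^2 without N(l) is kappa^2/(n l), which is at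
  most B / (2 sqrt l); the trace in front supplies the missing N(l) through
  \<open>trace_le_edim\<close>.\<close>

lemma trace_times_Bc_square_le:
  assumes n: "n > 0" and l: "0 < l" "l \<le> 1"
  shows "trace * (Bc n l)\<^sup>2 \<le> 16 * \<kappa> ^ 4 * (edim l / n) * (1 + Bc n l / sqrt l)"
proof -
  define \<beta> where "\<beta> = Bc n l / sqrt l"
  have \<beta>: "\<beta> \<ge> 0" using Bc_nonneg[OF n l(1)] l(1) by (simp add: \<beta>_def)
  have \<kappa>: "\<kappa>\<^sup>2 \<ge> 1" using kappa_ge_1 by simp
  have N: "edim l \<ge> 0" by (rule edim_nonneg[OF l(1)])
  have t1: "trace * (\<kappa>\<^sup>2 / (n * l)) \<le> ((2 * \<kappa>\<^sup>2) * edim l) * (\<beta> / 2)"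
  proof (rule mult_mono)
    have "(\<kappa>\<^sup>2 + 1) * edim l \<le> (2 * \<kappa>\<^sup>2) * edim l" using \<kappa> N by (intro mult_right_mono) auto
    then show "trace \<le> (2 * \<kappa>\<^sup>2) * edim l" using trace_le_edim[OF l] by simp
    show "\<kappa>\<^sup>2 / (n * l) \<le> \<beta> / 2" using Bc_ratio_lower[OF n l(1)] by (simp add: \<beta>_def)
  qed (use N l in auto)
  have t2: "trace * edim l \<le> \<kappa>\<^sup>2 * edim l"
  proof (rule mult_right_mono[OF _ N])
    show "trace \<le> \<kappa>\<^sup>2" unfolding trace_def
      using K_diag_integrable K_diag_le by (intro mu.integral_le_const) auto
  qed
  have "trace * (Bc n l)\<^sup>2 \<le> trace * (8 * \<kappa>\<^sup>2 / n * (\<kappa>\<^sup>2 / (n * l) + edim l))"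
    by (intro mult_left_mono Bc_square_upper[OF n l(1)] trace_nonneg)
  also have "\<dots> = 8 * \<kappa>\<^sup>2 / n * (trace * (\<kappa>\<^sup>2 / (n * l)) + trace * edim l)" by (simp add: algebra_simps)
  also have "\<dots> \<le> 8 * \<kappa>\<^sup>2 / n * (((2 * \<kappa>\<^sup>2) * edim l) * (\<beta> / 2) + \<kappa>\<^sup>2 * edim l)"
    using t1 t2 by (intro mult_left_mono add_mono) auto
  also have "\<dots> = 8 * \<kappa> ^ 4 * (edim l / n) * (1 + \<beta>)"
    by (simp add: power4_eq_xxxx power2_eq_square field_simps)
  also have "\<dots> \<le> 16 * \<kappa> ^ 4 * (edim l / n) * (1 + \<beta>)"
    using \<beta> N kappa_ge_1 by (intro mult_right_mono) auto
  finally show ?thesis by (simp add: \<beta>_def)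
qed

end

section \<open>Expectations over the sample\<close>

lemma one_plus_power_le: "0 \<le> x \<Longrightarrow> k > 0 \<Longrightarrow> 1 + x ^ k \<le> (x + 1) ^ k" for x :: real
proof (induction k)
  case (Suc k)
  show ?case
  proof (cases "k = 0")
    case False
    have "1 + x ^ Suc k \<le> (x + 1) * (1 + x ^ k)" using Suc.prems by (simp add: algebra_simps)
    also have "\<dots> \<le> (x + 1) * (x + 1) ^ k"
      using Suc False by (intro mult_left_mono) auto
    finally show ?thesis by simp
  qed simp
qed simp

lemma double_sum_integral:
  fixes f :: "'i \<Rightarrow> 'j \<Rightarrow> 'x \<Rightarrow> real"
  assumes "\<And>i k. i \<in> A \<Longrightarrow> k \<in> B \<Longrightarrow> integrable M (f i k)"
  shows "(\<integral>x. (\<Sum>i\<in>A. \<Sum>k\<in>B. f i k x) \<partial>M) = (\<Sum>i\<in>A. \<Sum>k\<in>B. \<integral>x. f i k x \<partial>M)"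
proof -
  have "(\<integral>x. (\<Sum>i\<in>A. \<Sum>k\<in>B. f i k x) \<partial>M) = (\<Sum>i\<in>A. \<integral>x. (\<Sum>k\<in>B. f i k x) \<partial>M)"
    by (intro Bochner_Integration.integral_sum Bochner_Integration.integrable_sum assms)
  also have "\<dots> = (\<Sum>i\<in>A. \<Sum>k\<in>B. \<integral>x. f i k x \<partial>M)"
    by (intro sum.cong refl Bochner_Integration.integral_sum assms)
  finally show ?thesis .
qed

text \<open>\<open>f0\<close> is the representative of the regression function in \<open>H\<close>.
  The zero-mean condition is tested against bounded functions of the input, so that conditional
  expectations occur only where the locale is instantiated.\<close>

locale learning = mercer_rkhs K H ip "marginal rho"
  for K :: "'a::compact_metric_space \<Rightarrow> 'a \<Rightarrow> real" and H ip and rho :: "('a \<times> real) measure" +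
  fixes f0 :: "'a \<Rightarrow> real" and M :: real
  assumes rho: "prob_space rho" and sets_rho: "sets rho = sets borel" and f0: "f0 \<in> H"
    and y_bound: "AE p in rho. \<bar>snd p\<bar> \<le> M"
    and noise_centered: "\<And>g c. g \<in> borel_measurable borel \<Longrightarrow> (\<And>x. \<bar>g x\<bar> \<le> c) \<Longrightarrow>
      (\<integral>p. (snd p - f0 (fst p)) * g (fst p) \<partial>rho) = 0"

sublocale learning \<subseteq> rho: prob_space rho
  by (rule rho)

context learning
begin

abbreviation "mu \<equiv> marginal rho"

abbreviation PN :: "nat \<Rightarrow> (nat \<Rightarrow> 'a \<times> real) measure" where
  "PN N \<equiv> PiM {..<N} (\<lambda>_. rho)"

lemma prob_PN: "prob_space (PN N)"
  by (intro prob_space_PiM rho)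

lemma sets_rho_pair: "sets rho = sets (borel \<Otimes>\<^sub>M borel)"
  unfolding borel_prod by (rule sets_rho)

lemma fst_measurable [measurable]: "fst \<in> rho \<rightarrow>\<^sub>M borel"
  and snd_measurable [measurable]: "snd \<in> rho \<rightarrow>\<^sub>M borel"
  unfolding measurable_cong_sets[OF sets_rho_pair refl] by measurable

lemma integral_mu: "g \<in> borel_measurable borel \<Longrightarrow> (\<integral>x. g x \<partial>mu) = (\<integral>p. g (fst p) \<partial>rho)" for g :: "'a \<Rightarrow> real"
  unfolding marginal_def by (rule integral_distr) auto

lemma sample_point_measurable [measurable]: "i < N \<Longrightarrow> (\<lambda>z. z i) \<in> PN N \<rightarrow>\<^sub>M rho"
  by (rule measurable_component_singleton) simp

text \<open>The outputs are clipped so that the noise is bounded everywhere and not only almost surely.\<close>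

definition err :: "'a \<times> real \<Rightarrow> real" where
  "err p = (if \<bar>snd p\<bar> \<le> M then snd p else 0) - f0 (fst p)"

definition E0 :: real where
  "E0 = \<bar>M\<bar> + \<kappa> * sqrt (ip f0 f0)"

lemma err_measurable [measurable]: "err \<in> borel_measurable rho"
proof -
  have [measurable]: "f0 \<in> borel_measurable borel" by (rule H_measurable[OF f0])
  show ?thesis unfolding err_def by measurable
qed

lemma err_bound: "\<bar>err p\<bar> \<le> E0"
proof -
  have "\<bar>f0 (fst p)\<bar> \<le> \<kappa> * sqrt (ip f0 f0)" by (rule H_abs_eval_le[OF f0])
  then show ?thesis by (auto simp: err_def E0_def abs_if split: if_splits)
qed

lemma E0_nonneg: "E0 \<ge> 0"
  using err_bound[of undefined] by linarith

lemma err_AE: "AE p in rho. err p = snd p - f0 (fst p)"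
  using y_bound by eventually_elim (simp add: err_def)

lemma err_centered:
  assumes g: "g \<in> borel_measurable borel" "\<And>x. \<bar>g x\<bar> \<le> c"
  shows "(\<integral>p. err p * g (fst p) \<partial>rho) = 0"
proof -
  have [measurable]: "f0 \<in> borel_measurable borel" "g \<in> borel_measurable borel"
    by (rule H_measurable[OF f0], rule g(1))
  have "(\<integral>p. err p * g (fst p) \<partial>rho) = (\<integral>p. (snd p - f0 (fst p)) * g (fst p) \<partial>rho)"
    using err_AE by (intro integral_cong_AE) (measurable, auto elim: eventually_mono)
  then show ?thesis using noise_centered[OF g] by simp
qed

lemma joint_eval_measurable:
  assumes "(\<lambda>p. G (fst p) (snd p)) \<in> borel_measurable (PN N \<Otimes>\<^sub>M borel)" "i < N"
  shows "(\<lambda>p. G (fst p) (fst (fst p i))) \<in> borel_measurable (PN N \<Otimes>\<^sub>M borel)"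
proof -
  have "(\<lambda>p. (fst p, fst (fst p i))) \<in> PN N \<Otimes>\<^sub>M borel \<rightarrow>\<^sub>M PN N \<Otimes>\<^sub>M borel"
    using assms(2) by measurable
  from measurable_compose[OF this assms(1)] show ?thesis by simp
qed

lemma kernel_section_measurable:
  assumes "i < N"
  shows "(\<lambda>p. K (fst (fst p i)) (snd p)) \<in> borel_measurable (PN N \<Otimes>\<^sub>M borel)"
proof -
  have "(\<lambda>p. (fst (fst p i), snd p)) \<in> PN N \<Otimes>\<^sub>M borel \<rightarrow>\<^sub>M borel \<Otimes>\<^sub>M borel"
    using assms by measurable
  from measurable_compose[OF this K_measurable_borel] show ?thesis by simp
qed

text \<open>Measurability is joint in sample and evaluation point, because squared L2 norms are
  integrals over the evaluation point that must be measurable in the sample.\<close>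

lemma RE_measurable:
  assumes l: "l > 0" and I: "I \<subseteq> {..<N}" and F: "\<And>z. F z \<in> H"
    "(\<lambda>p. F (fst p) (snd p)) \<in> borel_measurable (PN N \<Otimes>\<^sub>M borel)"
  shows "(\<lambda>p. RE l I (fst p) (F (fst p)) (snd p)) \<in> borel_measurable (PN N \<Otimes>\<^sub>M borel)"
  unfolding RE_def
proof (rule resolvent_measurable[OF empirical_op_pos_bdd l F])
  fix G :: "(nat \<Rightarrow> 'a \<times> real) \<Rightarrow> 'a \<Rightarrow> real"
  assume G: "(\<lambda>p. G (fst p) (snd p)) \<in> borel_measurable (PN N \<Otimes>\<^sub>M borel)"
  have "(\<lambda>p. G (fst p) (fst (fst p i)) * K (fst (fst p i)) (snd p)) \<in> borel_measurable (PN N \<Otimes>\<^sub>M borel)"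
    if "i \<in> I" for i
    using joint_eval_measurable[OF G, of i] kernel_section_measurable[of i N] that I
    by (intro borel_measurable_times) auto
  then show "(\<lambda>p. empirical_op K I (fst p) (G (fst p)) (snd p)) \<in> borel_measurable (PN N \<Otimes>\<^sub>M borel)"
    unfolding empirical_op_def sampling_adj_def sampling_op_def
    by (intro borel_measurable_times[OF borel_measurable_const] borel_measurable_sum)
qed

lemma GE_measurable:
  assumes l: "l > 0" and I: "I \<subseteq> {..<N}" and F: "\<And>z. F z \<in> H"
    "(\<lambda>p. F (fst p) (snd p)) \<in> borel_measurable (PN N \<Otimes>\<^sub>M borel)"
  shows "(\<lambda>p. GE l I (fst p) (F (fst p)) (snd p)) \<in> borel_measurable (PN N \<Otimes>\<^sub>M borel)"
proof -
  note R = RE_measurable[OF l I]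
  note 1 = R[OF F]
  have 2: "(\<lambda>p. RE l I (fst p) (RE l I (fst p) (F (fst p))) (snd p)) \<in> borel_measurable (PN N \<Otimes>\<^sub>M borel)"
    by (rule R[where F = "\<lambda>z. RE l I z (F z)", OF _ 1]) (rule pos_op_mem[OF RE_pos_op[OF l] F(1)])
  show ?thesis unfolding GE_def fun_apply using 1 2 by simp
qed

lemma inner_measurable:
  fixes F G :: "(nat \<Rightarrow> 'a \<times> real) \<Rightarrow> 'a \<Rightarrow> real"
  assumes F: "(\<lambda>p. F (fst p) (snd p)) \<in> borel_measurable (PN N \<Otimes>\<^sub>M borel)"
    and G: "(\<lambda>p. G (fst p) (snd p)) \<in> borel_measurable (PN N \<Otimes>\<^sub>M borel)"
  shows "(\<lambda>z. \<integral>x. F z x * G z x \<partial>mu) \<in> borel_measurable (PN N)"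
proof (rule mu.borel_measurable_lebesgue_integral)
  have eq: "sets (PN N \<Otimes>\<^sub>M mu) = sets (PN N \<Otimes>\<^sub>M borel)"
    by (rule sets_pair_measure_cong[OF refl sets_mu])
  show "(\<lambda>(z, x). F z x * G z x) \<in> borel_measurable (PN N \<Otimes>\<^sub>M mu)"
    unfolding measurable_cong_sets[OF eq refl] case_prod_beta by (intro borel_measurable_times F G)
qed

lemma sq_measurable:
  assumes "\<And>z. F z \<in> H" "(\<lambda>p. F (fst p) (snd p)) \<in> borel_measurable (PN N \<Otimes>\<^sub>M borel)"
  shows "(\<lambda>z. sq (F z)) \<in> borel_measurable (PN N)"
  using inner_measurable[OF assms(2) assms(2)] by (simp add: ip_L_self[OF assms(1)] power2_eq_square)

subsection \<open>Moments of the perturbation\<close>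

lemma centered_kernel_kk:
  assumes l: "0 < l" "l \<le> 1"
  shows "centered_kernel rho (\<lambda>p q. kk l (fst p) (fst q)) (2 * \<kappa> ^ 4 / l) (\<kappa>\<^sup>2 * edim l)"
proof
  have "(\<lambda>p. (fst (fst p), fst (snd p))) \<in> rho \<Otimes>\<^sub>M rho \<rightarrow>\<^sub>M borel \<Otimes>\<^sub>M borel" by measurable
  from measurable_compose[OF this kk_measurable[OF l(1)]]
  show "(\<lambda>p. kk l (fst (fst p)) (fst (snd p))) \<in> borel_measurable (rho \<Otimes>\<^sub>M rho)" by simp
  show "kk l (fst x) (fst y) = kk l (fst y) (fst x)" for x y :: "'a \<times> real" by (rule kk_sym[OF l(1)])
  show "0 \<le> (\<Sum>i\<in>I. \<Sum>j\<in>I. kk l (fst (w i)) (fst (w j)))" for I :: "nat set" and w :: "nat \<Rightarrow> 'a \<times> real"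
    by (rule kk_sum_nonneg[OF l(1)])
  show "(\<Sum>i\<in>I. kk l (fst (w i)) (fst y))\<^sup>2
      \<le> (\<Sum>i\<in>I. \<Sum>j\<in>I. kk l (fst (w i)) (fst (w j))) * kk l (fst y) (fst y)"
    for I :: "nat set" and w :: "nat \<Rightarrow> 'a \<times> real" and y :: "'a \<times> real"
    by (rule kk_Cauchy_Schwarz[OF l(1)])
  show "kk l (fst x) (fst x) \<le> 2 * \<kappa> ^ 4 / l" for x :: "'a \<times> real" by (rule kk_diag_le[OF l])
  have row: "kk l x \<in> borel_measurable borel" for x
    using measurable_compose[OF measurable_Pair1'[of x borel borel] kk_measurable[OF l(1)]] by simp
  show "(\<integral>y. kk l (fst x) (fst y) \<partial>rho) = 0" for x :: "'a \<times> real"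
    using kk_integral[OF l(1), of "fst x"] integral_mu[OF row] by simp
  have "(\<lambda>x. (x, x)) \<in> borel \<rightarrow>\<^sub>M borel \<Otimes>\<^sub>M borel" by measurable
  from measurable_compose[OF this kk_measurable[OF l(1)]]
  have "(\<lambda>x. kk l x x) \<in> borel_measurable borel" by simp
  then show "(\<integral>x. kk l (fst x) (fst x) \<partial>rho) \<le> \<kappa>\<^sup>2 * edim l"
    using kk_diag_integral_le[OF l(1)] integral_mu by simp
qed

text \<open>2560 = 160 * 16 and 512 = 32 * 16 combine the pointwise bias constants with the moment
  constant 16; the last factor is the price of trading B^2 for N(l)/n. If the trace is zero the
  quotient is 0 by convention, and the bias is zero as well.\<close>

definition Cbias :: "real \<Rightarrow> real" where
  "Cbias C = 2560 * C + 512 * C * (16 * \<kappa> ^ 4 / trace)"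

context
  fixes N :: nat and I :: "nat set" and l :: real
  assumes I: "I \<subseteq> {..<N}" "I \<noteq> {}" and l: "0 < l" "l \<le> 1"
begin

abbreviation "nI \<equiv> card I"
abbreviation "ratio \<equiv> Bc nI l / sqrt l"

lemma fin_I: "finite I"
  using I finite_subset by blast

lemma nI_pos: "nI > 0"
  using fin_I I by (simp add: card_gt_0_iff)

lemma ratio_nonneg: "ratio \<ge> 0"
  using Bc_nonneg[OF nI_pos l(1)] l by simp

text \<open>Apply \<open>centered_kernel\<close> with b = 2 kappa^4 / l and v = kappa^2 N(l). Then X
  / n^2, with X = b + n v, is at most B^2 / 2, and the third moment constant becomes 126 / 8 <=
  16.\<close>

lemma
  shows Q2_moment_integrable: "integrable (PN N) (\<lambda>z. Q2 l I z ^ p)"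
    and Q2_moment1: "(\<integral>z. Q2 l I z \<partial>PN N) \<le> (Bc nI l)\<^sup>2"
    and Q2_moment3: "(\<integral>z. Q2 l I z ^ 3 \<partial>PN N) \<le> 16 * ((Bc nI l)\<^sup>2) ^ 3"
proof -
  interpret ck: centered_kernel rho "\<lambda>p q. kk l (fst p) (fst q)" "2 * \<kappa> ^ 4 / l" "\<kappa>\<^sup>2 * edim l"
    by (rule centered_kernel_kk[OF l])
  interpret PN: prob_space "PN N" by (rule prob_PN)
  define n where "n = real nI"
  have n: "n > 0" using nI_pos by (simp add: n_def)
  define X where "X = 2 * \<kappa> ^ 4 / l + n * (\<kappa>\<^sup>2 * edim l)"
  have Q2_eq: "Q2 l I z = (ck.t I z - 2 * \<kappa> ^ 4 / l) / n\<^sup>2" for z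
    by (simp add: Q2_def ck.t_def n_def)
  have Q0: "0 \<le> Q2 l I z" for z by (rule Q2_nonneg[OF l(1)])
  have Q_le: "Q2 l I z \<le> ck.t I z / n\<^sup>2" for z
    unfolding Q2_eq using ck.b_nonneg by (intro divide_right_mono) auto
  define C where "C = (2 * \<kappa> ^ 4 / l + n * (n * (2 * \<kappa> ^ 4 / l))) / n\<^sup>2"
  have "ck.t I z / n\<^sup>2 \<le> C" for z
    unfolding C_def using ck.t_bound[of I z] by (intro divide_right_mono) (auto simp: n_def)
  then have Q_C: "Q2 l I z \<le> C" for z using Q_le order_trans by blast
  have t_meas: "ck.t I \<in> borel_measurable (PN N)" by (rule ck.t_measurable[OF finite_lessThan I(1)])
  have Q_meas [measurable]: "Q2 l I \<in> borel_measurable (PN N)"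
    unfolding Q2_eq[abs_def] using t_meas by measurable
  have int: "integrable (PN N) (\<lambda>z. Q2 l I z ^ p)" for p
    by (rule PN.integrable_const_bound[of _ "C ^ p"])
      (auto intro!: power_mono Q_C simp: Q0 power_abs)
  then show "integrable (PN N) (\<lambda>z. Q2 l I z ^ p)" .
  have t_int: "integrable (PN N) (\<lambda>z. ck.t I z ^ p)" for p
  proof (rule ck.bounded_integrable[OF finite_lessThan])
    show "(\<lambda>z. ck.t I z ^ p) \<in> borel_measurable (PN N)" using t_meas by measurable
    show "\<bar>ck.t I z ^ p\<bar> \<le> (2 * \<kappa> ^ 4 / l + real (card I) * (real (card I) * (2 * \<kappa> ^ 4 / l))) ^ p" for z
      unfolding power_abs by (intro power_mono ck.t_bound) auto
  qed
  have X0: "X \<ge> 0" unfolding X_def using edim_nonneg[OF l(1)] n l by simp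
  have "X / n\<^sup>2 = \<kappa>\<^sup>2 / n * (2 * (\<kappa>\<^sup>2 / (n * l)) + edim l)"
    unfolding X_def using n l by (simp add: power4_eq_xxxx power2_eq_square field_simps)
  also have "\<dots> \<le> \<kappa>\<^sup>2 / n * (2 * (\<kappa>\<^sup>2 / (n * l) + edim l))"
    using edim_nonneg[OF l(1)] n by (intro mult_left_mono) auto
  also have "\<dots> = (4 * \<kappa>\<^sup>2 / n * (\<kappa>\<^sup>2 / (n * l) + edim l)) / 2" by simp
  also have "\<dots> \<le> (Bc nI l)\<^sup>2 / 2"
    using Bc_square_lower[OF nI_pos l(1)] unfolding n_def by (intro divide_right_mono) auto
  finally have X_le: "X / n\<^sup>2 \<le> (Bc nI l)\<^sup>2 / 2" .
  have "(\<integral>z. Q2 l I z \<partial>PN N) \<le> (\<integral>z. ck.t I z / n\<^sup>2 \<partial>PN N)"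
    using int[of 1] t_int[of 1] Q_le by (intro integral_mono) auto
  also have "\<dots> = (\<integral>z. ck.t I z \<partial>PN N) / n\<^sup>2" by simp
  also have "\<dots> \<le> X / n\<^sup>2"
    using ck.moment1[OF finite_lessThan I(1)] unfolding X_def n_def by (intro divide_right_mono) auto
  also have "\<dots> \<le> (Bc nI l)\<^sup>2" using X_le zero_le_power2[of "Bc nI l"] by linarith
  finally show "(\<integral>z. Q2 l I z \<partial>PN N) \<le> (Bc nI l)\<^sup>2" .
  have "(\<integral>z. Q2 l I z ^ 3 \<partial>PN N) \<le> (\<integral>z. ck.t I z ^ 3 / (n\<^sup>2) ^ 3 \<partial>PN N)"
  proof (rule integral_mono)
    show "Q2 l I z ^ 3 \<le> ck.t I z ^ 3 / (n\<^sup>2) ^ 3" for z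
      using power_mono[OF Q_le[of z] Q0[of z], of 3] by (simp add: power_divide)
  qed (use int[of 3] t_int[of 3] in auto)
  also have "\<dots> = (\<integral>z. ck.t I z ^ 3 \<partial>PN N) / (n\<^sup>2) ^ 3" by simp
  also have "\<dots> \<le> 126 * X ^ 3 / (n\<^sup>2) ^ 3"
    using ck.moment3[OF finite_lessThan I(1)] unfolding X_def n_def by (intro divide_right_mono) auto
  also have "\<dots> = 126 * (X / n\<^sup>2) ^ 3" by (simp add: power_divide)
  also have "\<dots> \<le> 126 * ((Bc nI l)\<^sup>2 / 2) ^ 3"
    using X_le X0 by (intro mult_left_mono power_mono) auto
  also have "\<dots> = 126 / 8 * ((Bc nI l)\<^sup>2) ^ 3" by (simp add: power_divide)
  also have "\<dots> \<le> 16 * ((Bc nI l)\<^sup>2) ^ 3" by (intro mult_right_mono) auto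
  finally show "(\<integral>z. Q2 l I z ^ 3 \<partial>PN N) \<le> 16 * ((Bc nI l)\<^sup>2) ^ 3" .
qed

definition q :: "(nat \<Rightarrow> 'a \<times> real) \<Rightarrow> real" where
  "q z = Q2 l I z / l"

lemma q_nonneg: "q z \<ge> 0"
  using Q2_nonneg[OF l(1)] l by (simp add: q_def)

lemma q_integrable: "integrable (PN N) q" "integrable (PN N) (\<lambda>z. q z ^ 3)"
  using Q2_moment_integrable[of 1] Q2_moment_integrable[of 3] by (simp_all add: q_def[abs_def] power_divide)

text \<open>Since q is \<open>Q2\<close> over l and B^2 / l is \<open>ratio\<close> squared, q has
  first moment at most \<open>ratio\<close>^2 and third moment at most 16 \<open>ratio\<close>^6.
  The second version keeps a factor \<open>ratio\<close>^2, to be turned into B^2 by a power of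
  l.\<close>

lemma
  shows q_moment: "(\<integral>z. 1 + q z ^ 3 \<partial>PN N) \<le> 16 * (ratio + 1) ^ 6"
    and q_moment': "(\<integral>z. q z + q z ^ 3 \<partial>PN N) \<le> 16 * (ratio\<^sup>2 * (ratio + 1) ^ 4)"
proof -
  interpret PN: prob_space "PN N" by (rule prob_PN)
  have r2: "ratio\<^sup>2 = (Bc nI l)\<^sup>2 / l" using l by (simp add: power_divide)
  have m1: "(\<integral>z. q z \<partial>PN N) \<le> ratio\<^sup>2"
    unfolding r2 q_def using Q2_moment1 l by (simp add: divide_right_mono)
  have "(\<integral>z. q z ^ 3 \<partial>PN N) = (\<integral>z. Q2 l I z ^ 3 \<partial>PN N) / l ^ 3"
    by (simp add: q_def power_divide)
  also have "\<dots> \<le> 16 * ((Bc nI l)\<^sup>2) ^ 3 / l ^ 3"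
    using Q2_moment3 l by (intro divide_right_mono) auto
  also have "\<dots> = 16 * (ratio\<^sup>2) ^ 3" unfolding r2 by (simp add: power_divide)
  finally have m3: "(\<integral>z. q z ^ 3 \<partial>PN N) \<le> 16 * ratio ^ 6" by simp
  have le4: "1 + ratio ^ 4 \<le> (ratio + 1) ^ 4"
    by (rule one_plus_power_le[OF ratio_nonneg]) simp
  have "ratio ^ 6 = ratio\<^sup>2 * ratio ^ 4" by (simp flip: power_add)
  then have e6: "ratio\<^sup>2 + 16 * ratio ^ 6 \<le> 16 * (ratio\<^sup>2 * (1 + ratio ^ 4))"
    by (simp add: distrib_left)
  have "1 + ratio ^ 6 \<le> (ratio + 1) ^ 6"
    by (rule one_plus_power_le[OF ratio_nonneg]) simp
  then have "1 + 16 * ratio ^ 6 \<le> 16 * (ratio + 1) ^ 6" by linarith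
  then show "(\<integral>z. 1 + q z ^ 3 \<partial>PN N) \<le> 16 * (ratio + 1) ^ 6"
    using q_integrable m3 by (simp add: PN.prob_space)
  have "ratio\<^sup>2 * (1 + ratio ^ 4) \<le> ratio\<^sup>2 * (ratio + 1) ^ 4"
    by (intro mult_left_mono le4) auto
  then show "(\<integral>z. q z + q z ^ 3 \<partial>PN N) \<le> 16 * (ratio\<^sup>2 * (ratio + 1) ^ 4)"
    using q_integrable m1 m3 e6 by simp
qed

lemmas Q2_moments = q_nonneg[unfolded q_def] q_integrable[unfolded q_def[abs_def]] q_moment[unfolded q_def]

section \<open>Expected bias of one block\<close>

lemma bias_mem: "bias l I z f0 \<in> H"
  using f0 by (simp add: bias_def pos_op_mem[OF RE_pos_op[OF l(1)]])

lemma bias_joint_measurable: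
  "(\<lambda>p. bias l I (fst p) f0 (snd p)) \<in> borel_measurable (PN N \<Otimes>\<^sub>M borel)"
proof -
  have "(\<lambda>p. f0 (snd p)) \<in> borel_measurable (PN N \<Otimes>\<^sub>M borel)"
    using H_measurable[OF f0] by measurable
  note R1 = RE_measurable[OF l(1) I(1), where F = "\<lambda>z. f0", OF f0 this]
  have "(\<lambda>p. RE l I (fst p) (RE l I (fst p) f0) (snd p)) \<in> borel_measurable (PN N \<Otimes>\<^sub>M borel)"
    by (rule RE_measurable[OF l(1) I(1), where F = "\<lambda>z. RE l I z f0", OF _ R1])
      (rule pos_op_mem[OF RE_pos_op[OF l(1)] f0])
  then show ?thesis unfolding bias_def fun_apply by simp
qed

lemma bias_sq_integrable: "integrable (PN N) (\<lambda>z. sq (bias l I z f0))"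
proof -
  interpret PN: prob_space "PN N" by (rule prob_PN)
  show ?thesis
  proof (rule PN.integrable_const_bound[of _ "\<kappa>\<^sup>2 * ip f0 f0"])
    show "(\<lambda>z. sq (bias l I z f0)) \<in> borel_measurable (PN N)"
      by (rule sq_measurable[OF bias_mem bias_joint_measurable])
    have "norm (sq (bias l I z f0)) \<le> \<kappa>\<^sup>2 * ip f0 f0" for z
    proof -
      note m = pos_op_mem[OF RE_pos_op[OF l(1), of I z]]
      let ?v = "RE l I z f0"
      have "ip (bias l I z f0) (bias l I z f0) = l\<^sup>2 * (l\<^sup>2 * ip (RE l I z ?v) (RE l I z ?v))"
        using f0 m by (simp add: bias_def ip_linear power2_eq_square)
      also have "\<dots> \<le> l\<^sup>2 * ip ?v ?v" by (intro mult_left_mono RE_norm_le[OF l(1) m[OF f0]]) simp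
      also have "\<dots> \<le> ip f0 f0" by (rule RE_norm_le[OF l(1) f0])
      finally have "\<kappa>\<^sup>2 * ip (bias l I z f0) (bias l I z f0) \<le> \<kappa>\<^sup>2 * ip f0 f0"
        by (intro mult_left_mono) auto
      then show ?thesis
        using sq_le[OF bias_mem, of z] sq_nonneg[OF bias_mem, of z] by simp
    qed
    then show "AE z in PN N. norm (sq (bias l I z f0)) \<le> \<kappa>\<^sup>2 * ip f0 f0" by simp
  qed
qed

lemma bias_expectation_le:
  assumes src: "source r C f0" and C: "C \<ge> 0"
  shows "(\<integral>z. sq (bias l I z f0) \<partial>PN N) \<le>
    Cbias C * ((ratio + 1) ^ 6 * (l\<^sup>2 * edim l / nI + l powr (2 * r)))"
proof (cases "trace = 0")
  case True
  have "sq (bias l I z f0) = 0" for z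
    using sq_le_trace[OF bias_mem, of z] sq_nonneg[OF bias_mem, of z] True by simp
  then show ?thesis
    using C ratio_nonneg edim_nonneg[OF l(1)] trace_nonneg l by (simp add: Cbias_def)
next
  case False
  then have tr: "trace > 0" using trace_nonneg by simp
  define A where "A = (ratio + 1) ^ 6"
  have A: "A \<ge> 0" using ratio_nonneg by (simp add: A_def)
  have "(\<integral>z. sq (bias l I z f0) \<partial>PN N) \<le>
      (\<integral>z. 160 * C * l powr (2 * r) * (1 + q z ^ 3) + 32 * C * l ^ 3 * (q z + q z ^ 3) \<partial>PN N)"
  proof (rule integral_mono[OF bias_sq_integrable])
    show "integrable (PN N) (\<lambda>z. 160 * C * l powr (2 * r) * (1 + q z ^ 3) + 32 * C * l ^ 3 * (q z + q z ^ 3))"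
      using q_integrable prob_PN by (auto simp: prob_space_def finite_measure.integrable_const)
    show "sq (bias l I z f0) \<le> 160 * C * l powr (2 * r) * (1 + q z ^ 3) + 32 * C * l ^ 3 * (q z + q z ^ 3)" for z
      unfolding q_def by (rule bias_pointwise_le[OF src C l(1) fin_I I(2)])
  qed
  also have "\<dots> = 160 * C * l powr (2 * r) * (\<integral>z. 1 + q z ^ 3 \<partial>PN N) + 32 * C * l ^ 3 * (\<integral>z. q z + q z ^ 3 \<partial>PN N)"
  proof -
    have "integrable (PN N) (\<lambda>z. 1 + q z ^ 3)" "integrable (PN N) (\<lambda>z. q z + q z ^ 3)"
      using q_integrable prob_PN by (auto simp: prob_space_def finite_measure.integrable_const)
    then show ?thesis by (subst Bochner_Integration.integral_add) auto
  qed
  also have "\<dots> \<le> 160 * C * l powr (2 * r) * (16 * A) + 32 * C * l ^ 3 * (16 * (ratio\<^sup>2 * (ratio + 1) ^ 4))"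
    unfolding A_def using C l by (intro add_mono mult_left_mono q_moment q_moment') auto
  \<comment> \<open>One of the three factors l is spent on l \<open>ratio\<close>^2 = B^2. Trading
    B^2 for N(l)/n then adds a factor 1 + \<open>ratio\<close>, and the fifth power is raised to the
    sixth.\<close>
  also have "\<dots> = 2560 * C * (A * l powr (2 * r)) + 512 * C * (l\<^sup>2 * ((Bc nI l)\<^sup>2 * (ratio + 1) ^ 4))"
  proof -
    have "l * ratio\<^sup>2 = (Bc nI l)\<^sup>2" using l by (simp add: power_divide)
    moreover have "32 * C * l ^ 3 * (16 * (s * X)) = 512 * C * (l\<^sup>2 * ((l * s) * X))" for s X
      by (simp add: eval_nat_numeral)
    moreover have "160 * C * y * (16 * A) = 2560 * C * (A * y)" for y by simp
    ultimately show ?thesis by (simp only:)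
  qed
  also have "\<dots> \<le> 2560 * C * (A * l powr (2 * r)) + 512 * C * (l\<^sup>2 * ((16 * \<kappa> ^ 4 / trace) * (edim l / nI) * A))"
  proof -
    have "(Bc nI l)\<^sup>2 \<le> (16 * \<kappa> ^ 4 / trace) * (edim l / nI) * (1 + ratio)"
    proof -
      have "(Bc nI l)\<^sup>2 \<le> 16 * \<kappa> ^ 4 * (edim l / nI) * (1 + ratio) / trace"
        using trace_times_Bc_square_le[OF nI_pos l]
        by (simp only: pos_le_divide_eq[OF tr] mult.commute[of _ trace])
      then show ?thesis by (simp add: mult.commute)
    qed
    then have "(Bc nI l)\<^sup>2 * (ratio + 1) ^ 4 \<le> ((16 * \<kappa> ^ 4 / trace) * (edim l / nI) * (1 + ratio)) * (ratio + 1) ^ 4"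
      using ratio_nonneg by (intro mult_right_mono) auto
    also have "\<dots> = (16 * \<kappa> ^ 4 / trace) * (edim l / nI) * (ratio + 1) ^ 5"
      by (simp add: eval_nat_numeral add.commute mult.assoc)
    also have "\<dots> \<le> (16 * \<kappa> ^ 4 / trace) * (edim l / nI) * A"
      unfolding A_def using ratio_nonneg tr edim_nonneg[OF l(1)] by (intro mult_left_mono power_increasing) auto
    finally show ?thesis using C by (intro add_left_mono mult_left_mono) auto
  qed
  also have "\<dots> \<le> Cbias C * (A * (l\<^sup>2 * edim l / nI + l powr (2 * r)))"
  proof -
    define a where "a = 2560 * C"
    define b where "b = 512 * C * (16 * \<kappa> ^ 4 / trace)"
    define u where "u = A * (l\<^sup>2 * edim l / nI)"
    define v where "v = A * l powr (2 * r)"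
    have nn: "a \<ge> 0" "b \<ge> 0" "u \<ge> 0" "v \<ge> 0"
      using C tr A edim_nonneg[OF l(1)] by (auto simp: a_def b_def u_def v_def)
    have "a * v + b * u \<le> (a + b) * (u + v)"
      using mult_nonneg_nonneg[OF nn(1,3)] mult_nonneg_nonneg[OF nn(2,4)] by (simp add: algebra_simps)
    then show ?thesis by (simp add: a_def b_def u_def v_def Cbias_def algebra_simps)
  qed
  finally show ?thesis by (simp add: A_def)
qed

end

subsection \<open>The noise term\<close>

text \<open>Expands the square into pairs of observations. The weights V depend on the inputs only,
  so resampling observation i leaves the integral of \<open>err\<close> against a bounded function
  of its input, which is zero. Only the diagonal survives, where \<open>err\<close> is bounded by
  \<open>E0\<close>.\<close>

lemma noise_expectation:
  fixes V :: "nat \<Rightarrow> (nat \<Rightarrow> 'a \<times> real) \<Rightarrow> 'a \<Rightarrow> real"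
  assumes mem: "\<And>i z. i < N \<Longrightarrow> V i z \<in> H"
    and meas: "\<And>i. i < N \<Longrightarrow> (\<lambda>p. V i (fst p) (snd p)) \<in> borel_measurable (PN N \<Otimes>\<^sub>M borel)"
    and bound: "\<And>i z x. i < N \<Longrightarrow> \<bar>V i z x\<bar> \<le> c"
    and inputs: "\<And>i z z'. (\<And>k. fst (z k) = fst (z' k)) \<Longrightarrow> V i z = V i z'"
  shows "integrable (PN N) (\<lambda>z. sq (\<Sum>i<N. err (z i) *\<^sub>R V i z))"
    and "(\<integral>z. sq (\<Sum>i<N. err (z i) *\<^sub>R V i z) \<partial>PN N) \<le> E0\<^sup>2 * (\<Sum>i<N. \<integral>z. sq (V i z) \<partial>PN N)"
    and "\<And>i. i < N \<Longrightarrow> integrable (PN N) (\<lambda>z. sq (V i z))"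
proof -
  interpret PN: prob_space "PN N" by (rule prob_PN)
  define a where "a i k z = (\<integral>x. V i z x * V k z x \<partial>mu)" for i k z
  have a_meas: "a i k \<in> borel_measurable (PN N)" if "i < N" "k < N" for i k
    unfolding a_def[abs_def] by (rule inner_measurable[OF meas[OF that(1)] meas[OF that(2)]])
  have a_bound: "\<bar>a i k z\<bar> \<le> c * c" if "i < N" "k < N" for i k z
  proof -
    have int: "integrable mu (\<lambda>x. V i z x * V k z x)" by (rule L2_times_H[OF H_L2 mem]) (use mem that in auto)
    have c: "\<bar>V i z x * V k z x\<bar> \<le> c * c" for x
      unfolding abs_mult using bound[OF that(1)] bound[OF that(2)] abs_ge_zero order_trans
      by (intro mult_mono) blast+
    have "\<bar>a i k z\<bar> \<le> (\<integral>x. \<bar>V i z x * V k z x\<bar> \<partial>mu)" unfolding a_def by (rule integral_abs_bound)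
    also have "\<dots> \<le> c * c" using int c by (intro mu.integral_le_const) auto
    finally show ?thesis .
  qed
  have sq_V: "sq (V i z) = a i i z" if "i < N" for i z
    using ip_L_self[OF mem[OF that]] by (simp add: a_def power2_eq_square)
  have term_meas: "(\<lambda>z. err (z i) * err (z k) * a i k z) \<in> borel_measurable (PN N)" if "i < N" "k < N" for i k
    using a_meas[OF that] that by measurable
  have term_bound: "\<bar>err (z i) * err (z k) * a i k z\<bar> \<le> E0 * E0 * (c * c)" if "i < N" "k < N" for i k z
    unfolding abs_mult by (intro mult_mono err_bound a_bound that) (auto intro: E0_nonneg)
  have term_int: "integrable (PN N) (\<lambda>z. err (z i) * err (z k) * a i k z)" if "i < N" "k < N" for i k
    by (rule PN.integrable_const_bound[of _ "E0 * E0 * (c * c)", OF _ term_meas[OF that]]) (use term_bound[OF that] in simp)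
  have a_int: "integrable (PN N) (a i k)" if "i < N" "k < N" for i k
    by (rule PN.integrable_const_bound[of _ "c * c", OF _ a_meas[OF that]]) (use a_bound[OF that] in simp)
  then show "integrable (PN N) (\<lambda>z. sq (V i z))" if "i < N" for i using sq_V that by simp
  have expand: "sq (\<Sum>i<N. err (z i) *\<^sub>R V i z) = (\<Sum>i<N. \<Sum>k<N. err (z i) * err (z k) * a i k z)" for z
  proof -
    have u: "(\<Sum>i<N. err (z i) *\<^sub>R V i z) \<in> H" using mem by auto
    have "sq (\<Sum>i<N. err (z i) *\<^sub>R V i z) = (\<integral>x. (\<Sum>i<N. err (z i) * V i z x)\<^sup>2 \<partial>mu)"
      using ip_L_self[OF u] by (simp add: fun_apply)
    also have "\<dots> = (\<integral>x. (\<Sum>i<N. \<Sum>k<N. err (z i) * err (z k) * (V i z x * V k z x)) \<partial>mu)"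
      by (simp add: power2_eq_square sum_product mult.assoc mult.left_commute)
    also have "\<dots> = (\<Sum>i<N. \<Sum>k<N. err (z i) * err (z k) * a i k z)"
      unfolding a_def by (subst double_sum_integral) (auto intro!: L2_times_H H_L2 mem)
    finally show ?thesis .
  qed
  show "integrable (PN N) (\<lambda>z. sq (\<Sum>i<N. err (z i) *\<^sub>R V i z))"
    unfolding expand by (intro Bochner_Integration.integrable_sum term_int) auto
  have cross: "(\<integral>z. err (z i) * err (z k) * a i k z \<partial>PN N) = 0" if ik: "i < N" "k < N" "i \<noteq> k" for i k
  proof -
    have "(\<integral>z. err (z i) * err (z k) * a i k z \<partial>PN N)
        = (\<integral>z. (\<integral>w. err w * err (z k) * a i k (z(i := w)) \<partial>rho) \<partial>PN N)"
      using resample_integral[OF rho finite_lessThan _ term_meas[OF ik(1,2)] term_bound[OF ik(1,2)], of i] ik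
      by (simp add: fun_upd_def)
    also have "\<dots> = (\<integral>z. 0 \<partial>PN N)"
    proof (rule Bochner_Integration.integral_cong[OF refl])
      fix z assume z: "z \<in> space (PN N)"
      \<comment> \<open>The output of observation i is fixed at the arbitrary value 0; this changes
        nothing because \<open>a\<close> sees only inputs, and it makes g a function of the input
        alone.\<close>
      define g where "g x = err (z k) * a i k (z(i := (x, 0)))" for x
      have a_eq: "a i k (z(i := w)) = a i k (z(i := (fst w, 0)))" for w
      proof -
        have "V j (z(i := w)) = V j (z(i := (fst w, 0)))" for j by (rule inputs) simp
        then show ?thesis by (simp add: a_def)
      qed
      have "(\<lambda>(z, w). z(i := w)) \<in> PN N \<Otimes>\<^sub>M rho \<rightarrow>\<^sub>M PiM (insert i {..<N}) (\<lambda>_. rho)"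
        by (rule measurable_add_dim)
      moreover have "insert i {..<N} = {..<N}" using ik by auto
      ultimately have "(\<lambda>(z, w). z(i := w)) \<in> PN N \<Otimes>\<^sub>M rho \<rightarrow>\<^sub>M PN N" by simp
      from measurable_Pair2[OF this z] have "(\<lambda>w. z(i := w)) \<in> rho \<rightarrow>\<^sub>M PN N" by simp
      moreover have "(\<lambda>x. (x, 0)) \<in> borel \<rightarrow>\<^sub>M rho"
        unfolding measurable_cong_sets[OF refl sets_rho_pair] by measurable
      ultimately have "(\<lambda>x. z(i := (x, 0))) \<in> borel \<rightarrow>\<^sub>M PN N" using measurable_compose by blast
      from measurable_compose[OF this a_meas[OF ik(1,2)]]
      have g_meas: "g \<in> borel_measurable borel" unfolding g_def by measurable
      have g_bound: "\<bar>g x\<bar> \<le> E0 * (c * c)" for x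
        unfolding g_def abs_mult by (intro mult_mono err_bound a_bound ik E0_nonneg) auto
      have "(\<integral>w. err w * err (z k) * a i k (z(i := w)) \<partial>rho) = (\<integral>w. err w * g (fst w) \<partial>rho)"
        unfolding g_def by (subst a_eq) (simp add: mult.assoc)
      also have "\<dots> = 0" by (rule err_centered[OF g_meas g_bound])
      finally show "(\<integral>w. err w * err (z k) * a i k (z(i := w)) \<partial>rho) = 0" .
    qed
    finally show ?thesis by simp
  qed
  have "(\<integral>z. sq (\<Sum>i<N. err (z i) *\<^sub>R V i z) \<partial>PN N)
      = (\<Sum>i<N. \<Sum>k<N. \<integral>z. err (z i) * err (z k) * a i k z \<partial>PN N)"
    unfolding expand by (rule double_sum_integral) (auto intro: term_int)
  also have "\<dots> = (\<Sum>i<N. \<Sum>k<N. if i = k then \<integral>z. err (z i) * err (z i) * a i i z \<partial>PN N else 0)"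
    using cross by (intro sum.cong refl) auto
  also have "\<dots> = (\<Sum>i<N. \<integral>z. err (z i) * err (z i) * a i i z \<partial>PN N)" by simp
  also have "\<dots> \<le> (\<Sum>i<N. \<integral>z. E0\<^sup>2 * sq (V i z) \<partial>PN N)"
  proof (rule sum_mono, rule integral_mono)
    fix i z assume i: "i \<in> {..<N}"
    have "(err (z i))\<^sup>2 \<le> E0\<^sup>2" using err_bound[of "z i"] E0_nonneg by (simp add: abs_le_square_iff[symmetric])
    then show "err (z i) * err (z i) * a i i z \<le> E0\<^sup>2 * sq (V i z)"
      using sq_V[of i z] sq_nonneg[OF mem[of i z]] i by (simp add: power2_eq_square mult_right_mono)
  qed (use term_int a_int sq_V in auto)
  also have "\<dots> = E0\<^sup>2 * (\<Sum>i<N. \<integral>z. sq (V i z) \<partial>PN N)" by (simp add: sum_distrib_left)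
  finally show "(\<integral>z. sq (\<Sum>i<N. err (z i) *\<^sub>R V i z) \<partial>PN N) \<le> E0\<^sup>2 * (\<Sum>i<N. \<integral>z. sq (V i z) \<partial>PN N)" .
qed

end

section \<open>The distributed estimator\<close>

context learning
begin

text \<open>Write each output as f0 at the input plus noise. On the noiseless part the filter
  reproduces f0 up to its residual, by \<open>G_T'\<close>.\<close>

lemma bcrkn_eq:
  assumes l: "l > 0" and I: "finite I" "I \<noteq> {}"
  shows "bcrkn K H l I z = f0 - bias l I z f0 +
    (1 / real (card I)) *\<^sub>R (\<Sum>i\<in>I. (snd (z i) - f0 (fst (z i))) *\<^sub>R GE l I z (K (fst (z i))))"
proof -
  interpret D: two_resolvents K H ip L "empirical_op K I z" "\<kappa> ^ 4" "\<kappa> ^ 4" l "Q2 l I z"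
    using l I by (rule two_resolvents_empirical)
  note G = pos_op_linear[OF GE_pos_op[OF l, of I z]]
  define c where "c = 1 / real (card I)"
  define d where "d = c *\<^sub>R (\<Sum>i\<in>I. snd (z i) *\<^sub>R K (fst (z i)))"
  define e where "e i = snd (z i) - f0 (fst (z i))" for i
  have "rkn K H l I z = RE l I z d"
    unfolding rkn_def RE_def
    by (intro arg_cong[of _ _ "resolvent H (empirical_op K I z) l"] ext)
      (simp add: d_def c_def fun_apply sampling_adj_def)
  then have "bcrkn K H l I z = GE l I z d"
    unfolding bcrkn_def GE_def by (intro ext) (simp add: fun_apply RE_def)
  also have "d = empirical_op K I z f0 + c *\<^sub>R (\<Sum>i\<in>I. e i *\<^sub>R K (fst (z i)))"
    unfolding d_def e_def empirical_op_eq c_def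
    by (simp add: scaleR_add_right[symmetric] sum.distrib[symmetric] scaleR_add_left[symmetric])
  also have "GE l I z \<dots> = GE l I z (empirical_op K I z f0) + c *\<^sub>R (\<Sum>i\<in>I. e i *\<^sub>R GE l I z (K (fst (z i))))"
  proof -
    have "GE l I z (\<Sum>i\<in>I. e i *\<^sub>R K (fst (z i))) = (\<Sum>i\<in>I. GE l I z (e i *\<^sub>R K (fst (z i))))"
      by (rule pos_op_sum[OF GE_pos_op[OF l]]) auto
    moreover have "(\<Sum>i\<in>I. e i *\<^sub>R K (fst (z i))) \<in> H" by auto
    ultimately show ?thesis by (simp add: G empirical_op_mem)
  qed
  also have "GE l I z (empirical_op K I z f0) = f0 - bias l I z f0"
    using D.G_T'[OF f0] by (simp add: D.G_def GE_def bias_def RE_def algebra_simps)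
  finally show ?thesis by (simp add: c_def e_def)
qed

lemma distributed_bcrkn_eq:
  "distributed_bcrkn K H l N m D z = (\<Sum>j<m. (real (card (D j)) / real N) *\<^sub>R bcrkn K H l (D j) z)"
  unfolding distributed_bcrkn_def by (intro ext) (simp add: fun_apply)

definition bound_term :: "real \<Rightarrow> nat \<Rightarrow> nat set \<Rightarrow> real \<Rightarrow> real" where
  "bound_term r N I l = real (card I) / real N * (Bc (card I) l / sqrt l + 1) ^ 6 *
     (real (card I) / real N * (Bc (card I) l)\<^sup>2 + l\<^sup>2 * edim l / real (card I) + l powr (2 * r))"

section \<open>Bias and noise over the whole partition\<close>

context
  fixes N m :: nat and D :: "nat \<Rightarrow> nat set" and l :: real
  assumes bp: "block_partition N m D" and l: "0 < l" "l \<le> 1"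
begin

lemma D_subset: "j < m \<Longrightarrow> D j \<subseteq> {..<N}"
  using bp by (auto simp: block_partition_def)

lemma D_nonempty: "j < m \<Longrightarrow> D j \<noteq> {}"
  using bp by (auto simp: block_partition_def)

lemma D_finite: "j < m \<Longrightarrow> finite (D j)"
  using D_subset finite_subset by blast

lemma sum_blocks: "(\<Sum>j<m. \<Sum>i\<in>D j. g i) = (\<Sum>i<N. g i)"
proof -
  have "(\<Sum>i\<in>(\<Union>j\<in>{..<m}. D j). g i) = (\<Sum>j<m. \<Sum>i\<in>D j. g i)"
    using bp D_finite
    by (intro sum.UNION_disjoint) (auto simp: block_partition_def disjoint_family_on_def)
  then show ?thesis using bp by (simp add: block_partition_def)
qed

lemma N_pos: "N > 0"
proof -
  have "0 < m" using bp by (simp add: block_partition_def)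
  then show ?thesis using D_nonempty[of 0] D_subset[of 0] by auto
qed

abbreviation "w j \<equiv> real (card (D j)) / real N"

lemma sum_w: "(\<Sum>j<m. w j) = 1"
proof -
  have "(\<Sum>j<m. real (card (D j))) = real N"
    using sum_blocks[of "\<lambda>_. 1 :: real"] by simp
  then show ?thesis using N_pos by (simp add: sum_divide_distrib[symmetric])
qed

definition blk :: "nat \<Rightarrow> nat" where
  "blk i = (THE j. j < m \<and> i \<in> D j)"

lemma blk_eq: "j < m \<Longrightarrow> i \<in> D j \<Longrightarrow> blk i = j"
  unfolding blk_def using bp
  by (intro the_equality) (auto simp: block_partition_def disjoint_family_on_def)

lemma blk_less: "i < N \<Longrightarrow> blk i < m"
proof -
  assume "i < N"
  then have "i \<in> (\<Union>j<m. D j)" using bp by (auto simp: block_partition_def)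
  then obtain j where "j < m" "i \<in> D j" by auto
  then show ?thesis using blk_eq by simp
qed

text \<open>Choosing the filter by the block of i writes the noise of all blocks as one sum over the
  sample, so that orthogonality within and across blocks is a single statement.\<close>

definition V :: "nat \<Rightarrow> (nat \<Rightarrow> 'a \<times> real) \<Rightarrow> 'a \<Rightarrow> real" where
  "V i z = GE l (D (blk i)) z (K (fst (z i)))"

lemma V_mem: "V i z \<in> H"
  unfolding V_def by (rule GE_mem[OF l(1) H_kernel])

lemma V_measurable:
  assumes "i < N"
  shows "(\<lambda>p. V i (fst p) (snd p)) \<in> borel_measurable (PN N \<Otimes>\<^sub>M borel)"
  unfolding V_def
  by (rule GE_measurable[OF l(1) D_subset[OF blk_less[OF assms]], where F = "\<lambda>z. K (fst (z i))"])
    (use kernel_section_measurable[OF assms] in auto)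

lemma V_bound: "\<bar>V i z x\<bar> \<le> \<kappa> * sqrt (4 / l\<^sup>2 * \<kappa>\<^sup>2)"
proof -
  have "ip (V i z) (V i z) \<le> 4 / l\<^sup>2 * ip (K (fst (z i))) (K (fst (z i)))"
    unfolding V_def by (rule GE_norm_le[OF l(1) H_kernel])
  also have "\<dots> \<le> 4 / l\<^sup>2 * \<kappa>\<^sup>2" unfolding ip_kernel by (intro mult_left_mono K_diag_le) simp
  finally have "sqrt (ip (V i z) (V i z)) \<le> sqrt (4 / l\<^sup>2 * \<kappa>\<^sup>2)" by (rule real_sqrt_le_mono)
  then have "\<kappa> * sqrt (ip (V i z) (V i z)) \<le> \<kappa> * sqrt (4 / l\<^sup>2 * \<kappa>\<^sup>2)"
    using kappa_ge_1 by (intro mult_left_mono) auto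
  then show ?thesis using H_abs_eval_le[OF V_mem, of i z x] by simp
qed

lemma V_inputs:
  assumes "\<And>k. fst (z k) = fst (z' k)"
  shows "V i z = V i z'"
proof -
  have "empirical_op K I z = empirical_op K I z'" for I
    unfolding empirical_op_def sampling_adj_def sampling_op_def using assms by simp
  then show ?thesis unfolding V_def GE_def RE_def using assms by simp
qed

lemmas V_noise = noise_expectation[where V = V, OF V_mem V_measurable V_bound V_inputs]

text \<open>The block weight divided by the block size is 1/N, so every observation enters the noise
  with the same weight even for unequal blocks.\<close>

lemma error_decomposition:
  "distributed_bcrkn K H l N m D z - f0 = - (\<Sum>j<m. w j *\<^sub>R bias l (D j) z f0) +
    (1 / real N) *\<^sub>R (\<Sum>i<N. (snd (z i) - f0 (fst (z i))) *\<^sub>R V i z)"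
proof -
  define e where "e i = snd (z i) - f0 (fst (z i))" for i
  have one: "(\<Sum>j<m. w j *\<^sub>R f0) = f0" using sum_w by (simp add: scaleR_sum_left[symmetric])
  have block: "w j *\<^sub>R bcrkn K H l (D j) z = w j *\<^sub>R f0 - w j *\<^sub>R bias l (D j) z f0 +
      (1 / real N) *\<^sub>R (\<Sum>i\<in>D j. e i *\<^sub>R V i z)" if j: "j < m" for j
  proof -
    have n: "real (card (D j)) > 0" using D_finite[OF j] D_nonempty[OF j] by (simp add: card_gt_0_iff)
    have "(\<Sum>i\<in>D j. e i *\<^sub>R GE l (D j) z (K (fst (z i)))) = (\<Sum>i\<in>D j. e i *\<^sub>R V i z)"
      using blk_eq[OF j] by (intro sum.cong refl) (simp add: V_def)
    then show ?thesis
      unfolding bcrkn_eq[OF l(1) D_finite[OF j] D_nonempty[OF j]] e_def[symmetric]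
      using n by (simp add: scaleR_add_right scaleR_diff_right)
  qed
  have "distributed_bcrkn K H l N m D z = (\<Sum>j<m. w j *\<^sub>R f0 - w j *\<^sub>R bias l (D j) z f0 +
      (1 / real N) *\<^sub>R (\<Sum>i\<in>D j. e i *\<^sub>R V i z))"
    unfolding distributed_bcrkn_eq using block by (intro sum.cong refl) auto
  also have "\<dots> = f0 - (\<Sum>j<m. w j *\<^sub>R bias l (D j) z f0) + (1 / real N) *\<^sub>R (\<Sum>j<m. \<Sum>i\<in>D j. e i *\<^sub>R V i z)"
    by (simp only: sum.distrib sum_subtractf one scaleR_sum_right)
  also have "(\<Sum>j<m. \<Sum>i\<in>D j. e i *\<^sub>R V i z) = (\<Sum>i<N. e i *\<^sub>R V i z)" by (rule sum_blocks)
  finally show ?thesis by (simp add: e_def)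
qed

lemma error_mem: "distributed_bcrkn K H l N m D z - f0 \<in> H"
proof -
  have "bias l (D j) z f0 \<in> H" for j
    using f0 by (simp add: bias_def pos_op_mem[OF RE_pos_op[OF l(1)]])
  then show ?thesis unfolding error_decomposition using V_mem by auto
qed

definition noise :: "(nat \<Rightarrow> 'a \<times> real) \<Rightarrow> real" where
  "noise z = sq (\<Sum>i<N. err (z i) *\<^sub>R V i z)"

text \<open>Formed with the clipped noise \<open>err\<close>, so it is bounded everywhere; it
  dominates the true error almost surely and thereby also gives integrability.\<close>

definition majorant :: "(nat \<Rightarrow> 'a \<times> real) \<Rightarrow> real" where
  "majorant z = 2 * (\<Sum>j<m. w j * sq (bias l (D j) z f0)) + 2 * (1 / (real N)\<^sup>2 * noise z)"

lemma error_le_majorant: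
  "AE z in PN N. sq (distributed_bcrkn K H l N m D z - f0) \<le> majorant z"
proof -
  have "AE z in PN N. err (z i) = snd (z i) - f0 (fst (z i))" if "i < N" for i
    using AE_PiM_component[of "{..<N}" "\<lambda>_. rho" i, OF rho _ err_AE] that by simp
  then have "AE z in PN N. \<forall>i\<in>{..<N}. err (z i) = snd (z i) - f0 (fst (z i))"
    by (intro AE_finite_allI) auto
  then show ?thesis
  proof eventually_elim
    fix z assume e: "\<forall>i\<in>{..<N}. err (z i) = snd (z i) - f0 (fst (z i))"
    define u where "u = (\<Sum>j<m. w j *\<^sub>R bias l (D j) z f0)"
    define v where "v = (\<Sum>i<N. err (z i) *\<^sub>R V i z)"
    have b: "bias l (D j) z f0 \<in> H" for j
      using f0 by (simp add: bias_def pos_op_mem[OF RE_pos_op[OF l(1)]])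
    have uv: "u \<in> H" "v \<in> H" unfolding u_def v_def using b V_mem by auto
    have "(\<Sum>i<N. (snd (z i) - f0 (fst (z i))) *\<^sub>R V i z) = v"
      unfolding v_def using e by (intro sum.cong refl) auto
    then have eq: "distributed_bcrkn K H l N m D z - f0 = - u + (1 / real N) *\<^sub>R v"
      unfolding error_decomposition u_def by simp
    have "sq (distributed_bcrkn K H l N m D z - f0) \<le> 2 * sq (- u) + 2 * sq ((1 / real N) *\<^sub>R v)"
      unfolding eq by (rule pos_op_quadratic_add_le[OF L_pos_op]) (use uv in auto)
    also have "sq (- u) = sq u"
      using uv by (simp add: pos_op_linear[OF L_pos_op] ip_linear)
    also have "sq u \<le> (\<Sum>j<m. w j * sq (bias l (D j) z f0))"
      unfolding u_def by (rule pos_op_convex[OF L_pos_op]) (use sum_w b in auto)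
    also have "sq ((1 / real N) *\<^sub>R v) = 1 / (real N)\<^sup>2 * sq v"
      using uv by (simp add: pos_op_linear[OF L_pos_op] ip_linear power2_eq_square)
    finally show "sq (distributed_bcrkn K H l N m D z - f0) \<le> majorant z"
      by (simp add: majorant_def noise_def v_def)
  qed
qed

lemma majorant_integrable: "integrable (PN N) majorant"
  unfolding majorant_def noise_def
  using V_noise(1) bias_sq_integrable[OF D_subset D_nonempty l]
  by (intro Bochner_Integration.integrable_add integrable_mult_right Bochner_Integration.integrable_sum) auto

lemma error_measurable: "(\<lambda>z. sq (distributed_bcrkn K H l N m D z - f0)) \<in> borel_measurable (PN N)"
proof (rule sq_measurable[OF error_mem])
  have [measurable]: "(\<lambda>p. f0 (fst (fst p i))) \<in> borel_measurable (PN N \<Otimes>\<^sub>M (borel :: 'a measure))" if "i < N" for i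
    using measurable_compose[OF measurable_compose[OF measurable_fst[of "PN N" "borel :: 'a measure"] sample_point_measurable[OF that]]
      measurable_compose[OF fst_measurable H_measurable[OF f0]]] by simp
  have [measurable]: "(\<lambda>p. snd (fst p i)) \<in> borel_measurable (PN N \<Otimes>\<^sub>M (borel :: 'a measure))" if "i < N" for i
    using that by measurable
  have 1: "(\<lambda>p. (snd (fst p i) - f0 (fst (fst p i))) * V i (fst p) (snd p)) \<in> borel_measurable (PN N \<Otimes>\<^sub>M borel)"
    if "i < N" for i
    using V_measurable[OF that] that by measurable
  have 2: "(\<lambda>p. bias l (D j) (fst p) f0 (snd p)) \<in> borel_measurable (PN N \<Otimes>\<^sub>M borel)" if "j < m" for j
    by (rule bias_joint_measurable[OF D_subset[OF that] D_nonempty[OF that] l])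
  show "(\<lambda>p. (distributed_bcrkn K H l N m D (fst p) - f0) (snd p)) \<in> borel_measurable (PN N \<Otimes>\<^sub>M borel)"
    unfolding error_decomposition fun_apply real_scaleR_def
    by (intro borel_measurable_add borel_measurable_uminus borel_measurable_sum
        borel_measurable_times[OF borel_measurable_const]) (use 1 2 in auto)
qed

lemma error_integrable: "integrable (PN N) (\<lambda>z. sq (distributed_bcrkn K H l N m D z - f0))"
proof (rule Bochner_Integration.integrable_bound[OF majorant_integrable error_measurable])
  show "AE z in PN N. norm (sq (distributed_bcrkn K H l N m D z - f0)) \<le> norm (majorant z)"
    using error_le_majorant by eventually_elim (use sq_nonneg[OF error_mem] in auto)
qed

text \<open>Per block, \<open>GE_trace_le\<close> gives n N(l) 4 (2 + q), and 4 (2 + q) <= 32 (1 +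
  q^3). With \<open>q_moment\<close> the constant is 32 * 16 = 512.\<close>

lemma noise_le:
  "(\<integral>z. noise z \<partial>PN N) \<le> E0\<^sup>2 * (\<Sum>j<m. real (card (D j)) * edim l * (512 * (Bc (card (D j)) l / sqrt l + 1) ^ 6))"
proof -
  interpret PN: prob_space "PN N" by (rule prob_PN)
  have "(\<integral>z. noise z \<partial>PN N) \<le> E0\<^sup>2 * (\<Sum>i<N. \<integral>z. sq (V i z) \<partial>PN N)"
    unfolding noise_def by (rule V_noise(2))
  also have "(\<Sum>i<N. \<integral>z. sq (V i z) \<partial>PN N) = (\<Sum>j<m. \<Sum>i\<in>D j. \<integral>z. sq (V i z) \<partial>PN N)"
    by (rule sum_blocks[symmetric])
  also have "\<dots> \<le> (\<Sum>j<m. real (card (D j)) * edim l * (512 * (Bc (card (D j)) l / sqrt l + 1) ^ 6))"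
  proof (rule sum_mono)
    fix j assume "j \<in> {..<m}"
    then have j: "j < m" by simp
    let ?I = "D j"
    note S = D_subset[OF j] D_nonempty[OF j] l
    define q where "q z = Q2 l ?I z / l" for z
    note moments = Q2_moments[OF S, folded q_def]
    have 1: "integrable (PN N) (\<lambda>z. 1 + q z ^ 3)" using moments(3) by simp
    have V_eq: "(\<Sum>i\<in>?I. sq (V i z)) = (\<Sum>i\<in>?I. sq (GE l ?I z (K (fst (z i)))))" for z
      using blk_eq[OF j] by (intro sum.cong refl) (simp add: V_def)
    have "(\<Sum>i\<in>?I. \<integral>z. sq (V i z) \<partial>PN N) = (\<integral>z. (\<Sum>i\<in>?I. sq (V i z)) \<partial>PN N)"
      using V_noise(3) D_subset[OF j] by (intro Bochner_Integration.integral_sum[symmetric]) auto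
    also have "\<dots> \<le> (\<integral>z. (32 * real (card ?I) * edim l) * (1 + q z ^ 3) \<partial>PN N)"
    proof (rule integral_mono)
      show "integrable (PN N) (\<lambda>z. \<Sum>i\<in>?I. sq (V i z))"
        using V_noise(3) D_subset[OF j] by (intro Bochner_Integration.integrable_sum) auto
      show "integrable (PN N) (\<lambda>z. (32 * real (card ?I) * edim l) * (1 + q z ^ 3))"
        using 1 by (rule integrable_mult_right)
      fix z
      have q: "q z \<ge> 0" by (rule moments(1))
      have "q z \<le> 1 + q z ^ 3"
      proof (cases "q z \<le> 1")
        case True
        then show ?thesis using zero_le_power[OF q, of 3] by linarith
      next
        case False
        then have "q z ^ 1 \<le> q z ^ 3" by (intro power_increasing) auto
        then show ?thesis by simp
      qed
      then have "4 * (2 + q z) \<le> 32 * (1 + q z ^ 3)"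
        using zero_le_power[OF q, of 3] unfolding distrib_left by linarith
      then have "(4 * (2 + q z)) * (real (card ?I) * edim l) \<le> (32 * (1 + q z ^ 3)) * (real (card ?I) * edim l)"
        using edim_nonneg[OF l(1)] by (intro mult_right_mono) auto
      then show "(\<Sum>i\<in>?I. sq (V i z)) \<le> (32 * real (card ?I) * edim l) * (1 + q z ^ 3)"
        using GE_trace_le[OF l(1) D_finite[OF j] D_nonempty[OF j], of z]
        by (simp add: V_eq q_def[symmetric] mult.assoc mult.left_commute mult.commute)
    qed
    also have "\<dots> = (32 * real (card ?I) * edim l) * (\<integral>z. 1 + q z ^ 3 \<partial>PN N)" by simp
    also have "\<dots> \<le> (32 * real (card ?I) * edim l) * (16 * (Bc (card ?I) l / sqrt l + 1) ^ 6)"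
      using moments(4) edim_nonneg[OF l(1)] by (intro mult_left_mono) auto
    finally show "(\<Sum>i\<in>?I. \<integral>z. sq (V i z) \<partial>PN N)
        \<le> real (card ?I) * edim l * (512 * (Bc (card ?I) l / sqrt l + 1) ^ 6)" by simp
  qed
  finally show ?thesis by (simp add: mult_left_mono)
qed

lemma error_expectation_le:
  assumes src: "source r C f0" and C: "C \<ge> 0"
  shows "(\<integral>z. sq (distributed_bcrkn K H l N m D z - f0) \<partial>PN N)
    \<le> (2 * Cbias C + 1024 * E0\<^sup>2) * (\<Sum>j<m. bound_term r N (D j) l)"
proof -
  define c where "c j = real (card (D j))" for j
  define A where "A j = (Bc (card (D j)) l / sqrt l + 1) ^ 6" for j
  have Cb: "Cbias C \<ge> 0" using C trace_nonneg by (simp add: Cbias_def)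
  have c: "c j > 0" if "j < m" for j
    using D_finite[OF that] D_nonempty[OF that] by (simp add: c_def card_gt_0_iff)
  have A: "A j \<ge> 0" if "j < m" for j
    using ratio_nonneg[OF D_subset[OF that] D_nonempty[OF that] l] by (simp add: A_def)
  have edim: "edim l \<ge> 0" by (rule edim_nonneg[OF l(1)])
  have "(\<integral>z. sq (distributed_bcrkn K H l N m D z - f0) \<partial>PN N) \<le> (\<integral>z. majorant z \<partial>PN N)"
    by (rule integral_mono_AE[OF error_integrable majorant_integrable error_le_majorant])
  also have "\<dots> = 2 * (\<Sum>j<m. w j * (\<integral>z. sq (bias l (D j) z f0) \<partial>PN N)) + 2 * (1 / (real N)\<^sup>2 * (\<integral>z. noise z \<partial>PN N))"
  proof -
    have bias: "integrable (PN N) (\<lambda>z. w j * sq (bias l (D j) z f0))" if "j \<in> {..<m}" for j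
      using bias_sq_integrable[OF D_subset D_nonempty l] that by simp
    have noise: "integrable (PN N) noise" unfolding noise_def by (rule V_noise(1))
    have "(\<integral>z. majorant z \<partial>PN N) = (\<integral>z. 2 * (\<Sum>j<m. w j * sq (bias l (D j) z f0)) \<partial>PN N)
        + (\<integral>z. 2 * (1 / (real N)\<^sup>2 * noise z) \<partial>PN N)"
      unfolding majorant_def
    proof (rule Bochner_Integration.integral_add)
      show "integrable (PN N) (\<lambda>z. 2 * (\<Sum>j<m. w j * sq (bias l (D j) z f0)))"
        by (rule integrable_mult_right, rule Bochner_Integration.integrable_sum, rule bias)
      show "integrable (PN N) (\<lambda>z. 2 * (1 / (real N)\<^sup>2 * noise z))"
        by (intro integrable_mult_right noise)
    qed
    also have "(\<integral>z. 2 * (\<Sum>j<m. w j * sq (bias l (D j) z f0)) \<partial>PN N)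
        = 2 * (\<Sum>j<m. \<integral>z. w j * sq (bias l (D j) z f0) \<partial>PN N)"
      by (simp only: integral_mult_right_zero Bochner_Integration.integral_sum[OF bias])
    finally show ?thesis by simp
  qed
  also have "\<dots> \<le> 2 * (\<Sum>j<m. w j * (Cbias C * (A j * (l\<^sup>2 * edim l / c j + l powr (2 * r)))))
      + 2 * (1 / (real N)\<^sup>2 * (E0\<^sup>2 * (\<Sum>j<m. c j * edim l * (512 * A j))))"
  proof (intro add_mono mult_left_mono sum_mono)
    show "(\<integral>z. sq (bias l (D j) z f0) \<partial>PN N) \<le> Cbias C * (A j * (l\<^sup>2 * edim l / c j + l powr (2 * r)))"
      if "j \<in> {..<m}" for j
      unfolding A_def c_def using that
      by (intro bias_expectation_le[OF D_subset D_nonempty l src C]) auto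
    show "(\<integral>z. noise z \<partial>PN N) \<le> E0\<^sup>2 * (\<Sum>j<m. c j * edim l * (512 * A j))"
      unfolding A_def c_def by (rule noise_le)
  qed auto
  also have "\<dots> = (\<Sum>j<m. 2 * (w j * (Cbias C * (A j * (l\<^sup>2 * edim l / c j + l powr (2 * r)))))
      + 2 * (1 / (real N)\<^sup>2 * (E0\<^sup>2 * (c j * edim l * (512 * A j)))))"
    by (simp only: sum.distrib sum_distrib_left)
  also have "\<dots> \<le> (\<Sum>j<m. (2 * Cbias C + 1024 * E0\<^sup>2) * bound_term r N (D j) l)"
  proof (rule sum_mono)
    fix j assume "j \<in> {..<m}"
    then have j: "j < m" by simp
    define B where "B = (Bc (card (D j)) l)\<^sup>2"
    define b where "b = l\<^sup>2 * edim l / c j + l powr (2 * r)"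
    have b: "b \<ge> 0" using edim c[OF j] by (simp add: b_def)
    have B: "B \<ge> 0" by (simp add: B_def)
    \<comment> \<open>The noise contributes c_j N(l) / N^2. Replacing N(l) by at most c_j B^2 turns
      this into the squared block weight times B^2: one weight stands in front of the summand, the
      other next to B^2.\<close>
    have "edim l / c j \<le> B"
      unfolding B_def c_def using c[OF j] l by (intro edim_div_le_Bc_square) (auto simp: c_def)
    then have "c j * edim l \<le> (c j)\<^sup>2 * B"
      using c[OF j] mult_left_mono[of "edim l / c j" B "(c j)\<^sup>2"] by (simp add: power2_eq_square)
    then have "2 * (1 / (real N)\<^sup>2 * (E0\<^sup>2 * (c j * edim l * (512 * A j))))
        \<le> 2 * (1 / (real N)\<^sup>2 * (E0\<^sup>2 * ((c j)\<^sup>2 * B * (512 * A j))))"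
      using A[OF j] by (intro mult_left_mono mult_right_mono) auto
    also have "\<dots> = 1024 * E0\<^sup>2 * (w j * A j * (w j * B))"
      by (simp add: c_def power2_eq_square)
    finally have noise: "2 * (1 / (real N)\<^sup>2 * (E0\<^sup>2 * (c j * edim l * (512 * A j))))
        \<le> 1024 * E0\<^sup>2 * (w j * A j * (w j * B))" .
    have "2 * Cbias C * (w j * A j * b) + 1024 * E0\<^sup>2 * (w j * A j * (w j * B))
        \<le> (2 * Cbias C + 1024 * E0\<^sup>2) * (w j * A j * b + w j * A j * (w j * B))"
    proof -
      have *: "p * x + p' * y \<le> (p + p') * (x + y)" if "p \<ge> 0" "p' \<ge> 0" "x \<ge> 0" "y \<ge> 0" for p p' x y :: real
        using mult_nonneg_nonneg[OF that(1,4)] mult_nonneg_nonneg[OF that(2,3)] by (simp add: algebra_simps)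
      show ?thesis by (rule *) (use Cb A[OF j] b B in auto)
    qed
    also have "w j * A j * b + w j * A j * (w j * B) = bound_term r N (D j) l"
      by (simp add: bound_term_def A_def b_def B_def c_def distrib_left)
    finally show "2 * (w j * (Cbias C * (A j * (l\<^sup>2 * edim l / c j + l powr (2 * r)))))
      + 2 * (1 / (real N)\<^sup>2 * (E0\<^sup>2 * (c j * edim l * (512 * A j))))
      \<le> (2 * Cbias C + 1024 * E0\<^sup>2) * bound_term r N (D j) l"
      using noise by (simp add: b_def mult.assoc mult.left_commute)
  qed
  also have "\<dots> = (2 * Cbias C + 1024 * E0\<^sup>2) * (\<Sum>j<m. bound_term r N (D j) l)"
    by (simp add: sum_distrib_left)
  finally show ?thesis .
qed

end

end

text \<open>g after \<open>fst\<close> is measurable for the sigma-algebra generated by the inputs,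
  so it may be pulled through the conditional expectation of the output. That expectation is f,
  hence almost everywhere f0, at the input.\<close>

lemma regression_function_orthogonal:
  fixes rho :: "('a::second_countable_topology \<times> real) measure"
  assumes rho: "prob_space rho" and sets_rho: "sets rho = sets borel"
    and reg: "regression_function rho f" and y: "AE z in rho. \<bar>snd z\<bar> \<le> M"
    and f: "AE x in marginal rho. f x = f0 x" and f0: "f0 \<in> borel_measurable borel" "\<And>x. \<bar>f0 x\<bar> \<le> d"
    and g: "g \<in> borel_measurable borel" "\<And>x. \<bar>g x\<bar> \<le> c"
  shows "(\<integral>p. (snd p - f0 (fst p)) * g (fst p) \<partial>rho) = 0"
proof -
  interpret prob_space rho by (rule rho)
  have sets_pair: "sets rho = sets (borel \<Otimes>\<^sub>M borel)" unfolding borel_prod by (rule sets_rho)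
  have [measurable]: "fst \<in> rho \<rightarrow>\<^sub>M borel" "snd \<in> rho \<rightarrow>\<^sub>M borel"
    unfolding measurable_cong_sets[OF sets_pair refl] by measurable
  note [measurable] = g(1) f0(1)
  define F where "F = vimage_algebra (space rho) fst (borel :: 'a measure)"
  have fst_F: "fst \<in> F \<rightarrow>\<^sub>M (borel :: 'a measure)"
    unfolding F_def by (rule measurable_vimage_algebra1) simp
  have "subalgebra rho F"
    unfolding subalgebra_def F_def
    using measurable_sets[OF \<open>fst \<in> rho \<rightarrow>\<^sub>M borel\<close>] by (auto simp: sets_vimage_algebra2)
  then interpret F: finite_measure_subalgebra rho F by unfold_locales
  have AE_f: "AE z in rho. real_cond_exp rho F snd z = f0 (fst z)"
  proof -
    have "AE z in rho. f (fst z) = f0 (fst z)"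
      using AE_distrD[OF \<open>fst \<in> rho \<rightarrow>\<^sub>M borel\<close> f[unfolded marginal_def]] .
    moreover have "AE z in rho. real_cond_exp rho F snd z = f (fst z)"
      using reg unfolding regression_function_def F_def by blast
    ultimately show ?thesis by eventually_elim simp
  qed
  have c: "c \<ge> 0" using g(2) abs_ge_zero order_trans by blast
  have int_y: "integrable rho (\<lambda>z. g (fst z) * snd z)"
  proof (rule integrable_const_bound[of _ "c * M"])
    show "AE z in rho. norm (g (fst z) * snd z) \<le> c * M"
      using y by eventually_elim (use g(2) c in \<open>auto simp: abs_mult intro!: mult_mono\<close>)
  qed measurable
  have int_f: "integrable rho (\<lambda>z. g (fst z) * f0 (fst z))"
  proof (rule integrable_const_bound[of _ "c * d"])
    have "\<bar>g x * f0 x\<bar> \<le> c * d" for x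
      unfolding abs_mult by (rule mult_mono[OF g(2) f0(2)]) (use c in auto)
    then show "AE z in rho. norm (g (fst z) * f0 (fst z)) \<le> c * d" by simp
  qed measurable
  have "(\<integral>z. g (fst z) * snd z \<partial>rho) = (\<integral>z. g (fst z) * real_cond_exp rho F snd z \<partial>rho)"
    by (rule F.real_cond_exp_intg(2)[symmetric, OF int_y measurable_compose[OF fst_F g(1)]]) measurable
  also have "\<dots> = (\<integral>z. g (fst z) * f0 (fst z) \<partial>rho)"
  proof (rule integral_cong_AE)
    show "AE z in rho. g (fst z) * real_cond_exp rho F snd z = g (fst z) * f0 (fst z)"
      using AE_f by eventually_elim simp
  qed (use borel_measurable_cond_exp2[of rho F snd] in measurable)
  finally have "(\<integral>z. g (fst z) * snd z \<partial>rho) - (\<integral>z. g (fst z) * f0 (fst z) \<partial>rho) = 0" by simp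
  then have "(\<integral>z. g (fst z) * snd z - g (fst z) * f0 (fst z) \<partial>rho) = 0"
    by (subst Bochner_Integration.integral_diff[OF int_y int_f])
  then show ?thesis by (simp add: algebra_simps)
qed

text \<open>Integrability is part of the claim because the integral of a nonintegrable function is 0
  by convention, which would make the bound alone uninformative.\<close>

theorem theorem2p5:
  fixes rho :: "('a::compact_metric_space \<times> real) measure"
    and K :: "'a \<Rightarrow> 'a \<Rightarrow> real"
    and H :: "('a \<Rightarrow> real) set"
    and ip :: "('a \<Rightarrow> real) \<Rightarrow> ('a \<Rightarrow> real) \<Rightarrow> real"
    and fstar ustar :: "'a \<Rightarrow> real"
    and M r :: real
  assumes "prob_space rho" and "sets rho = sets borel"
    and "mercer_kernel K" and "rkhs K H ip"
    and "regression_function rho fstar"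
    and "AE z in rho. \<bar>snd z\<bar> \<le> M"
    and "1 / 2 \<le> r" and "r \<le> 2"
    and "ustar \<in> L2 (marginal rho)"
    and "is_spectral_power (marginal rho) (integral_op (marginal rho) K) r ustar fstar"
  shows "\<exists>C::real. \<forall>(N::nat) (m::nat) (D::nat \<Rightarrow> nat set) (l::real).
    block_partition N m D \<longrightarrow> 0 < l \<longrightarrow> l \<le> 1 \<longrightarrow>
    integrable (PiM {..<N} (\<lambda>_. rho))
      (\<lambda>z. (L2_norm (marginal rho) (\<lambda>x. distributed_bcrkn K H l N m D z x - fstar x))\<^sup>2) \<and>
    (\<integral>z. (L2_norm (marginal rho) (\<lambda>x. distributed_bcrkn K H l N m D z x - fstar x))\<^sup>2
        \<partial>PiM {..<N} (\<lambda>_. rho))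
      \<le> C * (\<Sum>j<m. real (card (D j)) / real N *
          (B_complexity (marginal rho) K H ip (card (D j)) l / sqrt l + 1) ^ 6 *
          (real (card (D j)) / real N * (B_complexity (marginal rho) K H ip (card (D j)) l)\<^sup>2 +
           l\<^sup>2 * effective_dim (marginal rho) K H ip l / real (card (D j)) +
           l powr (2 * r)))"
proof -
  interpret rho: prob_space rho by fact
  have "sets rho = sets (borel \<Otimes>\<^sub>M borel)" unfolding borel_prod by fact
  then have fst_meas: "fst \<in> rho \<rightarrow>\<^sub>M (borel :: 'a measure)"
    using measurable_cong_sets measurable_fst by blast
  interpret rkhs K H ip by fact
  interpret mk: mercer_rkhs K H ip "marginal rho"
  proof (intro mercer_rkhs.intro mercer_rkhs_axioms.intro)
    show "rkhs K H ip" by fact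
    show "mercer_kernel K" by fact
    show "prob_space (marginal rho)" unfolding marginal_def by (rule rho.prob_space_distr[OF fst_meas])
    show "sets (marginal rho) = sets borel" by (simp add: marginal_def)
  qed
  obtain f0 where fH: "f0 \<in> H" "AE x in marginal rho. fstar x = f0 x" and ex_C: "\<exists>C\<ge>0. mk.source r C f0"
    using mk.spectral_power_source[OF assms(9,7,8,10)] by blast
  from ex_C obtain C where C: "C \<ge> 0" "mk.source r C f0" by blast
  interpret learning K H ip rho f0 M
  proof (intro learning.intro learning_axioms.intro)
    show "mercer_rkhs K H ip (marginal rho)" by (rule mk.mercer_rkhs_axioms)
    show "prob_space rho" "sets rho = sets borel" "f0 \<in> H" "AE p in rho. \<bar>snd p\<bar> \<le> M" by (fact assms(1,2,6) fH(1))+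
    fix g :: "'a \<Rightarrow> real" and c :: real
    assume "g \<in> borel_measurable borel" "\<And>x. \<bar>g x\<bar> \<le> c"
    then show "(\<integral>p. (snd p - f0 (fst p)) * g (fst p) \<partial>rho) = 0"
      by (rule regression_function_orthogonal[OF assms(1,2,5,6) fH(2) mk.H_measurable[OF fH(1)] mk.H_abs_eval_le[OF fH(1)]])
  qed
  \<comment> \<open>\<open>fstar\<close> may differ from \<open>f0\<close> on a null set; the L2
    norm does not notice, and afterwards the error is a member of \<open>H\<close> to which
    \<open>ip_L_self\<close> applies.\<close>
  have norm_eq: "(L2_norm (marginal rho) (\<lambda>x. distributed_bcrkn K H l N m D z x - fstar x))\<^sup>2
      = ip (mk.L (distributed_bcrkn K H l N m D z - f0)) (distributed_bcrkn K H l N m D z - f0)"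
    if "block_partition N m D" "0 < l" "l \<le> 1" for N m D l z
  proof -
    let ?e = "distributed_bcrkn K H l N m D z - f0"
    have e: "?e \<in> H" by (rule error_mem[OF that])
    have "(\<lambda>x. distributed_bcrkn K H l N m D z x) = ?e + f0" by simp
    then have meas: "(\<lambda>x. distributed_bcrkn K H l N m D z x) \<in> borel_measurable (marginal rho)"
      using mk.H_measurable_mu[OF H_add[OF e fH(1)]] by simp
    have fstar: "fstar \<in> borel_measurable (marginal rho)"
      using assms(10) by (auto simp: is_spectral_power_def L2_def)
    have "(L2_norm (marginal rho) (\<lambda>x. distributed_bcrkn K H l N m D z x - fstar x))\<^sup>2
        = (\<integral>x. (distributed_bcrkn K H l N m D z x - fstar x)\<^sup>2 \<partial>marginal rho)"
      by (simp add: L2_norm_def L2_inner_def power2_eq_square[symmetric])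
    also have "\<dots> = (\<integral>x. (?e x)\<^sup>2 \<partial>marginal rho)"
    proof (rule integral_cong_AE)
      show "AE x in marginal rho. (distributed_bcrkn K H l N m D z x - fstar x)\<^sup>2 = (?e x)\<^sup>2"
        using fH(2) by eventually_elim (simp add: fun_apply)
      show "(\<lambda>x. (?e x)\<^sup>2) \<in> borel_measurable (marginal rho)"
        using mk.H_measurable_mu[OF e] by measurable
    qed (use meas fstar in measurable)
    finally show ?thesis by (simp add: mk.ip_L_self[OF e])
  qed
  show ?thesis
  \<comment> \<open>C was fixed by the source condition before the partition and l;
    \<open>Cbias\<close> adds only kappa and the trace, and \<open>E0\<close> only M, kappa and the
    norm of f0. Both 2 and 1024 = 2 * 512 contain the factor from splitting bias and noise.\<close>
  proof (intro exI[of _ "2 * Cbias C + 1024 * E0\<^sup>2"] allI impI)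
    fix N m :: nat and D :: "nat \<Rightarrow> nat set" and l :: real
    assume A: "block_partition N m D" "0 < l" "l \<le> 1"
    show "integrable (PiM {..<N} (\<lambda>_. rho))
      (\<lambda>z. (L2_norm (marginal rho) (\<lambda>x. distributed_bcrkn K H l N m D z x - fstar x))\<^sup>2) \<and>
    (\<integral>z. (L2_norm (marginal rho) (\<lambda>x. distributed_bcrkn K H l N m D z x - fstar x))\<^sup>2
        \<partial>PiM {..<N} (\<lambda>_. rho))
      \<le> (2 * Cbias C + 1024 * E0\<^sup>2) * (\<Sum>j<m. real (card (D j)) / real N *
          (B_complexity (marginal rho) K H ip (card (D j)) l / sqrt l + 1) ^ 6 *
          (real (card (D j)) / real N * (B_complexity (marginal rho) K H ip (card (D j)) l)\<^sup>2 +
           l\<^sup>2 * effective_dim (marginal rho) K H ip l / real (card (D j)) +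
           l powr (2 * r)))"
      unfolding norm_eq[OF A]
      using error_integrable[OF A] error_expectation_le[OF A C(2,1)] by (simp add: bound_term_def)
  qed
qed

end
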